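(* Suppose that $x\mapsto F(-x)$ is regularly varying at infinity with index $-\alpha$ for some $\alpha\in(1,2)$, that $x\mapsto\overline F(x)$ is regularly varying at infinity with index $-\beta$ for some $\beta>\alpha$, and that $\mathsf{E}\{\xi\}=0$. Let $\{b_n\}$, $b_n\to\infty$, be determined (for large $n$) by $\Gamma(3-\alpha)\,n\mu_2(b_n)=(\alpha-1)b_n^2$, and suppose that $$\limsup_{n\to\infty}\frac{F(-b_n/[\log n]^{1/\alpha})}{(\log n)F(-b_n)}\le1 .$$ Furthermore, if $T<\infty$, suppose that $x\mapsto F(x+\Delta)$ is regularly varying at infinity. Then for any $t>1$, $\mathsf{P}\{S_n\in x+\Delta\}\sim nF(x+\Delta)$ as $n\to\infty$ uniformly for $$x\ge t\left(\frac{\beta-\alpha}{\alpha-1}\log n\right)^{(\alpha-1)/\alpha}b_n .$$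
   Context: Let $\xi,\xi_1,\xi_2,\dots$ be i.i.d. real random variables with distribution function $F(x)=\mathsf{P}\{\xi\le x\}$, and $S_n=\xi_1+\cdots+\xi_n$. Fix $T\in(0,\infty]$; put $\Delta=(0,T]$ if $T<\infty$ and $\Delta=(0,\infty)$ if $T=\infty$, and $F(x+\Delta)=\mathsf{P}\{\xi\in x+\Delta\}$ (so $F(x+\Delta)=\overline F(x)$ when $T=\infty$). Write $\overline F(x)=\mathsf{P}\{\xi>x\}$ and $\mu_2(x)=\int_{|y|\le x}y^2F(dy)$. $\Gamma$ is the Gamma function. "$\mathsf{P}\{S_n\in x+\Delta\}\sim nF(x+\Delta)$ uniformly for $x\ge x_n$" means $\lim_{n\to\infty}\sup_{x\ge x_n}\left|\frac{\mathsf{P}\{S_n\in x+\Delta\}}{nF(x+\Delta)}-1\right|=0$. *)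

theory Defs
  imports "HOL-Probability.Probability"
begin

definition regularly_varying :: "(real \<Rightarrow> real) \<Rightarrow> real \<Rightarrow> bool" where
  "regularly_varying f \<rho> \<longleftrightarrow>
     (\<exists>a. f \<in> borel_measurable (restrict_space borel {a..}) \<and> (\<forall>x\<ge>a. f x > 0)) \<and>
     (\<forall>c>0. ((\<lambda>x. f (c * x) / f x) \<longlongrightarrow> c powr \<rho>) at_top)"

text \<open>
  For a real T this is the interval (0, T]; for T infinite the second constraint is void and
  it is the open half-line of positive reals.
\<close>
definition Delta :: "ereal \<Rightarrow> real set" where
  "Delta T = {y. 0 < y \<and> ereal y \<le> T}"

definition shifted_Delta :: "real \<Rightarrow> ereal \<Rightarrow> real set" where
  "shifted_Delta x T = (\<lambda>y. x + y) ` Delta T"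

definition truncated_second_moment :: "real measure \<Rightarrow> real \<Rightarrow> real" where
  "truncated_second_moment D x = (LINT y:{y. \<bar>y\<bar> \<le> x}|D. y\<^sup>2)"

text \<open>
  The equivalence of p n x and q n x, as n tends to infinity, uniformly for x at least xs n.
  The supremum is taken in the extended reals, because a real supremum of an unbounded set
  would be an unspecified number.
\<close>
definition uniformly_equiv_from ::
    "(nat \<Rightarrow> real \<Rightarrow> real) \<Rightarrow> (nat \<Rightarrow> real \<Rightarrow> real) \<Rightarrow> (nat \<Rightarrow> real) \<Rightarrow> bool" where
  "uniformly_equiv_from p q xs \<longleftrightarrow>
     (\<lambda>n. SUP x\<in>{xs n..}. ereal \<bar>p n x / q n x - 1\<bar>) \<longlonglongrightarrow> 0"

end

theory Submission
  imports Defs "HOL-Real_Asymp.Real_Asymp"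
begin

text \<open>
  A large deviation of the walk is caused by one big jump. Given that some summand exceeds
  \<open>\<delta> * x\<close>, the remaining sum is \<open>o(x)\<close> (Chebyshev after truncation at \<open>x\<close>), and uniform
  convergence for regularly varying functions gives the asymptotics \<open>n * F(x + \<Delta>)\<close>. It remains
  to discard the event that no summand exceeds \<open>\<delta> * x\<close>. There the exponential Chebyshev
  inequality is used: with \<open>\<Lambda>(s) = E(exp (s * \<xi>) - 1 - s * \<xi>; \<xi> \<le> 0)\<close>, an Abelian theorem gives
  \<open>\<Lambda>(1 / x) \<sim> \<Gamma>(2 - \<alpha>) / (\<alpha> - 1) * F(- x)\<close>, so that by the choice of \<open>b\<close> and the limsup
  condition \<open>n * \<Lambda>(s)\<close> is asymptotically at most \<open>c0 * ln n / \<alpha>\<close> at the optimal tilt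
  \<open>s = (c0 * ln n) powr (1 / \<alpha>) / b n\<close>, where \<open>c0 = (\<beta> - \<alpha>) / (\<alpha> - 1)\<close>. The resulting bound
  beats \<open>n * P(\<xi> > x)\<close> by a power of \<open>n\<close> because \<open>t > 1\<close>. For finite \<open>T\<close> an additional factor
  \<open>1 / b n\<close>, up to a small power of \<open>n\<close>, comes from Fourier smoothing of the tilted law: its
  transform is strictly less than its value at the origin on a bounded range of frequencies,
  since the left tail handles the low ones and the mass on intervals \<open>x + \<Delta>\<close> the others.
\<close>

text \<open>The constant \<open>c0\<close> balances two exponents. On the scale of powers of n the
  sequence b has order 1 / \<alpha>, so n * P(\<xi> > x) has order 1 - \<beta> / \<alpha> at the
  threshold, while the exponential bound has order c0 / \<alpha> - t * c0. At t = 1 the two agree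
  exactly, and t > 1 leaves the surplus (t - 1) * c0, out of which all slowly varying errors are
  paid. Hence the constant in n * \<Lambda> has to be sharp and not merely of the right order. The
  obstacle is that 1 / s lies below b by a power of ln n: regular variation compares arguments of
  bounded ratio, and the limsup condition bridges the rest. One tilt per n cannot serve all x: far
  beyond the threshold the target decays only like a power of x, while exp (s * \<delta> * x)
  explodes; there s is of size ln x / x. For bounded intervals the target itself may be smaller than
  the tail by a factor of size 1 / x, and not by more: {x<..2 * x} is covered by about x translates
  of \<Delta> of comparable mass. This is why a gain of about 1 / b from Fourier smoothing is
  enough.\<close>

section \<open>Regular variation\<close>

text \<open>For each fixed shift w the convergence holds from some index on, so the sets of w that
  are good from index n on increase to \<open>{0..B}\<close>, and continuity of measure from below
  applies. The fraction 3/4 exceeds 1/2, so that two such sets can be forced to meet after a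
  translation.\<close>

lemma measure_close_shift_ge:
  fixes h :: "real \<Rightarrow> real" and p :: "nat \<Rightarrow> real"
  assumes meas: "h \<in> borel_measurable borel"
    and lim: "\<And>v. ((\<lambda>u. h (u + v) - h u) \<longlongrightarrow> 0) at_top"
    and "0 < e" "0 < B" and p: "filterlim p at_top sequentially"
  shows "\<forall>\<^sub>F n in sequentially.
    measure lborel {w\<in>{0..B}. \<forall>m\<ge>n. \<bar>h (p m + w) - h (p m)\<bar> < e} > 3/4 * B"
proof -
  define V where "V n = {w\<in>{0..B}. \<forall>m\<ge>n. \<bar>h (p m + w) - h (p m)\<bar> < e}" for n
  have hm: "(\<lambda>w. h (p m + w)) \<in> borel_measurable borel" for m
    using meas by measurable
  have Vm: "V n \<in> sets lborel" for n
  proof -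
    have "Measurable.pred borel (\<lambda>w. \<bar>h (p m + w) - h (p m)\<bar> < e)" for m
      using hm by measurable
    then have "Measurable.pred borel (\<lambda>w. \<forall>m\<ge>n. \<bar>h (p m + w) - h (p m)\<bar> < e)"
      by measurable
    then have "{w\<in>space borel. \<forall>m\<ge>n. \<bar>h (p m + w) - h (p m)\<bar> < e} \<in> sets borel"
      by (rule predE)
    then have "{0..B} \<inter> {w\<in>space borel. \<forall>m\<ge>n. \<bar>h (p m + w) - h (p m)\<bar> < e} \<in> sets borel"
      by (rule sets.Int[rotated]) simp
    also have "{0..B} \<inter> {w\<in>space borel. \<forall>m\<ge>n. \<bar>h (p m + w) - h (p m)\<bar> < e} = V n"
      by (auto simp: V_def)
    finally show ?thesis by simp
  qed
  have inc: "incseq V"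
    by (rule incseq_SucI) (auto simp: V_def dest: Suc_leD)
  have un: "(\<Union>n. V n) = {0..B}"
  proof
    show "{0..B} \<subseteq> (\<Union>n. V n)"
    proof
      fix w assume w: "w \<in> {0..B}"
      have "(\<lambda>n. h (p n + w) - h (p n)) \<longlonglongrightarrow> 0"
        by (rule filterlim_compose[OF lim p])
      from tendstoD[OF this \<open>0 < e\<close>] obtain N where "\<forall>n\<ge>N. \<bar>h (p n + w) - h (p n)\<bar> < e"
        by (auto simp: eventually_sequentially dist_real_def)
      with w show "w \<in> (\<Union>n. V n)" unfolding V_def by blast
    qed
  qed (auto simp: V_def)
  have "(\<lambda>n. measure lborel (V n)) \<longlonglongrightarrow> measure lborel (\<Union>n. V n)"
    using Vm inc un \<open>0 < B\<close> by (intro Lim_measure_incseq) auto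
  then have "(\<lambda>n. measure lborel (V n)) \<longlonglongrightarrow> B"
    using un \<open>0 < B\<close> by simp
  from order_tendstoD(1)[OF this, of "3/4 * B"] \<open>0 < B\<close>
  show ?thesis by (simp add: V_def)
qed

text \<open>This is the uniform convergence theorem for slowly varying functions in additive
  notation. If it fails along base points \<open>u n\<close> and shifts \<open>v n\<close>, the good
  sets for \<open>u n\<close> and for \<open>u n + v n\<close> each fill most of
  \<open>{0..B}\<close>. Translating the second by \<open>v n\<close> makes them meet, and a common
  point joins \<open>u n\<close> to \<open>u n + v n\<close> at a cost below e.\<close>

lemma shift_uniform_nonneg:
  fixes h :: "real \<Rightarrow> real"
  assumes meas: "h \<in> borel_measurable borel"
    and lim: "\<And>v. ((\<lambda>u. h (u + v) - h u) \<longlongrightarrow> 0) at_top"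
    and "0 < e" "0 \<le> A"
  shows "\<exists>U. \<forall>u\<ge>U. \<forall>v\<in>{0..A}. \<bar>h (u + v) - h u\<bar> < e"
proof (rule ccontr)
  assume "\<not> ?thesis"
  then have "\<forall>n. \<exists>u v. u \<ge> real n \<and> v \<in> {0..A} \<and> \<bar>h (u + v) - h u\<bar> \<ge> e"
    unfolding not_ex not_all not_less by (metis linorder_not_le)
  then obtain u v where u: "\<And>n. u n \<ge> real n" and v: "\<And>n. v n \<in> {0..A}"
    and uv: "\<And>n. \<bar>h (u n + v n) - h (u n)\<bar> \<ge> e"
    by metis
  \<comment> \<open>Two sets of measure above 3/4 * B cannot be disjoint inside
    \<open>{0..A + B}\<close>: 3/2 * B = 3 * A + 3, whereas A + B = 3 * A + 2.\<close>
  define B where "B = 2 * A + 2"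
  have B: "0 < B" using \<open>0 \<le> A\<close> by (simp add: B_def)
  have pu: "filterlim u at_top sequentially"
    by (rule filterlim_at_top_mono[OF filterlim_real_sequentially]) (simp add: u)
  have "real n \<le> u n + v n" for n using u[of n] v[of n] by auto
  then have puv: "filterlim (\<lambda>n. u n + v n) at_top sequentially"
    by (intro filterlim_at_top_mono[OF filterlim_real_sequentially]) simp
  define V where "V n = {w\<in>{0..B}. \<forall>m\<ge>n. \<bar>h (u m + w) - h (u m)\<bar> < e/2}" for n
  define W where "W n = {w\<in>{0..B}. \<forall>m\<ge>n. \<bar>h (u m + v m + w) - h (u m + v m)\<bar> < e/2}" for n
  have "\<forall>\<^sub>F n in sequentially. measure lborel (V n) > 3/4 * B \<and> measure lborel (W n) > 3/4 * B"
    unfolding V_def W_def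
    using measure_close_shift_ge[OF meas lim _ B pu, of "e/2"] measure_close_shift_ge[OF meas lim _ B puv, of "e/2"]
      \<open>0 < e\<close> by (auto intro: eventually_conj)
  then obtain n where n: "measure lborel (V n) > 3/4 * B" "measure lborel (W n) > 3/4 * B"
    by (auto simp: eventually_sequentially)
  have VM: "V n \<in> sets lborel" and WM: "W n \<in> sets lborel"
    using n B by (metis measure_notin_sets mult_pos_pos not_less_iff_gr_or_eq zero_less_divide_iff zero_less_numeral)+
  have mV: "V n \<in> lmeasurable" and mW: "W n \<in> lmeasurable"
  proof -
    have "bounded (V n)" "bounded (W n)"
      by (rule bounded_subset[OF bounded_closed_interval[of 0 B]], simp only: V_def W_def, blast)+
    then show "V n \<in> lmeasurable" "W n \<in> lmeasurable"
      using VM WM by (blast intro: bounded_set_imp_lmeasurable sets_completionI_sets)+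
  qed
  have lV: "measure lebesgue (V n) > 3/4 * B" and lW: "measure lebesgue (W n) > 3/4 * B"
    using n VM WM by (simp_all add: measure_completion)
  have mW': "(+) (v n) ` W n \<in> lmeasurable"
    using mW by (rule measurable_translation)
  have lW': "measure lebesgue ((+) (v n) ` W n) > 3/4 * B"
    using lW by (simp add: measure_translation)
  have "V n \<inter> (+) (v n) ` W n \<noteq> {}"
  proof
    assume "V n \<inter> (+) (v n) ` W n = {}"
    then have "measure lebesgue (V n \<union> (+) (v n) ` W n) = measure lebesgue (V n) + measure lebesgue ((+) (v n) ` W n)"
      by (intro measure_Un_AE mV mW') blast
    moreover have "measure lebesgue (V n \<union> (+) (v n) ` W n) \<le> measure lebesgue {0..A + B}"
    proof (rule measure_mono_fmeasurable)
      have "x \<in> {0..A + B}" if "x \<in> V n" for x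
        using that \<open>0 \<le> A\<close> by (simp add: V_def)
      moreover have "v n + x \<in> {0..A + B}" if "x \<in> W n" for x
        using that v[of n] by (simp add: W_def)
      ultimately show "V n \<union> (+) (v n) ` W n \<subseteq> {0..A + B}" by blast
      show "V n \<union> (+) (v n) ` W n \<in> sets lebesgue"
        using mV mW' by (blast intro: sets.Un fmeasurableD)
    qed simp
    moreover have "measure lebesgue {0..A + B} = A + B" using B \<open>0 \<le> A\<close> by simp
    ultimately show False using lV lW' by (simp add: B_def)
  qed
  then obtain w where w: "w \<in> W n" "v n + w \<in> V n" by auto
  have "\<bar>h (u n + (v n + w)) - h (u n)\<bar> < e/2" "\<bar>h (u n + v n + w) - h (u n + v n)\<bar> < e/2"
    using w by (auto simp: V_def W_def)
  then have "\<bar>h (u n + v n) - h (u n)\<bar> < e"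
    unfolding add.assoc by linarith
  with uv[of n] show False by simp
qed

text \<open>Negative shifts reduce to nonnegative ones by measuring both \<open>u\<close> and
  \<open>u + v\<close> from the point \<open>u - A\<close>.\<close>

lemma shift_uniform:
  fixes h :: "real \<Rightarrow> real"
  assumes meas: "h \<in> borel_measurable borel"
    and lim: "\<And>v. ((\<lambda>u. h (u + v) - h u) \<longlongrightarrow> 0) at_top"
    and "0 < e" "0 \<le> A"
  shows "\<exists>U. \<forall>u\<ge>U. \<forall>v\<in>{-A..A}. \<bar>h (u + v) - h u\<bar> < e"
proof -
  obtain U where U: "\<And>u v. u \<ge> U \<Longrightarrow> v \<in> {0..2*A} \<Longrightarrow> \<bar>h (u + v) - h u\<bar> < e/2"
    using shift_uniform_nonneg[OF meas lim half_gt_zero[OF \<open>0 < e\<close>], of "2*A"] \<open>0 \<le> A\<close> by force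
  show ?thesis
  proof (intro exI[of _ "U + A"] allI impI ballI)
    fix u v assume "U + A \<le> u" "v \<in> {-A..A}"
    with U[of "u - A" "v + A"] U[of "u - A" A] \<open>0 \<le> A\<close>
    have "\<bar>h (u + v) - h (u - A)\<bar> < e / 2" "\<bar>h u - h (u - A)\<bar> < e / 2" by auto
    then show "\<bar>h (u + v) - h u\<bar> < e" by linarith
  qed
qed

text \<open>Each unit step costs at most e, and the fractional remainder one more e. The linear
  growth in v becomes a power of y / x in Potter's bounds.\<close>

lemma shift_linear_bound:
  fixes h :: "real \<Rightarrow> real"
  assumes U: "\<And>u v. u \<ge> U \<Longrightarrow> v \<in> {0..1} \<Longrightarrow> \<bar>h (u + v) - h u\<bar> \<le> e"
    and "u \<ge> U" "0 \<le> v"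
  shows "\<bar>h (u + v) - h u\<bar> \<le> e + e * v"
proof -
  have e: "0 \<le> e" using U[of U 0] by simp
  have steps: "\<bar>h (u + real n) - h u\<bar> \<le> e * real n" for n
  proof (induction n)
    case (Suc n)
    have "\<bar>h (u + real n + 1) - h (u + real n)\<bar> \<le> e" using U[of "u + real n" 1] \<open>u \<ge> U\<close> by simp
    with Suc show ?case by (simp add: algebra_simps)
  qed simp
  define n where "n = nat \<lfloor>v\<rfloor>"
  have n: "real n \<le> v" "v \<le> real n + 1" using \<open>0 \<le> v\<close> unfolding n_def by linarith+
  have "\<bar>h (u + real n + (v - real n)) - h (u + real n)\<bar> \<le> e"
    using n \<open>u \<ge> U\<close> by (intro U) auto
  moreover have "\<bar>h (u + real n) - h u\<bar> \<le> e * v"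
    using steps[of n] mult_left_mono[OF n(1) e] by linarith
  ultimately show ?thesis by simp
qed

text \<open>The substitution x = exp u turns the slowly varying factor of f into a function whose
  increments over fixed shifts vanish at infinity.\<close>

lemma regularly_varying_log:
  assumes "regularly_varying f \<rho>"
  obtains h U where "h \<in> borel_measurable borel"
    "\<And>v. ((\<lambda>u. h (u + v) - h u) \<longlongrightarrow> 0) at_top"
    "\<And>x. ln x \<ge> U \<Longrightarrow> x > 0 \<Longrightarrow> f x = exp (h (ln x)) * x powr \<rho> \<and> f x > 0"
proof -
  from assms obtain a where a: "f \<in> borel_measurable (restrict_space borel {a..})" "\<And>x. x \<ge> a \<Longrightarrow> f x > 0"
    and lim: "\<And>c. c > 0 \<Longrightarrow> ((\<lambda>x. f (c * x) / f x) \<longlongrightarrow> c powr \<rho>) at_top"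
    unfolding regularly_varying_def by auto
  define A where "A = max a 1"
  \<comment> \<open>Regular variation gives measurability and positivity only on a half-line; the
    filling value 1 makes f' Borel and positive on the whole line.\<close>
  define f' where "f' x = (if x \<in> {A..} then f x else 1)" for x
  have "f \<in> borel_measurable (restrict_space borel {A..})"
  proof -
    have "f \<in> borel_measurable (restrict_space (restrict_space borel {a..}) {A..})"
      using a(1) by (rule measurable_restrict_space1)
    also have "restrict_space (restrict_space borel {a..}) {A..} = restrict_space borel {A..}"
      by (subst restrict_restrict_space) (auto simp: A_def Int_absorb1 Int_absorb2)
    finally show ?thesis .
  qed
  then have f'm: "f' \<in> borel_measurable borel"
    unfolding f'_def by (intro measurable_If_restrict_space_iff[THEN iffD2]) (auto simp: atLeast_def)
  define h where "h u = ln (f' (exp u)) - \<rho> * u" for u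
  have hm: "h \<in> borel_measurable borel" unfolding h_def using f'm by measurable
  have rep: "f x = exp (h (ln x)) * x powr \<rho> \<and> f x > 0" if "ln x \<ge> ln A" "x > 0" for x
  proof -
    have "x \<ge> A" using that by (simp add: A_def)
    then have "f x > 0" "f' x = f x" using a(2) by (auto simp: A_def f'_def)
    then show ?thesis using \<open>x > 0\<close>
      by (simp add: h_def exp_diff powr_def)
  qed
  have hlim: "((\<lambda>u. h (u + v) - h u) \<longlongrightarrow> 0) at_top" for v
  proof -
    have "((\<lambda>u. f (exp v * exp u) / f (exp u)) \<longlongrightarrow> exp v powr \<rho>) at_top"
      by (rule filterlim_compose[OF lim exp_at_top]) simp
    then have "((\<lambda>u. ln (f (exp v * exp u) / f (exp u)) - \<rho> * v) \<longlongrightarrow> ln (exp v powr \<rho>) - \<rho> * v) at_top"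
      by (intro tendsto_intros) auto
    moreover have "\<forall>\<^sub>F u in at_top. ln (f (exp v * exp u) / f (exp u)) - \<rho> * v = h (u + v) - h u"
      using eventually_ge_at_top[of "ln A"] eventually_ge_at_top[of "ln A - v"]
    proof eventually_elim
      case (elim u)
      have "exp (u + v) \<ge> exp (ln A)" "exp u \<ge> exp (ln A)" using elim by (simp_all only: exp_le_cancel_iff)
      then have "f' (exp (u + v)) = f (exp (u + v))" "f' (exp u) = f (exp u)" "f (exp (u+v)) > 0" "f (exp u) > 0"
        using a(2) by (auto simp: f'_def A_def)
      then show ?case
        by (simp add: h_def exp_add[symmetric] ln_div algebra_simps)
    qed
    ultimately show ?thesis by (subst (asm) tendsto_cong) (simp_all add: ln_powr)
  qed
  show ?thesis by (rule that[OF hm hlim rep])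
qed

text \<open>The multiplicative form of \<open>shift_uniform\<close>: for c in a compact part of the
  positive axis, ln c stays in a bounded interval.\<close>

lemma regularly_varying_uniform:
  assumes "regularly_varying f \<rho>" "0 < a" "0 < e"
  shows "\<exists>X>0. \<forall>x\<ge>X. \<forall>c\<in>{a..b}. 0 < f x \<and> 0 < f (c * x) \<and>
    exp (- e) * c powr \<rho> * f x \<le> f (c * x) \<and> f (c * x) \<le> exp e * c powr \<rho> * f x"
proof -
  obtain h U where hm: "h \<in> borel_measurable borel"
    and lim: "\<And>v. ((\<lambda>u. h (u + v) - h u) \<longlongrightarrow> 0) at_top"
    and rep: "\<And>x. ln x \<ge> U \<Longrightarrow> x > 0 \<Longrightarrow> f x = exp (h (ln x)) * x powr \<rho> \<and> f x > 0"
    by (rule regularly_varying_log[OF assms(1)]) (rule that)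
  define A where "A = \<bar>ln a\<bar> + \<bar>ln b\<bar>"
  obtain U' where U': "\<And>u v. u \<ge> U' \<Longrightarrow> v \<in> {-A..A} \<Longrightarrow> \<bar>h (u + v) - h u\<bar> < e"
    using shift_uniform[OF hm lim \<open>0 < e\<close>, of A] unfolding A_def by fastforce
  show ?thesis
  proof (intro exI[of _ "exp (max U' (\<bar>U\<bar> + A))"] conjI allI impI ballI)
    fix x c assume x: "exp (max U' (\<bar>U\<bar> + A)) \<le> x" and c: "c \<in> {a..b}"
    have x0: "x > 0" using x exp_gt_zero[of "max U' (\<bar>U\<bar> + A)"] by linarith
    have c0: "c > 0" using c assms by auto
    have lx: "ln x \<ge> max U' (\<bar>U\<bar> + A)" using x x0 by (simp only: ln_ge_iff)
    have "ln a \<le> ln c" "ln c \<le> ln b" using c c0 assms by auto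
    then have lc: "ln c \<in> {-A..A}" unfolding A_def by auto
    have d: "\<bar>h (ln x + ln c) - h (ln x)\<bar> < e" using U'[OF _ lc] lx by simp
    have lcx: "ln (c * x) = ln x + ln c" using c0 x0 by (simp add: ln_mult)
    have A0: "A \<ge> 0" by (simp add: A_def)
    have 1: "f x = exp (h (ln x)) * x powr \<rho> \<and> f x > 0"
      using lx x0 A0 by (intro rep) auto
    have 2: "f (c * x) = exp (h (ln x + ln c)) * (c * x) powr \<rho> \<and> f (c * x) > 0"
      using rep[of "c*x"] lx lc x0 c0 A0 lcx by auto
    show "f x > 0" "f (c * x) > 0" using 1 2 by auto
    have e1: "exp (- e) * exp (h (ln x)) \<le> exp (h (ln x + ln c))"
      unfolding exp_add[symmetric] using d by simp
    have e2: "exp (h (ln x + ln c)) \<le> exp e * exp (h (ln x))"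
      unfolding exp_add[symmetric] using d by simp
    have cx: "(c * x) powr \<rho> = c powr \<rho> * x powr \<rho>" using c0 x0 by (simp add: powr_mult)
    have "exp (- e) * exp (h (ln x)) * (c powr \<rho> * x powr \<rho>) \<le> exp (h (ln x + ln c)) * (c powr \<rho> * x powr \<rho>)"
      by (intro mult_right_mono e1) auto
    then show "exp (- e) * c powr \<rho> * f x \<le> f (c * x)" using 1 2 cx by (simp add: mult_ac)
    have "exp (h (ln x + ln c)) * (c powr \<rho> * x powr \<rho>) \<le> exp e * exp (h (ln x)) * (c powr \<rho> * x powr \<rho>)"
      by (intro mult_right_mono e2) auto
    then show "f (c * x) \<le> exp e * c powr \<rho> * f x" using 1 2 cx by (simp add: mult_ac)
  qed simp
qed

text \<open>Potter's bounds: \<open>shift_linear_bound\<close> with the shift ln (y / x). The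
  constant part of the error gives the factor exp e, the linear part the change of exponent.\<close>

lemma regularly_varying_potter:
  assumes "regularly_varying f \<rho>" "0 < e"
  shows "\<exists>X>0. \<forall>x\<ge>X. \<forall>y\<ge>x. 0 < f x \<and>
    exp (- e) * (y / x) powr (\<rho> - e) * f x \<le> f y \<and> f y \<le> exp e * (y / x) powr (\<rho> + e) * f x"
proof -
  obtain h U where hm: "h \<in> borel_measurable borel"
    and lim: "\<And>v. ((\<lambda>u. h (u + v) - h u) \<longlongrightarrow> 0) at_top"
    and rep: "\<And>x. ln x \<ge> U \<Longrightarrow> x > 0 \<Longrightarrow> f x = exp (h (ln x)) * x powr \<rho> \<and> f x > 0"
    by (rule regularly_varying_log[OF assms(1)]) (rule that)
  obtain U' where U': "\<And>u v. u \<ge> U' \<Longrightarrow> v \<in> {0..1} \<Longrightarrow> \<bar>h (u + v) - h u\<bar> \<le> e"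
    using shift_uniform_nonneg[OF hm lim \<open>0 < e\<close>, of 1] by (metis less_imp_le zero_le_one)
  show ?thesis
  proof (intro exI[of _ "exp (max U' U)"] conjI allI impI ballI)
    fix x y assume x: "exp (max U' U) \<le> x" and y: "x \<le> y"
    have x0: "x > 0" using x exp_gt_zero[of "max U' U"] by linarith
    have y0: "y > 0" using x0 y by simp
    have lx: "ln x \<ge> max U' U" using x x0 by (simp only: ln_ge_iff)
    have lxy: "ln x \<le> ln y" using x0 y by simp
    define l where "l = ln (y / x)"
    have ll: "l = ln y - ln x" using x0 y0 by (simp add: l_def ln_div)
    have d: "\<bar>h (ln x + l) - h (ln x)\<bar> \<le> e + e * l"
      using lx lxy ll by (intro shift_linear_bound[OF U']) auto
    then have d: "\<bar>h (ln y) - h (ln x)\<bar> \<le> e + e * l" unfolding ll by simp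
    have 1: "f x = exp (h (ln x)) * x powr \<rho> \<and> f x > 0"
      using lx x0 by (intro rep) auto
    have 2: "f y = exp (h (ln y)) * y powr \<rho>"
      using lx lxy y0 by (intro rep[THEN conjunct1]) auto
    show "f x > 0" using 1 by auto
    have pw: "(y / x) powr r = exp (r * l)" for r
      using x0 y0 by (simp add: powr_def l_def)
    have yx: "y powr \<rho> = exp (\<rho> * ln y)" "x powr \<rho> = exp (\<rho> * ln x)" using x0 y0 by (simp_all add: powr_def)
    have "exp (- e) * (y / x) powr (\<rho> - e) * f x = exp (- e + (\<rho> - e) * l + h (ln x) + \<rho> * ln x)"
      using 1 by (simp add: pw yx exp_add[symmetric] mult_ac)
    also have "\<dots> \<le> exp (h (ln y) + \<rho> * ln y)"
      using d by (simp add: ll algebra_simps)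
    also have "\<dots> = f y" using 2 by (simp add: yx exp_add)
    finally show "exp (- e) * (y / x) powr (\<rho> - e) * f x \<le> f y" .
    have "f y = exp (h (ln y) + \<rho> * ln y)" using 2 by (simp add: yx exp_add)
    also have "\<dots> \<le> exp (e + (\<rho> + e) * l + h (ln x) + \<rho> * ln x)"
      using d by (simp add: ll algebra_simps)
    also have "\<dots> = exp e * (y / x) powr (\<rho> + e) * f x"
      using 1 by (simp add: pw yx exp_add[symmetric] mult_ac)
    finally show "f y \<le> exp e * (y / x) powr (\<rho> + e) * f x" .
  qed simp
qed

lemma regularly_varying_power_bounds:
  assumes "regularly_varying f \<rho>" "0 < e"
  shows "\<exists>X>0. \<exists>c>0. \<exists>C>0. \<forall>x\<ge>X. c * x powr (\<rho> - e) \<le> f x \<and> f x \<le> C * x powr (\<rho> + e)"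
proof -
  obtain X where X: "X > 0" "\<And>x y. x \<ge> X \<Longrightarrow> y \<ge> x \<Longrightarrow> 0 < f x \<and>
    exp (- e) * (y / x) powr (\<rho> - e) * f x \<le> f y \<and> f y \<le> exp e * (y / x) powr (\<rho> + e) * f x"
    using regularly_varying_potter[OF assms] by blast
  have "exp (-e) / X powr (\<rho> - e) * f X * y powr (\<rho> - e) \<le> f y \<and>
    f y \<le> exp e / X powr (\<rho> + e) * f X * y powr (\<rho> + e)" if "y \<ge> X" for y
    using X(2)[OF order_refl that] X(1) that
    by (simp add: powr_divide mult_ac)
  moreover have "f X > 0" using X(2)[of X X] by simp
  ultimately show ?thesis using X(1)
    by (intro exI[of _ X] conjI exI[of _ "exp (-e) / X powr (\<rho> - e) * f X"] exI[of _ "exp e / X powr (\<rho> + e) * f X"]) auto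
qed

section \<open>Integrals of regularly varying tails\<close>

text \<open>A nonnegative function with a gauge integral is absolutely integrable, and Borel
  measurability allows the completed measure to be replaced by \<open>lborel\<close>.\<close>

lemma nonneg_has_integral_imp_set_integral:
  fixes f :: "real \<Rightarrow> real"
  assumes f: "f \<in> borel_measurable borel" and S: "S \<in> sets borel"
    and nn: "\<And>x. x \<in> S \<Longrightarrow> 0 \<le> f x" and I: "(f has_integral I) S"
  shows "set_integrable lborel S f" "(LINT x:S|lborel. f x) = I"
proof -
  have "f absolutely_integrable_on S"
    using I nn by (intro nonnegative_absolutely_integrable_1) (auto simp: integrable_on_def)
  then have "integrable (completion lborel) (\<lambda>x. indicator S x *\<^sub>R f x)"
    by (simp add: set_integrable_def)
  then show *: "set_integrable lborel S f"
    unfolding set_integrable_def using f S by (subst (asm) integrable_completion) auto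
  show "(LINT x:S|lborel. f x) = I"
    using set_borel_integral_eq_integral(2)[OF *] I by (simp add: integral_unique)
qed

text \<open>Tonelli, applied to \<phi>(y) written as the integral of k over 0 < u \<le> y.
  Expressing expectations through tails lets regular variation of a tail act on exponential and
  truncated moments.\<close>

lemma (in prob_space) layer_cake:
  fixes Y :: "'a \<Rightarrow> real" and k \<phi> :: "real \<Rightarrow> real"
  assumes Y[measurable]: "Y \<in> borel_measurable M"
    and k[measurable]: "k \<in> borel_measurable borel" and \<phi>[measurable]: "\<phi> \<in> borel_measurable borel"
    and k0: "\<And>u. u \<ge> 0 \<Longrightarrow> 0 \<le> k u" and \<phi>k: "\<And>y. y \<ge> 0 \<Longrightarrow> (k has_integral \<phi> y) {0..y}"
    and int: "set_integrable lborel {0<..} (\<lambda>u. k u * prob {\<omega>\<in>space M. u \<le> Y \<omega>})"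
  shows "integrable M (\<lambda>\<omega>. \<phi> (max 0 (Y \<omega>)))"
    "expectation (\<lambda>\<omega>. \<phi> (max 0 (Y \<omega>))) = (LINT u:{0<..}|lborel. k u * prob {\<omega>\<in>space M. u \<le> Y \<omega>})"
proof -
  interpret pair_sigma_finite M lborel ..
  have \<phi>0: "\<phi> y \<ge> 0" if "y \<ge> 0" for y
    using has_integral_nonneg[OF \<phi>k[OF that]] k0 by simp
  have \<phi>nn: "ennreal (\<phi> (max 0 y)) = (\<integral>\<^sup>+u. ennreal (indicator {0<..} u * k u) * indicator {u. u \<le> y} u \<partial>lborel)" for y
  proof (cases "y \<ge> 0")
    case True
    have "(\<integral>\<^sup>+u. ennreal (indicator {0..y} u * k u) \<partial>lborel) = ennreal (\<phi> y)"
      using k0 \<phi>k[OF True] by (intro nn_integral_has_integral_lebesgue) auto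
    also have "(\<integral>\<^sup>+u. ennreal (indicator {0..y} u * k u) \<partial>lborel) = (\<integral>\<^sup>+u. ennreal (indicator {0<..} u * k u) * indicator {u. u \<le> y} u \<partial>lborel)"
      using AE_lborel_singleton[of 0]
      by (intro nn_integral_cong_AE) (auto split: split_indicator)
    finally show ?thesis using True by (simp add: max_def)
  next
    case False
    have "\<phi> 0 = 0" using \<phi>k[of 0] by (simp add: has_integral_refl has_integral_unique)
    moreover have "(\<integral>\<^sup>+u. ennreal (indicator {0<..} u * k u) * indicator {u. u \<le> y} u \<partial>lborel) = (\<integral>\<^sup>+u. 0 \<partial>(lborel :: real measure))"
      using False by (intro nn_integral_cong) (auto split: split_indicator)
    ultimately show ?thesis using False by (simp add: max_def)
  qed
  have "(\<integral>\<^sup>+\<omega>. ennreal (\<phi> (max 0 (Y \<omega>))) \<partial>M)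
    = (\<integral>\<^sup>+\<omega>. (\<integral>\<^sup>+u. ennreal (indicator {0<..} u * k u) * indicator {u. u \<le> Y \<omega>} u \<partial>lborel) \<partial>M)"
    by (simp add: \<phi>nn)
  also have "\<dots> = (\<integral>\<^sup>+u. (\<integral>\<^sup>+\<omega>. ennreal (indicator {0<..} u * k u) * indicator {u. u \<le> Y \<omega>} u \<partial>M) \<partial>lborel)"
    by (rule Fubini'[symmetric]) measurable
  also have "\<dots> = (\<integral>\<^sup>+u. ennreal (indicator {0<..} u * (k u * prob {\<omega>\<in>space M. u \<le> Y \<omega>})) \<partial>lborel)"
  proof (intro nn_integral_cong)
    fix u :: real
    have "(\<integral>\<^sup>+\<omega>. ennreal (indicator {0<..} u * k u) * indicator {u. u \<le> Y \<omega>} u \<partial>M)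
      = (\<integral>\<^sup>+\<omega>. ennreal (indicator {0<..} u * k u) * indicator {\<omega>\<in>space M. u \<le> Y \<omega>} \<omega> \<partial>M)"
      by (intro nn_integral_cong) (auto split: split_indicator)
    also have "\<dots> = ennreal (indicator {0<..} u * k u) * emeasure M {\<omega>\<in>space M. u \<le> Y \<omega>}"
      by (intro nn_integral_cmult_indicator) measurable
    also have "\<dots> = ennreal (indicator {0<..} u * (k u * prob {\<omega>\<in>space M. u \<le> Y \<omega>}))"
      using k0 by (auto simp: emeasure_eq_measure ennreal_mult[symmetric] split: split_indicator)
    finally show "(\<integral>\<^sup>+\<omega>. ennreal (indicator {0<..} u * k u) * indicator {u. u \<le> Y \<omega>} u \<partial>M)
      = ennreal (indicator {0<..} u * (k u * prob {\<omega>\<in>space M. u \<le> Y \<omega>}))" .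
  qed
  also have "\<dots> = ennreal (LINT u:{0<..}|lborel. k u * prob {\<omega>\<in>space M. u \<le> Y \<omega>})"
    using int k0 unfolding set_integrable_def set_lebesgue_integral_def
    by (subst nn_integral_eq_integral) (auto split: split_indicator)
  finally have *: "(\<integral>\<^sup>+\<omega>. ennreal (\<phi> (max 0 (Y \<omega>))) \<partial>M) = ennreal (LINT u:{0<..}|lborel. k u * prob {\<omega>\<in>space M. u \<le> Y \<omega>})" .
  show i: "integrable M (\<lambda>\<omega>. \<phi> (max 0 (Y \<omega>)))"
    using * \<phi>0 by (intro integrableI_nonneg) auto
  have "(LINT u:{0<..}|lborel. k u * prob {\<omega>\<in>space M. u \<le> Y \<omega>}) \<ge> 0"
    unfolding set_lebesgue_integral_def using k0 by (intro integral_nonneg_AE) (auto split: split_indicator)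
  then show "expectation (\<lambda>\<omega>. \<phi> (max 0 (Y \<omega>))) = (LINT u:{0<..}|lborel. k u * prob {\<omega>\<in>space M. u \<le> Y \<omega>})"
    using * \<phi>0 by (intro integral_eq_nn_integral[THEN trans]) auto
qed

text \<open>A bound for all u > 0 at once, as dominated convergence requires. Potter's bounds work
  while \<open>u * x\<close> is at least X. Below X only G \<le> 1 is available; there Potter's
  lower bound from X up to x shows that the right-hand side is already at least 1, which explains C
  = exp e / G X.\<close>

lemma regularly_varying_rescaled_bound:
  assumes rv: "regularly_varying G (- \<alpha>)" and G1: "\<And>x. 0 \<le> G x" "\<And>x. G x \<le> 1"
    and e: "0 < e" and "0 \<le> \<alpha>"
  shows "\<exists>X>0. \<exists>C>0. \<forall>x\<ge>X. 0 < G x \<and> (\<forall>u>0. G (u * x) \<le> C * G x * (if u \<le> 1 then u powr (- \<alpha> - e) else u powr (- \<alpha> + e)))"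
proof -
  obtain X where X: "X > 0" "\<And>x y. x \<ge> X \<Longrightarrow> y \<ge> x \<Longrightarrow> 0 < G x \<and>
    exp (- e) * (y / x) powr (- \<alpha> - e) * G x \<le> G y \<and> G y \<le> exp e * (y / x) powr (- \<alpha> + e) * G x"
    using regularly_varying_potter[OF rv e] by blast
  define C where "C = exp e / G X"
  have GX: "0 < G X" "G X \<le> 1" using X(2)[of X X] G1 by auto
  then have C: "exp e \<le> C" "C > 0" by (auto simp: C_def field_simps)
  show ?thesis
  proof (rule exI[of _ X], intro conjI X(1), rule exI[of _ C], intro conjI C(2) allI impI)
    fix x assume x: "x \<ge> X"
    then have x0: "x > 0" and Gx: "G x > 0" using X(1) X(2)[of x x] by auto
    show "G x > 0" by (rule Gx)
    fix u :: real assume u: "u > 0"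
    consider "u > 1" | "u \<le> 1" "u * x \<ge> X" | "u \<le> 1" "u * x < X" by linarith
    then show "G (u * x) \<le> C * G x * (if u \<le> 1 then u powr (- \<alpha> - e) else u powr (- \<alpha> + e))"
    proof cases
      case 1
      then have "G (u * x) \<le> exp e * u powr (- \<alpha> + e) * G x"
        using X(2)[of x "u * x"] x x0 by auto
      also have "\<dots> \<le> C * u powr (- \<alpha> + e) * G x"
        using Gx C by (intro mult_right_mono) auto
      finally show ?thesis using 1 by (simp add: mult_ac)
    next
      case 2
      have "u * x \<le> x" using 2 x0 by (simp add: mult_le_cancel_right1)
      with 2 X(2)[of "u * x" x] have "exp (- e) * (x / (u * x)) powr (- \<alpha> - e) * G (u * x) \<le> G x" by auto
      also have "x / (u * x) = inverse u" using x0 by (simp add: field_simps)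
      also have "inverse u powr (- \<alpha> - e) = inverse (u powr (- \<alpha> - e))"
        using u by (simp add: inverse_powr)
      finally have "G (u * x) \<le> exp e * G x * u powr (- \<alpha> - e)"
        using u by (simp add: exp_minus field_simps)
      also have "\<dots> \<le> C * G x * u powr (- \<alpha> - e)"
        using Gx C by (intro mult_right_mono) auto
      finally show ?thesis using 2 by simp
    next
      case 3
      have "exp (- e) * (x / X) powr (- \<alpha> - e) * G X \<le> G x"
        using X(2)[of X x] x by auto
      then have 1: "1 \<le> C * G x * (X / x) powr (- \<alpha> - e)"
        using X(1) x0 GX by (simp add: C_def exp_minus powr_divide field_simps)
      have "(X / x) powr (- \<alpha> - e) \<le> u powr (- \<alpha> - e)"
        using 3 x0 u e \<open>0 \<le> \<alpha>\<close> by (intro powr_mono2') (auto simp: field_simps)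
      then have "C * G x * (X / x) powr (- \<alpha> - e) \<le> C * G x * u powr (- \<alpha> - e)"
        using C Gx by (intro mult_left_mono) auto
      with 1 G1(2)[of "u * x"] 3 show ?thesis by auto
    qed
  qed
qed

lemma set_integrable_powr_pieces:
  fixes p q :: real
  assumes "p > -1" "q < -1"
  shows "set_integrable lborel {0<..} (\<lambda>u. if u \<le> 1 then u powr p else u powr q)"
proof -
  have 1: "set_integrable lborel {0..1} (\<lambda>u. u powr p)"
    using has_integral_powr_from_0[OF assms(1), of 1]
    by (intro nonneg_has_integral_imp_set_integral(1)) auto
  have 2: "set_integrable lborel {1..} (\<lambda>u. u powr q)"
    using has_integral_powr_to_inf[OF assms(2), of 1]
    by (intro nonneg_has_integral_imp_set_integral(1)) auto
  have 3: "set_integrable lborel {0<..1} (\<lambda>u. u powr p)"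
    by (rule set_integrable_subset[OF 1]) auto
  have 4: "set_integrable lborel {1<..} (\<lambda>u. u powr q)"
    by (rule set_integrable_subset[OF 2]) auto
  show ?thesis
    using Bochner_Integration.integrable_add[OF 3[unfolded set_integrable_def] 4[unfolded set_integrable_def]]
    unfolding set_integrable_def
    by (rule Bochner_Integration.integrable_cong[OF refl, THEN iffD1, rotated]) (auto split: split_indicator)
qed

text \<open>Dominated convergence with the rescaled Potter bound. The kernel is at most linear near
  0 and bounded at infinity, hence integrable against u powr (- \<alpha>) because 1 < \<alpha> < 2.
  The factor 2 admits the kernel 2 * u of the truncated second moment.\<close>

lemma regularly_varying_integral_limit:
  fixes k :: "real \<Rightarrow> real"
  assumes rv: "regularly_varying G (- \<alpha>)" and \<alpha>: "1 < \<alpha>" "\<alpha> < 2"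
    and G1: "\<And>x. 0 \<le> G x" "\<And>x. G x \<le> 1" and G[measurable]: "G \<in> borel_measurable borel"
    and k[measurable]: "k \<in> borel_measurable borel"
    and k0: "\<And>u. u > 0 \<Longrightarrow> 0 \<le> k u" "\<And>u. u > 0 \<Longrightarrow> k u \<le> 2 * min u 1"
  shows "((\<lambda>x. (LINT u:{0<..}|lborel. k u * G (u * x)) / G x) \<longlongrightarrow> (LINT u:{0<..}|lborel. k u * u powr (- \<alpha>))) at_top"
    and "set_integrable lborel {0<..} (\<lambda>u. k u * u powr (- \<alpha>))"
    and "\<forall>\<^sub>F x in at_top. 0 < G x \<and> set_integrable lborel {0<..} (\<lambda>u. k u * G (u * x))"
proof -
  \<comment> \<open>Half the distance from \<alpha> to the nearer of 1 and 2 keeps both perturbed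
    exponents on the integrable side of -1.\<close>
  define e where "e = min (\<alpha> - 1) (2 - \<alpha>) / 2"
  have e: "0 < e" "\<alpha> + e < 2" "- \<alpha> + e < -1" using \<alpha> by (auto simp: e_def min_def field_simps)
  obtain X C where X: "X > 0" and C: "C > 0"
    and XC: "\<And>x. x \<ge> X \<Longrightarrow> 0 < G x"
      "\<And>x u. x \<ge> X \<Longrightarrow> u > 0 \<Longrightarrow> G (u * x) \<le> C * G x * (if u \<le> 1 then u powr (- \<alpha> - e) else u powr (- \<alpha> + e))"
    using regularly_varying_rescaled_bound[OF rv G1 e(1)] \<alpha> by auto
  define w where "w u = (if u \<le> 1 then u powr (1 - \<alpha> - e) else u powr (- \<alpha> + e))" for u :: real
  have w: "set_integrable lborel {0<..} w"
    unfolding w_def using e by (intro set_integrable_powr_pieces) auto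
  have kw: "k u * (if u \<le> 1 then u powr (- \<alpha> - e) else u powr (- \<alpha> + e)) \<le> 2 * w u" if "u > 0" for u
  proof (cases "u \<le> 1")
    case True
    have "k u * u powr (- \<alpha> - e) \<le> 2 * u * u powr (- \<alpha> - e)"
      using k0(2)[OF that] True by (intro mult_right_mono) auto
    also have "2 * u * u powr (- \<alpha> - e) = 2 * u powr (1 - \<alpha> - e)"
      using that powr_add[of u 1 "- \<alpha> - e"] by (simp add: algebra_simps)
    finally show ?thesis using True by (simp add: w_def)
  next
    case False
    then show ?thesis using k0(2)[OF that] by (auto simp: w_def intro!: mult_right_mono)
  qed
  have dom: "k u * G (u * x) / G x \<le> 2 * C * w u" if "x \<ge> X" "u > 0" for x u
  proof -
    have "k u * G (u * x) \<le> k u * (C * G x * (if u \<le> 1 then u powr (- \<alpha> - e) else u powr (- \<alpha> + e)))"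
      using XC(2)[OF that] k0(1)[OF that(2)] by (rule mult_left_mono)
    also have "\<dots> = C * G x * (k u * (if u \<le> 1 then u powr (- \<alpha> - e) else u powr (- \<alpha> + e)))" by (simp only: mult_ac)
    also have "\<dots> \<le> C * G x * (2 * w u)" using kw[OF that(2)] C XC(1)[OF that(1)] by (intro mult_left_mono) auto
    finally show ?thesis using XC(1)[OF that(1)] by (simp add: field_simps)
  qed
  have Gu: "((\<lambda>x. G (u * x) / G x) \<longlongrightarrow> u powr (- \<alpha>)) at_top" if "u > 0" for u
    using rv that by (auto simp: regularly_varying_def)
  have w2: "integrable lborel (\<lambda>u. indicator {0<..} u * (2 * C * w u))"
    using integrable_mult_left[OF w[unfolded set_integrable_def], of "2 * C"] by (simp add: mult_ac)
  have lim0: "((\<lambda>x. LINT u|lborel. indicator {0<..} u * (k u * G (u * x) / G x)) \<longlongrightarrow> (LINT u|lborel. indicator {0<..} u * (k u * u powr (- \<alpha>)))) at_top"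
  proof (rule integral_dominated_convergence_at_top[where w="\<lambda>u. indicator {0<..} u * (2 * C * w u)"])
    show "AE u in lborel. ((\<lambda>x. indicator {0<..} u * (k u * G (u * x) / G x)) \<longlongrightarrow> indicator {0<..} u * (k u * u powr - \<alpha>)) at_top"
    proof (intro AE_I2)
      fix u :: real
      show "((\<lambda>x. indicator {0<..} u * (k u * G (u * x) / G x)) \<longlongrightarrow> indicator {0<..} u * (k u * u powr - \<alpha>)) at_top"
        using Gu[of u] tendsto_mult_left[of "\<lambda>x. G (u * x) / G x" "u powr (- \<alpha>)" at_top "k u"] by (cases "u > 0") auto
    qed
    show "\<forall>\<^sub>F x in at_top. AE u in lborel. norm (indicator {0<..} u * (k u * G (u * x) / G x)) \<le> indicator {0<..} u * (2 * C * w u)"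
      using eventually_ge_at_top[of X]
    proof eventually_elim
      case (elim x)
      show ?case using dom[OF elim] k0(1) G1(1) by (intro AE_I2) (auto split: split_indicator)
    qed
  qed (use w2 in auto)
  then show "((\<lambda>x. (LINT u:{0<..}|lborel. k u * G (u * x)) / G x) \<longlongrightarrow> (LINT u:{0<..}|lborel. k u * u powr (- \<alpha>))) at_top"
    unfolding set_lebesgue_integral_def by (simp flip: Bochner_Integration.integral_divide_zero)
  show "\<forall>\<^sub>F x in at_top. 0 < G x \<and> set_integrable lborel {0<..} (\<lambda>u. k u * G (u * x))"
    using eventually_ge_at_top[of X]
  proof eventually_elim
    case (elim x)
    have "integrable lborel (\<lambda>u. indicator {0<..} u * (k u * G (u * x) / G x))"
      using order_trans[OF dom[OF elim] abs_ge_self] k0(1) G1(1)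
      by (intro Bochner_Integration.integrable_bound[OF w2] AE_I2) (auto split: split_indicator)
    from integrable_mult_left[OF this, of "G x"]
    show ?case using XC(1)[OF elim] by (simp add: set_integrable_def)
  qed
  have "k u * u powr (- \<alpha>) \<le> 2 * C * w u" if "u > 0" for u
  proof (rule tendsto_upperbound)
    show "((\<lambda>x. k u * (G (u * x) / G x)) \<longlongrightarrow> k u * u powr (- \<alpha>)) at_top"
      by (intro tendsto_mult_left Gu that)
    show "\<forall>\<^sub>F x in at_top. k u * (G (u * x) / G x) \<le> 2 * C * w u"
      using eventually_ge_at_top[of X] by eventually_elim (use dom that in auto)
  qed simp
  note order_trans[OF this abs_ge_self]
  then show "set_integrable lborel {0<..} (\<lambda>u. k u * u powr (- \<alpha>))"
    unfolding set_integrable_def using k0(1)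
    by (intro Bochner_Integration.integrable_bound[OF w2] AE_I2) (auto split: split_indicator)
qed

text \<open>Integration by parts. The boundary term (1 - exp (- u)) * u powr (1 - \<alpha>) / (1 -
  \<alpha>) vanishes at 0 since \<alpha> < 2 and at infinity since \<alpha> > 1; what remains is the
  integral for Gamma (2 - \<alpha>).\<close>

lemma integral_one_minus_exp_powr:
  assumes "1 < \<alpha>" "\<alpha> < (2::real)"
  shows "(LINT u:{0<..}|lborel. (1 - exp (- u)) * u powr (- \<alpha>)) = Gamma (2 - \<alpha>) / (\<alpha> - 1)"
proof -
  have i1: "set_integrable lborel {0<..} (\<lambda>u::real. (1 - exp (- u)) * u powr (- \<alpha>))"
    unfolding set_integrable_def
  proof (rule Bochner_Integration.integrable_bound)
    show "integrable lborel (\<lambda>u. indicator {0<..} u *\<^sub>R (if u \<le> 1 then u powr (1 - \<alpha>) else u powr (- \<alpha>)))"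
      using set_integrable_powr_pieces[of "1 - \<alpha>" "- \<alpha>"] assms by (simp add: set_integrable_def)
    show "AE u in lborel. norm (indicator {0<..} u *\<^sub>R ((1 - exp (- u)) * u powr (- \<alpha>)))
      \<le> norm (indicator {0<..} u *\<^sub>R (if u \<le> 1 then u powr (1 - \<alpha>) else u powr (- \<alpha>)))"
    proof (intro AE_I2)
      fix u :: real
      have "(1 - exp (- u)) * u powr (- \<alpha>) \<le> u * u powr (- \<alpha>)" if "u > 0"
        using exp_ge_add_one_self[of "- u"] by (intro mult_right_mono) auto
      moreover have "u * u powr (- \<alpha>) = u powr (1 - \<alpha>)" if "u > 0"
        using that powr_add[of u 1 "- \<alpha>"] by simp
      moreover have "(1 - exp (- u)) * u powr (- \<alpha>) \<le> 1 * u powr (- \<alpha>)"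
        by (intro mult_right_mono) auto
      ultimately show "norm (indicator {0<..} u *\<^sub>R ((1 - exp (- u)) * u powr (- \<alpha>)))
      \<le> norm (indicator {0<..} u *\<^sub>R (if u \<le> 1 then u powr (1 - \<alpha>) else u powr (- \<alpha>)))"
        by (auto split: split_indicator simp: abs_mult)
    qed
  qed auto
  have G: "((\<lambda>t. t powr (1 - \<alpha>) / exp t) has_integral Gamma (2 - \<alpha>)) {0<..}"
    using Gamma_integral_real[of "2 - \<alpha>"] assms
    by (subst has_integral_spike_set_eq[where T="{0..}"]) (auto intro: negligible_subset[of "{0}"])
  have i2: "set_integrable lborel {0<..} (\<lambda>t. t powr (1 - \<alpha>) / exp t)"
    and v2: "(LINT t:{0<..}|lborel. t powr (1 - \<alpha>) / exp t) = Gamma (2 - \<alpha>)"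
    by (rule nonneg_has_integral_imp_set_integral[OF _ _ _ G]; simp)+
  define f where "f u = (1 - exp (- u)) * u powr (- \<alpha>) - (u powr (1 - \<alpha>) / exp u) / (\<alpha> - 1)" for u
  define F where "F u = (1 - exp (- u)) * u powr (1 - \<alpha>) / (1 - \<alpha>)" for u
  have fint: "set_integrable lborel {0<..} f"
    unfolding f_def by (intro set_integral_diff(1) i1 set_integrable_divide i2)
  have "(LBINT u=0..\<infinity>. f u) = 0 - 0"
  proof (rule interval_integral_FTC_integrable[where F=F])
    fix x :: real assume x: "0 < ereal x" "ereal x < \<infinity>"
    have x0: "x > 0" using x by simp
    have "(F has_real_derivative f x) (at x)"
    proof -
      have "(F has_real_derivative (exp (- x) * x powr (1 - \<alpha>) + (1 - exp (- x)) * ((1 - \<alpha>) * x powr (1 - \<alpha> - 1))) / (1 - \<alpha>)) (at x)"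
      proof -
        have d1: "((\<lambda>u. 1 - exp (- u)) has_real_derivative exp (- x)) (at x)"
          by (auto intro!: derivative_eq_intros)
        have d2: "((\<lambda>u. u powr (1 - \<alpha>)) has_real_derivative (1 - \<alpha>) * x powr (1 - \<alpha> - 1)) (at x)"
          by (rule has_real_derivative_powr[OF x0])
        show ?thesis
          using DERIV_cdivide[OF DERIV_mult[OF d1 d2], of "1 - \<alpha>"] unfolding F_def by (simp only: mult.commute)
      qed
      also have "(exp (- x) * x powr (1 - \<alpha>) + (1 - exp (- x)) * ((1 - \<alpha>) * x powr (1 - \<alpha> - 1))) / (1 - \<alpha>) = f x"
      proof -
        have e: "(p * q + r * (c * s)) / c = r * s - q * p / (- c)" if "c \<noteq> 0" for p q r c s :: real
          using that by (simp add: field_simps)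
        have "x powr (1 - \<alpha>) / exp x = x powr (1 - \<alpha>) * exp (- x)" by (simp add: exp_minus field_simps)
        then show ?thesis using e[of "1 - \<alpha>" "exp (- x)"] assms by (simp add: f_def)
      qed
      finally show ?thesis .
    qed
    then show "(F has_vector_derivative f x) (at x)"
      by (simp add: has_real_derivative_iff_has_vector_derivative)
    show "isCont f x" unfolding f_def using x0 assms by (intro continuous_intros) auto
  next
    show "set_integrable lborel (einterval 0 \<infinity>) f"
      using fint by (simp add: zero_ereal_def)
    have "(F \<longlongrightarrow> 0) (at_right 0)"
    proof -
      have "((\<lambda>u. u powr (2 - \<alpha>)) \<longlongrightarrow> 0) (at_right 0)"
        using assms by real_asymp
      then have "((\<lambda>u. u powr (2 - \<alpha>) / (\<alpha> - 1)) \<longlongrightarrow> 0) (at_right 0)"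
        by (intro tendsto_divide_zero)
      then show ?thesis
      proof (rule Lim_null_comparison[rotated])
        show "\<forall>\<^sub>F u in at_right 0. norm (F u) \<le> u powr (2 - \<alpha>) / (\<alpha> - 1)"
          using eventually_at_right_less[of "0::real"]
        proof eventually_elim
          case (elim u)
          have "(1 - exp (- u)) * u powr (1 - \<alpha>) \<le> u * u powr (1 - \<alpha>)"
            using exp_ge_add_one_self[of "- u"] by (intro mult_right_mono) auto
          also have "u * u powr (1 - \<alpha>) = u powr (2 - \<alpha>)"
            using elim powr_add[of u 1 "1 - \<alpha>"] by simp
          finally show ?case using assms elim by (simp add: F_def abs_mult divide_right_mono abs_minus_commute)
        qed
      qed
    qed
    then show "((F \<circ> real_of_ereal) \<longlongrightarrow> 0) (at_right 0)"
      by (simp add: zero_ereal_def ereal_tendsto_simps)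
    have "(F \<longlongrightarrow> 0) at_top"
    proof -
      have "((\<lambda>u. u powr (1 - \<alpha>)) \<longlongrightarrow> 0) at_top"
        using assms by real_asymp
      then have "((\<lambda>u. u powr (1 - \<alpha>) / (\<alpha> - 1)) \<longlongrightarrow> 0) at_top"
        by (intro tendsto_divide_zero)
      then show ?thesis
      proof (rule Lim_null_comparison[rotated])
        show "\<forall>\<^sub>F u in at_top. norm (F u) \<le> u powr (1 - \<alpha>) / (\<alpha> - 1)"
          using eventually_gt_at_top[of "0::real"]
        proof eventually_elim
          case (elim u)
          have "(1 - exp (- u)) * u powr (1 - \<alpha>) \<le> 1 * u powr (1 - \<alpha>)"
            by (intro mult_right_mono) auto
          then show ?case using assms elim by (simp add: F_def abs_mult divide_right_mono abs_minus_commute)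
        qed
      qed
    qed
    then show "((F \<circ> real_of_ereal) \<longlongrightarrow> 0) (at_left \<infinity>)"
      by (simp add: ereal_tendsto_simps)
  qed simp
  then have "(LINT u:{0<..}|lborel. f u) = 0"
    by (simp add: interval_lebesgue_integral_def zero_ereal_def)
  moreover have "(LINT u:{0<..}|lborel. f u) = (LINT u:{0<..}|lborel. (1 - exp (- u)) * u powr (- \<alpha>)) - Gamma (2 - \<alpha>) / (\<alpha> - 1)"
    using set_integral_diff(2)[OF i1 set_integrable_divide[OF i2, of "\<alpha> - 1"]]
    by (simp only: f_def set_integral_divide_zero v2)
  ultimately show ?thesis by simp
qed

section \<open>Distributions with a heavy left tail\<close>

text \<open>Squaring 1 - u / 2 \<le> exp (- u / 2) gives the quadratic bound for u \<le> 2; for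
  larger u already 4 * (u - 1) exceeds u. This is how the left part of \<open>psi\<close> is bounded
  by \<open>Lam\<close>.\<close>

lemma exp_minus_remainder_ge:
  fixes u :: real assumes "0 \<le> u"
  shows "min (u\<^sup>2) u \<le> 4 * (exp (- u) - 1 + u)"
proof -
  consider "u \<le> 2" | "2 < u" by linarith
  then show ?thesis
  proof cases
    case 1
    have "(1 - u / 2)\<^sup>2 \<le> (exp (- (u / 2)))\<^sup>2"
      using 1 exp_ge_add_one_self[of "- (u / 2)"] by (intro power_mono) auto
    also have "(exp (- (u / 2)))\<^sup>2 = exp (- u)" by (simp flip: exp_of_nat_mult)
    finally have "u\<^sup>2 \<le> 4 * (exp (- u) - 1 + u)" by (simp add: power2_eq_square field_simps)
    then show ?thesis by simp
  next
    case 2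
    then have "u \<le> 4 * (q - 1 + u)" if "q > 0" for q using that by argo
    from this[OF exp_gt_zero[of "- u"]] have "u \<le> 4 * (exp (- u) - 1 + u)" .
    then show ?thesis by simp
  qed
qed

lemma min_square_le_powr:
  fixes u p :: real assumes "0 \<le> u" "1 \<le> p" "p \<le> 2"
  shows "min (u\<^sup>2) u \<le> u powr p" "min (u\<^sup>2) 1 \<le> u powr p"
proof -
  have *: "u\<^sup>2 \<le> u powr p" if "u \<le> 1"
  proof (cases "u = 0")
    case False
    then have "u powr 2 \<le> u powr p" using assms that by (intro powr_mono') auto
    then show ?thesis using False assms by (simp add: powr_numeral)
  qed simp
  have 1: "u powr 1 \<le> u powr p" if "u > 1"
    using assms that by (intro powr_mono) auto
  have 2: "1 \<le> u powr p" if "u > 1"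
    using assms that by (intro ge_one_powr_ge_zero) auto
  show "min (u\<^sup>2) u \<le> u powr p" "min (u\<^sup>2) 1 \<le> u powr p"
    using * 1 2 assms by (cases "u \<le> 1"; fastforce simp: min_le_iff_disj)+
qed

text \<open>After division by exp u the remainder is at most u^2 and at most 1, hence at most u powr
  p. The power p replaces the square because the right tail may have an infinite second
  moment.\<close>

lemma exp_remainder_le_powr:
  fixes u p :: real assumes "0 \<le> u" "1 \<le> p" "p \<le> 2"
  shows "exp u - 1 - u \<le> exp u * u powr p"
proof -
  have a: "1 - exp (- u) \<le> u" using exp_ge_add_one_self[of "- u"] by linarith
  have b: "u * (1 - exp (- u)) \<le> u * u" using a assms by (intro mult_left_mono) auto
  have "1 - exp (- u) - u * exp (- u) \<le> u\<^sup>2" using a b by (simp add: power2_eq_square algebra_simps)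
  moreover have "0 \<le> u * exp (- u)" using assms by simp
  then have "1 - exp (- u) - u * exp (- u) \<le> 1" using exp_gt_zero[of "- u"] by linarith
  ultimately have "1 - exp (- u) - u * exp (- u) \<le> u powr p"
    using min_square_le_powr(2)[OF assms] by linarith
  then have "exp u * (1 - exp (- u) - u * exp (- u)) \<le> exp u * u powr p"
    by (intro mult_left_mono) auto
  then show ?thesis by (simp add: algebra_simps exp_minus)
qed

section \<open>Laplace exponent and truncated second moment of the left tail\<close>

locale heavy_left_tail = real_distribution D for D :: "real measure" +
  fixes \<alpha> \<beta> :: real
  assumes alpha: "1 < \<alpha>" "\<alpha> < 2" and alpha_beta: "\<alpha> < \<beta>"
    and left_rv: "regularly_varying (\<lambda>x. cdf D (- x)) (- \<alpha>)"
    and right_rv: "regularly_varying (\<lambda>x. measure D {x<..}) (- \<beta>)"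
    and integrable_id: "integrable D (\<lambda>y. y)" and mean_zero: "(LINT y|D. y) = 0"
begin

definition "G x = cdf D (- x)"

lemma G_eq: "G x = prob {y. x \<le> - y}"
  unfolding G_def cdf_def by (rule arg_cong[where f=prob]) auto

lemma G_bounds: "0 \<le> G x" "G x \<le> 1"
  by (auto simp: G_eq)

lemma G_antimono: "x \<le> y \<Longrightarrow> G y \<le> G x"
  unfolding G_def by (rule cdf_nondecreasing) simp

lemma G_measurable [measurable]: "G \<in> borel_measurable borel"
proof -
  have "(\<lambda>x. - G x) \<in> borel_measurable borel"
    by (intro borel_measurable_mono) (auto simp: mono_def G_antimono)
  then show ?thesis by simp
qed

lemma G_rv: "regularly_varying G (- \<alpha>)"
  using left_rv unfolding G_def .

lemma G_tail_integral_limit: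
  assumes "k \<in> borel_measurable borel"
    and "\<And>u. u > 0 \<Longrightarrow> 0 \<le> k u" "\<And>u. u > 0 \<Longrightarrow> k u \<le> 2 * min u 1"
  shows "((\<lambda>x. (LINT u:{0<..}|lborel. k u * G (u * x)) / G x) \<longlongrightarrow> (LINT u:{0<..}|lborel. k u * u powr (- \<alpha>))) at_top"
    and "\<forall>\<^sub>F x in at_top. 0 < G x \<and> set_integrable lborel {0<..} (\<lambda>u. k u * G (u * x))"
  using regularly_varying_integral_limit[OF G_rv alpha G_bounds G_measurable assms] by auto

lemma G_layer_cake:
  assumes k: "k \<in> borel_measurable borel" and \<phi>: "\<phi> \<in> borel_measurable borel"
    and k0: "\<And>u. u \<ge> 0 \<Longrightarrow> 0 \<le> k u" and \<phi>k: "\<And>y. y \<ge> 0 \<Longrightarrow> (k has_integral \<phi> y) {0..y}"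
    and int: "set_integrable lborel {0<..} (\<lambda>u. k u * G (u * x))" and "x > 0"
  shows "integrable D (\<lambda>y. \<phi> (max 0 (- y / x)))"
    "(LINT y|D. \<phi> (max 0 (- y / x))) = (LINT u:{0<..}|lborel. k u * G (u * x))"
proof -
  have G: "prob {y\<in>space D. u \<le> - y / x} = G (u * x)" for u
    using \<open>x > 0\<close> by (simp add: G_eq field_simps)
  have Y: "(\<lambda>y. - y / x) \<in> borel_measurable D" by simp
  show "integrable D (\<lambda>y. \<phi> (max 0 (- y / x)))"
    "(LINT y|D. \<phi> (max 0 (- y / x))) = (LINT u:{0<..}|lborel. k u * G (u * x))"
    using layer_cake[OF Y k \<phi> k0 \<phi>k] int unfolding G by auto
qed

text \<open>Subtracting 1 + s * y makes the integrand nonnegative, and integrable with a first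
  moment only. As the mean is 0, 1 + \<open>Lam s\<close> is the Laplace transform at s up to what
  positive values contribute.\<close>

definition "Lam s = (LINT y|D. indicator {..0} y * (exp (s * y) - 1 - s * y))"

lemma Lam_integrand_nonneg: "0 \<le> indicator {..0} y * (exp (s * y) - 1 - s * (y::real))"
proof -
  have "0 \<le> exp (s * y) - 1 - s * y" using exp_ge_add_one_self[of "s * y"] by linarith
  then show ?thesis by simp
qed

lemma Lam_integrable:
  assumes "0 \<le> s"
  shows "integrable D (\<lambda>y. indicator {..0} y * (exp (s * y) - 1 - s * y))"
proof (rule Bochner_Integration.integrable_bound)
  show "integrable D (\<lambda>y. s * y)" using integrable_id by simp
  show "AE y in D. norm (indicator {..0} y * (exp (s * y) - 1 - s * y)) \<le> norm (s * y)"
  proof (intro AE_I2)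
    fix y :: real
    have "exp (s * y) - 1 - s * y \<le> - (s * y)" "s * y \<le> 0" if "y \<le> 0"
      using that assms by (auto simp: mult_nonneg_nonpos)
    then show "norm (indicator {..0} y * (exp (s * y) - 1 - s * y)) \<le> norm (s * y)"
      using Lam_integrand_nonneg[of y s] by (auto split: split_indicator)
  qed
qed simp

text \<open>The function exp v - v decreases on v \<le> 0; the tangent of exp at s * y shows
  it.\<close>

lemma Lam_mono:
  assumes "0 \<le> s" "s \<le> t"
  shows "Lam s \<le> Lam t"
  unfolding Lam_def
proof (intro integral_mono Lam_integrable)
  fix y
  have "exp (s * y) - s * y \<le> exp (t * y) - t * y" if "y \<le> 0"
  proof -
    have "exp (t * y) \<ge> exp (s * y) + (t * y - s * y) * exp (s * y)"
      using exp_ge_add_one_self[of "t * y - s * y"] mult_left_mono[of "1 + (t * y - s * y)" "exp (t * y - s * y)" "exp (s * y)"]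
      by (simp add: algebra_simps flip: exp_add)
    moreover have "(s * y - t * y) * exp (s * y) \<le> (s * y - t * y) * 1"
      using assms that by (intro mult_left_mono) (auto simp: mult_nonneg_nonpos mult_right_mono_neg)
    ultimately show ?thesis by (simp add: algebra_simps)
  qed
  then show "indicator {..0} y * (exp (s * y) - 1 - s * y) \<le> indicator {..0} y * (exp (t * y) - 1 - t * y)"
    by (auto split: split_indicator)
qed (use assms in auto)

lemma has_integral_one_minus_exp:
  assumes "0 \<le> (y::real)"
  shows "((\<lambda>u. 1 - exp (- u)) has_integral (exp (- y) - 1 + y)) {0..y}"
proof -
  have "((\<lambda>u. 1 - exp (- u)) has_integral (exp (- y) + y) - (exp (- 0) + 0)) {0..y}"
    using assms by (intro fundamental_theorem_of_calculus)
      (auto intro!: derivative_eq_intros simp flip: has_real_derivative_iff_has_vector_derivative)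
  then show ?thesis by (simp add: algebra_simps)
qed

text \<open>Layer cake with k u = 1 - exp (- u), the derivative of exp (- u) - 1 + u, turns
  \<open>Lam (1 / x)\<close> into a tail integral whose limit is the Gamma integral above. The exact
  constant matters, since it enters an exponent of n.\<close>

lemma Lam_asymp: "((\<lambda>x. Lam (1 / x) / G x) \<longlongrightarrow> Gamma (2 - \<alpha>) / (\<alpha> - 1)) at_top"
proof -
  define k where "k u = 1 - exp (- u)" for u :: real
  have k: "k \<in> borel_measurable borel" by (simp add: k_def[abs_def])
  have k1: "0 \<le> k u" "k u \<le> 2 * min u 1" if "u \<ge> 0" for u
    using that exp_ge_add_one_self[of "- u"] exp_gt_zero[of "- u"] unfolding k_def
    by (simp, linarith)
  have "((\<lambda>x. (LINT u:{0<..}|lborel. k u * G (u * x)) / G x) \<longlongrightarrow> (LINT u:{0<..}|lborel. k u * u powr (- \<alpha>))) at_top"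
    using k k1 by (intro G_tail_integral_limit(1)) auto
  then have l: "((\<lambda>x. (LINT u:{0<..}|lborel. k u * G (u * x)) / G x) \<longlongrightarrow> Gamma (2 - \<alpha>) / (\<alpha> - 1)) at_top"
    using integral_one_minus_exp_powr[OF alpha] by (simp add: k_def)
  have "\<forall>\<^sub>F x in at_top. 0 < G x \<and> set_integrable lborel {0<..} (\<lambda>u. k u * G (u * x))"
    using k k1 by (intro G_tail_integral_limit(2)) auto
  then have "\<forall>\<^sub>F x in at_top. (LINT u:{0<..}|lborel. k u * G (u * x)) / G x = Lam (1 / x) / G x"
    using eventually_gt_at_top[of 0]
  proof eventually_elim
    case (elim x)
    have "(LINT y|D. exp (- max 0 (- y / x)) - 1 + max 0 (- y / x)) = (LINT u:{0<..}|lborel. k u * G (u * x))"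
      using elim has_integral_one_minus_exp by (intro G_layer_cake(2) k k1) (auto simp: k_def)
    moreover have "(LINT y|D. exp (- max 0 (- y / x)) - 1 + max 0 (- y / x)) = Lam (1 / x)"
      unfolding Lam_def using elim
      by (intro Bochner_Integration.integral_cong) (auto split: split_indicator simp: max_def field_simps)
    ultimately show ?case by simp
  qed
  with l show ?thesis by (subst (asm) tendsto_cong)
qed

text \<open>On the left half-line the layer cake formula for the square of min (- y / x) 1 gives 2 /
  (2 - \<alpha>). The mass below - x is counted there with weight 1; taking it away leaves 2 / (2 -
  \<alpha>) - 1 = \<alpha> / (2 - \<alpha>). Positive values only enlarge the truncated moment, so
  the left tail alone gives a lower bound.\<close>

lemma truncated_second_moment_ge:
  assumes "0 < e"
  shows "\<forall>\<^sub>F x in at_top. (\<alpha> / (2 - \<alpha>) - e) * G x * x\<^sup>2 \<le> truncated_second_moment D x"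
proof -
  define k where "k u = (if u \<le> 1 then 2 * u else 0)" for u :: real
  have k: "k \<in> borel_measurable borel" unfolding k_def[abs_def] by measurable
  have k1: "0 \<le> k u" "k u \<le> 2 * min u 1" if "u \<ge> 0" for u
    using that by (auto simp: k_def)
  have "((\<lambda>x. (LINT u:{0<..}|lborel. k u * G (u * x)) / G x) \<longlongrightarrow> (LINT u:{0<..}|lborel. k u * u powr (- \<alpha>))) at_top"
    using k k1 by (intro G_tail_integral_limit(1)) auto
  moreover have "(LINT u:{0<..}|lborel. k u * u powr (- \<alpha>)) = 2 / (2 - \<alpha>)"
  proof -
    have "((\<lambda>u. 2 * u powr (1 - \<alpha>)) has_integral 2 * (1 powr (1 - \<alpha> + 1) / (1 - \<alpha> + 1))) {0..1}"
      using alpha by (intro has_integral_mult_right has_integral_powr_from_0) auto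
    then have "(LINT u:{0..1}|lborel. 2 * u powr (1 - \<alpha>)) = 2 / (2 - \<alpha>)"
      by (subst nonneg_has_integral_imp_set_integral(2)) auto
    moreover have "(LINT u:{0..1}|lborel. 2 * u powr (1 - \<alpha>)) = (LINT u:{0<..}|lborel. k u * u powr (- \<alpha>))"
      unfolding set_lebesgue_integral_def
    proof (intro Bochner_Integration.integral_cong refl)
      fix u :: real
      have "u * u powr (- \<alpha>) = u powr (1 - \<alpha>)" if "u > 0"
        using that powr_add[of u 1 "- \<alpha>"] by simp
      then show "indicat_real {0..1} u *\<^sub>R (2 * u powr (1 - \<alpha>)) = indicat_real {0<..} u *\<^sub>R (k u * u powr - \<alpha>)"
        by (cases "u = 0") (auto simp: k_def split: split_indicator)
    qed
    ultimately show ?thesis by simp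
  qed
  ultimately have "((\<lambda>x. (LINT u:{0<..}|lborel. k u * G (u * x)) / G x) \<longlongrightarrow> 2 / (2 - \<alpha>)) at_top" by simp
  then have "\<forall>\<^sub>F x in at_top. 2 / (2 - \<alpha>) - e < (LINT u:{0<..}|lborel. k u * G (u * x)) / G x"
    using assms by (intro order_tendstoD(1)) auto
  moreover have "\<forall>\<^sub>F x in at_top. 0 < G x \<and> set_integrable lborel {0<..} (\<lambda>u. k u * G (u * x))"
    using k k1 by (intro G_tail_integral_limit(2)) auto
  ultimately show ?thesis using eventually_gt_at_top[of 0]
  proof eventually_elim
    case (elim x)
    have \<phi>k: "(k has_integral (min y 1)\<^sup>2) {0..y}" if "y \<ge> 0" for y
    proof -
      have "((\<lambda>u. 2 * u) has_integral (min y 1)\<^sup>2 - 0\<^sup>2) {0..min y 1}"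
        using that by (intro fundamental_theorem_of_calculus)
          (auto intro!: derivative_eq_intros simp flip: has_real_derivative_iff_has_vector_derivative)
      then have "((\<lambda>u. if u \<in> {0..min y 1} then 2 * u else 0) has_integral (min y 1)\<^sup>2) {0..y}"
        by (subst has_integral_restrict) auto
      then show ?thesis
        by (rule has_integral_eq[rotated]) (auto simp: k_def)
    qed
    have i: "integrable D (\<lambda>y. (min (max 0 (- y / x)) 1)\<^sup>2)"
      and v: "(LINT y|D. (min (max 0 (- y / x)) 1)\<^sup>2) = (LINT u:{0<..}|lborel. k u * G (u * x))"
      by (rule G_layer_cake[where \<phi>="\<lambda>y. (min y 1)\<^sup>2", OF k _ k1(1) \<phi>k]; use elim in simp)+
    have i3: "integrable D (\<lambda>y. indicator {y. \<bar>y\<bar> \<le> x} y * y\<^sup>2)"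
    proof (rule integrable_const_bound[where B="x\<^sup>2"])
      show "AE y in D. norm (indicator {y. \<bar>y\<bar> \<le> x} y * y\<^sup>2) \<le> x\<^sup>2"
        by (intro AE_I2) (auto split: split_indicator simp: abs_le_square_iff[symmetric])
    qed simp
    have i2: "integrable D (\<lambda>y. indicator {..- x} y :: real)"
      by (rule integrable_const_bound[where B=1]) auto
    have "(LINT y|D. (min (max 0 (- y / x)) 1)\<^sup>2) \<le> (LINT y|D. indicator {y. \<bar>y\<bar> \<le> x} y * y\<^sup>2 / x\<^sup>2 + indicator {..- x} y)"
    proof (intro integral_mono i Bochner_Integration.integrable_add integrable_divide i3 i2)
      fix y
      show "(min (max 0 (- y / x)) 1)\<^sup>2 \<le> indicator {y. \<bar>y\<bar> \<le> x} y * y\<^sup>2 / x\<^sup>2 + indicator {..- x} y"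
      proof (cases "y \<le> - x")
        case True
        then have "- y / x \<ge> 1" using elim by (simp add: field_simps)
        then show ?thesis using True by (simp add: max_def)
      next
        case False
        then have "- y / x < 1" using elim by (simp add: field_simps)
        then show ?thesis using False elim
          by (auto simp: max_def min_def power_divide field_simps split: split_indicator)
      qed
    qed
    also have "\<dots> = (LINT y|D. indicator {y. \<bar>y\<bar> \<le> x} y * y\<^sup>2 / x\<^sup>2) + (LINT y|D. indicator {..- x} y)"
      by (intro Bochner_Integration.integral_add integrable_divide i3 i2)
    also have "(LINT y|D. indicator {y. \<bar>y\<bar> \<le> x} y * y\<^sup>2 / x\<^sup>2) = truncated_second_moment D x / x\<^sup>2"
      by (simp add: truncated_second_moment_def set_lebesgue_integral_def)
    also have "(LINT y|D. indicator {..- x} y) = G x"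
      by (simp add: G_def cdf_def)
    finally have a: "(LINT u:{0<..}|lborel. k u * G (u * x)) \<le> truncated_second_moment D x / x\<^sup>2 + G x" by (simp only: v)
    have "(2 / (2 - \<alpha>) - e) * G x \<le> (LINT u:{0<..}|lborel. k u * G (u * x))"
      using elim by (simp add: field_simps)
    with a have "(2 / (2 - \<alpha>) - e) * G x - G x \<le> truncated_second_moment D x / x\<^sup>2" by linarith
    then have "((2 / (2 - \<alpha>) - e) * G x - G x) * x\<^sup>2 \<le> truncated_second_moment D x"
      using elim by (simp add: pos_le_divide_eq)
    moreover have "2 / (2 - \<alpha>) = 1 + \<alpha> / (2 - \<alpha>)" using alpha by (simp add: field_simps)
    then have "(2 / (2 - \<alpha>) - e) * G x - G x = (\<alpha> / (2 - \<alpha>) - e) * G x" by (simp only: algebra_simps)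
    ultimately show ?case by simp
  qed
qed

text \<open>The positive part has a finite moment of an order above \<open>\<alpha>\<close>; this makes the right tail
  negligible in the truncated exponential moments.\<close>

definition "p = (\<alpha> + min \<beta> 2) / 2"

lemma p_bounds: "\<alpha> < p" "p < \<beta>" "p < 2" "1 < p" "1 \<le> p" "p \<le> 2" "0 < p"
  using alpha alpha_beta by (auto simp: p_def min_def)

text \<open>The exponent halfway between p and \<beta> leaves room on both sides: below \<beta> for
  the slowly varying factor, above p for integrating u powr (p - 1) against the tail.\<close>

lemma right_tail_le: "\<exists>C>0. \<forall>u\<ge>1. prob {u..} \<le> C * u powr (- ((\<beta> + p) / 2))"
proof -
  define q where "q = (\<beta> + p) / 2"
  have q: "p < q" "q < \<beta>" "q > 0" using p_bounds by (auto simp: q_def)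
  obtain X C where X: "X > 0" and C: "C > 0" and b: "\<And>x. x \<ge> X \<Longrightarrow> prob {x<..} \<le> C * x powr (- \<beta> + (\<beta> - q))"
    using regularly_varying_power_bounds[OF right_rv, of "\<beta> - q"] q by auto
  define C' where "C' = max (C * 2 powr q) ((2 * X) powr q)"
  have "prob {u..} \<le> C' * u powr (- q)" if "u \<ge> 1" for u
  proof (cases "u \<ge> 2 * X")
    case True
    have "prob {u..} \<le> prob {u / 2<..}" using that by (intro finite_measure_mono) auto
    also have "\<dots> \<le> C * (u / 2) powr (- q)" using b[of "u / 2"] True by simp
    also have "\<dots> = C * 2 powr q * u powr (- q)" using that by (simp add: powr_divide powr_minus field_simps)
    also have "\<dots> \<le> C' * u powr (- q)" by (intro mult_right_mono) (auto simp: C'_def)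
    finally show ?thesis .
  next
    case False
    have "1 = (2 * X) powr q * (2 * X) powr (- q)" using X by (simp flip: powr_add)
    also have "\<dots> \<le> C' * u powr (- q)"
      using False that q X by (intro mult_mono powr_mono2') (auto simp: C'_def le_max_iff_disj)
    finally show ?thesis using prob_le_1[of "{u..}"] by linarith
  qed
  moreover have "C' > 0" using C by (auto simp: C'_def less_max_iff_disj)
  ultimately show ?thesis by (intro exI[of _ C']) (auto simp: q_def)
qed

lemma integrable_pos_part_powr: "integrable D (\<lambda>y. max 0 y powr p)"
proof -
  obtain C where C: "C > 0" "\<And>u. u \<ge> 1 \<Longrightarrow> prob {u..} \<le> C * u powr (- ((\<beta> + p) / 2))"
    using right_tail_le by auto
  define k where "k u = p * u powr (p - 1)" for u
  have k: "k \<in> borel_measurable borel" unfolding k_def[abs_def] by measurable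
  have pr: "{y\<in>space D. u \<le> y} = {u..}" for u by auto
  have m: "(\<lambda>u. prob {u..}) \<in> borel_measurable borel"
  proof -
    have "(\<lambda>u. - prob {u..}) \<in> borel_measurable borel"
      by (intro borel_measurable_mono) (auto simp: mono_def intro!: finite_measure_mono)
    then show ?thesis by simp
  qed
  have 1: "integrable lborel (\<lambda>u. indicator {0<..} u *\<^sub>R (if u \<le> 1 then u powr (p - 1) else u powr (p - 1 - ((\<beta> + p) / 2))) * (p * max 1 C))"
    using set_integrable_powr_pieces[of "p - 1" "p - 1 - ((\<beta> + p) / 2)"] p_bounds
    unfolding set_integrable_def by (intro integrable_mult_left) auto
  have "set_integrable lborel {0<..} (\<lambda>u. k u * prob {u..})"
    unfolding set_integrable_def
  proof (rule Bochner_Integration.integrable_bound[OF 1])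
    show "AE u in lborel. norm (indicator {0<..} u *\<^sub>R (k u * prob {u..})) \<le> norm (indicator {0<..} u *\<^sub>R (if u \<le> 1 then u powr (p - 1) else u powr (p - 1 - ((\<beta> + p) / 2))) * (p * max 1 C))"
    proof (intro AE_I2)
      fix u :: real
      have "k u * prob {u..} \<le> (if u \<le> 1 then u powr (p - 1) else u powr (p - 1 - ((\<beta> + p) / 2))) * (p * max 1 C)" if "u > 0"
      proof (cases "u \<le> 1")
        case True
        have "u powr (p - 1) * p * prob {u..} \<le> u powr (p - 1) * p * max 1 C"
          using prob_le_1[of "{u..}"] p_bounds by (intro mult_left_mono) (auto simp: le_max_iff_disj)
        then show ?thesis using True by (simp add: k_def mult_ac)
      next
        case False
        have "u powr (p - 1) * p * prob {u..} \<le> u powr (p - 1) * p * (max 1 C * u powr (- ((\<beta> + p) / 2)))"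
          using False p_bounds by (intro mult_left_mono order_trans[OF C(2)] mult_right_mono) auto
        moreover have "u powr (p - 1 - ((\<beta> + p) / 2)) = u powr (p - 1) * u powr (- ((\<beta> + p) / 2))"
          by (simp flip: powr_add add: field_simps)
        ultimately show ?thesis using False by (simp add: k_def mult_ac)
      qed
      then show "norm (indicator {0<..} u *\<^sub>R (k u * prob {u..})) \<le> norm (indicator {0<..} u *\<^sub>R (if u \<le> 1 then u powr (p - 1) else u powr (p - 1 - ((\<beta> + p) / 2))) * (p * max 1 C))"
        using p_bounds by (auto split: split_indicator simp: k_def abs_mult intro: order_trans[OF _ abs_ge_self])
    qed
  qed (use k m in measurable)
  moreover have "(k has_integral (y powr p)) {0..y}" if "y \<ge> 0" for y
    using has_integral_mult_right[OF has_integral_powr_from_0[of "p - 1" y], of p] p_bounds that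
    by (simp add: k_def[abs_def])
  ultimately show ?thesis
    using p_bounds unfolding pr[symmetric]
    by (intro layer_cake(1)[OF _ k, where \<phi>="\<lambda>y. y powr p"]) (auto simp: k_def)
qed

definition "MP = (LINT y|D. max 0 y powr p)"

lemma MP_nonneg: "0 \<le> MP"
  unfolding MP_def by (intro integral_nonneg_AE) auto

section \<open>Truncated exponential moments and a Chebyshev functional\<close>

lemma integrable_truncated_exp:
  assumes "0 \<le> s"
  shows "integrable D (\<lambda>y. indicator {..h} y * exp (s * y))"
proof (rule integrable_const_bound[where B="exp (s * h)"])
  show "AE y in D. norm (indicator {..h} y * exp (s * y)) \<le> exp (s * h)"
    using assms by (intro AE_I2) (auto split: split_indicator simp: mult_left_mono)
qed simp

text \<open>A pointwise comparison on y \<le> 0, 0 < y \<le> h and y > h. The linear part 1 + s * y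
  has mean 1 by centring, the remainder on the left is \<open>Lam\<close>, and on 0 < y \<le> h the
  remainder costs at most exp (s * h) times a p-th moment. With h = \<delta> * x and \<delta> small,
  n times this last term stays bounded.\<close>

lemma truncated_mgf_le:
  assumes "0 \<le> s" "0 \<le> h"
  shows "(LINT y|D. indicator {..h} y * exp (s * y)) \<le> 1 + Lam s + exp (s * h) * s powr p * MP"
proof -
  have i3: "integrable D (\<lambda>y. exp (s * h) * s powr p * max 0 y powr p)"
    by (intro integrable_mult_right integrable_pos_part_powr)
  have i12: "integrable D (\<lambda>y. 1 + s * y)" using integrable_id by simp
  have "(LINT y|D. indicator {..h} y * exp (s * y)) \<le> (LINT y|D. (1 + s * y) + indicator {..0} y * (exp (s * y) - 1 - s * y) + exp (s * h) * s powr p * max 0 y powr p)"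
  proof (intro integral_mono Bochner_Integration.integrable_add Lam_integrable i3 i12[simplified] integrable_truncated_exp assms)
    fix y :: real
    consider "y \<le> 0" | "0 < y" "y \<le> h" | "y > h" "y > 0" by linarith
    then show "indicator {..h} y * exp (s * y) \<le> (1 + s * y) + indicator {..0} y * (exp (s * y) - 1 - s * y) + exp (s * h) * s powr p * max 0 y powr p"
    proof cases
      case 2
      have "exp (s * y) - 1 - s * y \<le> exp (s * y) * (s * y) powr p"
        using 2 assms p_bounds by (intro exp_remainder_le_powr) auto
      also have "\<dots> \<le> exp (s * h) * (s * y) powr p"
        using 2 assms by (intro mult_right_mono) (auto simp: mult_left_mono)
      also have "\<dots> = exp (s * h) * s powr p * max 0 y powr p"
        using 2 assms by (simp add: powr_mult max_def)
      finally show ?thesis using 2 by simp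
    qed (use assms p_bounds in auto)
  qed (use integrable_id in auto)
  also have "\<dots> = (LINT y|D. 1 + s * y) + Lam s + exp (s * h) * s powr p * MP"
    using i12 i3 Lam_integrable[OF assms(1)] unfolding Lam_def MP_def by simp
  also have "(LINT y|D. 1 + s * y) = 1" using integrable_id mean_zero prob_space by simp
  finally show ?thesis .
qed

text \<open>One functional for both halves of a Chebyshev bound with truncation at x: it dominates
  the second moment of the part with |y| \<le> x, divided by x^2, and the first absolute moment of
  the rest, divided by x.\<close>

definition "psi x = (LINT y|D. min ((y / x)\<^sup>2) \<bar>y / x\<bar>)"

lemma psi_integrable: "integrable D (\<lambda>y. min ((y / x)\<^sup>2) \<bar>y / x\<bar>)"
proof (rule Bochner_Integration.integrable_bound)
  show "integrable D (\<lambda>y. y / x)" using integrable_id by simp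
qed auto

text \<open>Negative values are compared with \<open>Lam\<close> at s = 1 / x, positive ones with
  their p-th moment, so that the left tail enters only through asymptotics already known.\<close>

lemma psi_le:
  assumes "0 < x"
  shows "psi x \<le> 4 * Lam (1 / x) + x powr (- p) * MP"
proof -
  have "psi x \<le> (LINT y|D. 4 * (indicator {..0} y * (exp (1 / x * y) - 1 - 1 / x * y)) + x powr (- p) * max 0 y powr p)"
    unfolding psi_def
  proof (intro integral_mono psi_integrable Bochner_Integration.integrable_add integrable_mult_right Lam_integrable integrable_pos_part_powr)
    fix y
    show "min ((y / x)\<^sup>2) \<bar>y / x\<bar> \<le> 4 * (indicator {..0} y * (exp (1 / x * y) - 1 - 1 / x * y)) + x powr (- p) * max 0 y powr p"
    proof (cases "y \<le> 0")
      case True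
      then show ?thesis using exp_minus_remainder_ge[of "- y / x"] assms p_bounds
        by (auto simp: power_divide divide_nonpos_pos)
    next
      case False
      then show ?thesis using min_square_le_powr(1)[of "y / x" p] assms p_bounds
        by (auto simp: powr_divide powr_minus field_simps)
    qed
  qed (use assms in auto)
  also have "\<dots> = 4 * Lam (1 / x) + x powr (- p) * MP"
    using assms Lam_integrable[of "1 / x"] integrable_pos_part_powr unfolding Lam_def MP_def by simp
  finally show ?thesis .
qed

lemma truncated_second_moment_le_psi:
  assumes "0 < x"
  shows "truncated_second_moment D x \<le> x\<^sup>2 * psi x"
proof -
  have "(LINT y|D. indicator {y. \<bar>y\<bar> \<le> x} y * y\<^sup>2) \<le> (LINT y|D. x\<^sup>2 * min ((y / x)\<^sup>2) \<bar>y / x\<bar>)"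
  proof (rule integral_mono)
    show "integrable D (\<lambda>y. indicator {y. \<bar>y\<bar> \<le> x} y * y\<^sup>2)"
    proof (rule integrable_const_bound[where B="x\<^sup>2"])
      show "AE y in D. norm (indicator {y. \<bar>y\<bar> \<le> x} y * y\<^sup>2) \<le> x\<^sup>2"
        by (intro AE_I2) (auto split: split_indicator simp: abs_le_square_iff[symmetric])
    qed simp
    fix y
    have "(y / x)\<^sup>2 \<le> \<bar>y / x\<bar>" if "\<bar>y\<bar> \<le> x"
    proof -
      have "\<bar>y / x\<bar> \<le> 1" using that assms by simp
      then have "\<bar>y / x\<bar> * \<bar>y / x\<bar> \<le> \<bar>y / x\<bar>" by (intro mult_left_le) auto
      then show ?thesis by (simp add: power2_eq_square flip: abs_mult)
    qed
    then show "indicator {y. \<bar>y\<bar> \<le> x} y * y\<^sup>2 \<le> x\<^sup>2 * min ((y / x)\<^sup>2) \<bar>y / x\<bar>"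
      using assms by (auto split: split_indicator simp: power_divide min_def)
  qed (use psi_integrable in auto)
  then show ?thesis
    by (simp add: truncated_second_moment_def set_lebesgue_integral_def psi_def)
qed

end

section \<open>The norming sequence\<close>

text \<open>The logarithmic scale is blind to slowly varying factors, so comparisons of regularly varying
  expressions in \<open>n\<close> reduce to comparisons of exponents.\<close>

definition has_order :: "(nat \<Rightarrow> real) \<Rightarrow> real \<Rightarrow> bool" where
  "has_order q l \<longleftrightarrow> (\<forall>\<^sub>F n in sequentially. 0 < q n) \<and> (\<lambda>n. ln (q n) / ln (real n)) \<longlonglongrightarrow> l"

lemma filterlim_ln_real_at_top: "filterlim (\<lambda>n. ln (real n)) at_top sequentially"
  by real_asymp

lemma eventually_ln_real_gt: "\<forall>\<^sub>F n in sequentially. (c::real) < ln (real n)"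
  using filterlim_ln_real_at_top by (simp add: filterlim_at_top_dense)

lemma has_orderI:
  assumes "\<forall>\<^sub>F n in sequentially. 0 < q n" "(\<lambda>n. ln (q n) / ln (real n)) \<longlonglongrightarrow> l"
  shows "has_order q l"
  using assms by (simp add: has_order_def)

lemma has_order_pos: "has_order q l \<Longrightarrow> \<forall>\<^sub>F n in sequentially. 0 < q n"
  by (simp add: has_order_def)

lemma has_order_mult:
  assumes "has_order q k" "has_order r l"
  shows "has_order (\<lambda>n. q n * r n) (k + l)"
proof (rule has_orderI)
  show "\<forall>\<^sub>F n in sequentially. 0 < q n * r n"
    using has_order_pos[OF assms(1)] has_order_pos[OF assms(2)] by eventually_elim simp
  have "(\<lambda>n. ln (q n) / ln (real n) + ln (r n) / ln (real n)) \<longlonglongrightarrow> k + l"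
    using assms by (intro tendsto_add) (auto simp: has_order_def)
  moreover have "\<forall>\<^sub>F n in sequentially. ln (q n) / ln (real n) + ln (r n) / ln (real n) = ln (q n * r n) / ln (real n)"
    using has_order_pos[OF assms(1)] has_order_pos[OF assms(2)]
    by eventually_elim (simp add: ln_mult add_divide_distrib)
  ultimately show "(\<lambda>n. ln (q n * r n) / ln (real n)) \<longlonglongrightarrow> k + l"
    by (rule Lim_transform_eventually)
qed

lemma has_order_powr:
  assumes "has_order q l"
  shows "has_order (\<lambda>n. q n powr c) (c * l)"
proof (rule has_orderI)
  show "\<forall>\<^sub>F n in sequentially. 0 < q n powr c"
    using has_order_pos[OF assms] by eventually_elim simp
  have "(\<lambda>n. c * (ln (q n) / ln (real n))) \<longlonglongrightarrow> c * l"
    using assms by (intro tendsto_mult_left) (auto simp: has_order_def)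
  moreover have "\<forall>\<^sub>F n in sequentially. c * (ln (q n) / ln (real n)) = ln (q n powr c) / ln (real n)"
    using has_order_pos[OF assms] by eventually_elim (simp add: ln_powr)
  ultimately show "(\<lambda>n. ln (q n powr c) / ln (real n)) \<longlonglongrightarrow> c * l"
    by (rule Lim_transform_eventually)
qed

lemma has_order_const:
  assumes "c > 0" shows "has_order (\<lambda>n. c) 0"
  using assms tendsto_divide_0[OF tendsto_const filterlim_at_top_imp_at_infinity[OF filterlim_ln_real_at_top], of "ln c"]
  by (intro has_orderI) auto

lemma has_order_real: "has_order real 1"
  by (rule has_orderI) real_asymp+

lemma has_order_real_powr: "has_order (\<lambda>n. real n powr c) c"
  using has_order_powr[OF has_order_real, of c] by simp

lemma has_order_ln: "has_order (\<lambda>n. ln (real n)) 0"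
  by (rule has_orderI) real_asymp+

lemma has_order_ln_powr: "has_order (\<lambda>n. ln (real n) powr c) 0"
  using has_order_powr[OF has_order_ln, of c] by simp

lemma has_order_divide:
  assumes "has_order q k" "has_order r l"
  shows "has_order (\<lambda>n. q n / r n) (k - l)"
proof -
  have *: "has_order (\<lambda>n. q n * r n powr (-1)) (k + (-1) * l)"
    by (intro has_order_mult has_order_powr assms)
  show ?thesis
  proof (rule has_orderI)
    have e: "\<forall>\<^sub>F n in sequentially. q n * r n powr (-1) = q n / r n"
      using has_order_pos[OF assms(2)] by eventually_elim (simp add: powr_minus_divide)
    show "\<forall>\<^sub>F n in sequentially. 0 < q n / r n"
      using has_order_pos[OF assms(1)] has_order_pos[OF assms(2)] by eventually_elim simp
    have "(\<lambda>n. ln (q n * r n powr (-1)) / ln (real n)) \<longlonglongrightarrow> k - l" using * by (simp add: has_order_def)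
    moreover have "\<forall>\<^sub>F n in sequentially. ln (q n * r n powr (-1)) / ln (real n) = ln (q n / r n) / ln (real n)"
      using e by eventually_elim (simp only:)
    ultimately show "(\<lambda>n. ln (q n / r n) / ln (real n)) \<longlonglongrightarrow> k - l"
      by (rule Lim_transform_eventually)
  qed
qed

lemma has_order_less:
  assumes "has_order q k" "has_order r l" "k < l"
  shows "\<forall>\<^sub>F n in sequentially. q n < r n"
proof -
  define m where "m = (k + l) / 2"
  have m: "k < m" "m < l" using assms by (auto simp: m_def)
  have "\<forall>\<^sub>F n in sequentially. ln (q n) / ln (real n) < m" "\<forall>\<^sub>F n in sequentially. m < ln (r n) / ln (real n)"
    using assms m by (auto simp: has_order_def dest: order_tendstoD)
  then show ?thesis
    using eventually_ln_real_gt[of 0] has_order_pos[OF assms(1)] has_order_pos[OF assms(2)]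
  proof eventually_elim
    case (elim n)
    then have "ln (q n) < m * ln (real n)" "m * ln (real n) < ln (r n)" by (simp_all add: field_simps)
    then have "ln (q n) < ln (r n)" by (rule order.strict_trans)
    with elim show ?case using ln_less_cancel_iff by blast
  qed
qed

lemma has_order_le:
  assumes "has_order q k" "has_order r l" "k < l" "C > 0"
  shows "\<forall>\<^sub>F n in sequentially. q n \<le> C * r n"
  using has_order_less[OF assms(1) has_order_mult[OF has_order_const[OF \<open>C > 0\<close>] assms(2)]] assms(3)
  by (simp add: eventually_mono)

lemma has_order_tendsto_0:
  assumes "has_order q l" "l < 0"
  shows "q \<longlonglongrightarrow> 0"
proof (rule tendstoI)
  fix e :: real assume "0 < e"
  from has_order_less[OF assms(1) has_order_const[OF this] assms(2)] has_order_pos[OF assms(1)]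
  show "\<forall>\<^sub>F n in sequentially. dist (q n) 0 < e"
    by eventually_elim simp
qed

lemma has_order_at_top:
  assumes "has_order q l" "0 < l"
  shows "filterlim q at_top sequentially"
  unfolding filterlim_at_top_dense
proof
  fix Z :: real
  have "\<forall>\<^sub>F n in sequentially. max Z 1 < q n"
    by (rule has_order_less[OF has_order_const assms]) simp
  then show "\<forall>\<^sub>F n in sequentially. Z < q n" by eventually_elim simp
qed

text \<open>A regularly varying function lies between powers of exponent close to \<rho>; after
  taking logarithms and dividing by ln x the constants disappear.\<close>

lemma regularly_varying_ln_ratio:
  assumes "regularly_varying f \<rho>"
  shows "((\<lambda>x. ln (f x) / ln x) \<longlongrightarrow> \<rho>) at_top"
proof (rule tendstoI)
  fix e :: real assume "0 < e"
  then obtain X c C where X: "X > 0" "c > 0" "C > 0"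
    and b: "\<And>x. x \<ge> X \<Longrightarrow> c * x powr (\<rho> - e / 2) \<le> f x \<and> f x \<le> C * x powr (\<rho> + e / 2)"
    using regularly_varying_power_bounds[OF assms, of "e / 2"] by auto
  have "\<forall>\<^sub>F x in at_top. \<bar>ln c\<bar> + \<bar>ln C\<bar> < e / 2 * ln x" using \<open>0 < e\<close> by real_asymp
  then show "\<forall>\<^sub>F x in at_top. dist (ln (f x) / ln x) \<rho> < e"
    using eventually_ge_at_top[of X] eventually_gt_at_top[of 1]
  proof eventually_elim
    case (elim x)
    have lx: "ln x > 0" using elim by simp
    have "0 < c * x powr (\<rho> - e / 2)" using X elim by simp
    then have fx: "f x > 0" using b[of x] elim by linarith
    have "ln (c * x powr (\<rho> - e / 2)) \<le> ln (f x)" "ln (f x) \<le> ln (C * x powr (\<rho> + e / 2))"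
      using b[of x] elim fx X by (auto simp: ln_le_cancel_iff)
    then have "ln c + (\<rho> - e / 2) * ln x \<le> ln (f x)" "ln (f x) \<le> ln C + (\<rho> + e / 2) * ln x"
      using X elim by (simp_all add: ln_mult ln_powr)
    then have "\<bar>ln (f x) - \<rho> * ln x\<bar> < e * ln x"
      using elim by (simp add: algebra_simps abs_if split: if_splits)
    then show ?case using lx by (simp add: dist_real_def field_simps abs_if split: if_splits)
  qed
qed

lemma has_order_regularly_varying:
  assumes rv: "regularly_varying f \<rho>" and q: "has_order q l" "filterlim q at_top sequentially"
  shows "has_order (\<lambda>n. f (q n)) (\<rho> * l)"
proof (rule has_orderI)
  obtain X where "X > 0" "\<And>x. x \<ge> X \<Longrightarrow> 0 < f x"
    using regularly_varying_potter[OF rv zero_less_one] by auto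
  then show "\<forall>\<^sub>F n in sequentially. 0 < f (q n)"
    using q(2) eventually_mono[of "\<lambda>n. X \<le> q n"] by (auto simp: filterlim_at_top)
  have "(\<lambda>n. (ln (f (q n)) / ln (q n)) * (ln (q n) / ln (real n))) \<longlonglongrightarrow> \<rho> * l"
    using q filterlim_compose[OF regularly_varying_ln_ratio[OF rv] q(2)]
    by (intro tendsto_mult) (auto simp: has_order_def)
  moreover have "\<forall>\<^sub>F n in sequentially. 1 < q n" using q(2) by (simp add: filterlim_at_top_dense)
  then have "\<forall>\<^sub>F n in sequentially. (ln (f (q n)) / ln (q n)) * (ln (q n) / ln (real n)) = ln (f (q n)) / ln (real n)"
    by eventually_elim simp
  ultimately show "(\<lambda>n. ln (f (q n)) / ln (real n)) \<longlonglongrightarrow> \<rho> * l"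
    by (rule Lim_transform_eventually)
qed

section \<open>Growth of the norming sequence and the exponent at the optimal tilt\<close>

locale heavy_left_tail_norming = heavy_left_tail +
  fixes b :: "nat \<Rightarrow> real"
  assumes b_at_top: "filterlim b at_top sequentially"
    and b_eq: "\<forall>\<^sub>F n in sequentially.
      Gamma (3 - \<alpha>) * real n * truncated_second_moment D (b n) = (\<alpha> - 1) * (b n)\<^sup>2"
    and b_limsup: "limsup (\<lambda>n. ereal (cdf D (- (b n / ln (real n) powr (1 / \<alpha>)))
      / (ln (real n) * cdf D (- b n)))) \<le> 1"
begin

definition "K = Gamma (2 - \<alpha>) / (\<alpha> - 1)"

lemma K_pos: "0 < K"
  using alpha by (auto simp: K_def intro!: divide_pos_pos Gamma_real_pos)

lemma Lam_asymp_K: "((\<lambda>x. Lam (1 / x) / G x) \<longlongrightarrow> K) at_top"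
  using Lam_asymp by (simp add: K_def)

lemma G_pos: "\<forall>\<^sub>F x in at_top. 0 < G x"
  using regularly_varying_potter[OF G_rv zero_less_one] by (auto simp: eventually_at_top_linorder)

lemma b_ge: "\<forall>\<^sub>F n in sequentially. c \<le> b n"
  using b_at_top by (simp add: filterlim_at_top)

lemma Gamma_3_minus: "Gamma (3 - \<alpha>) = (2 - \<alpha>) * Gamma (2 - \<alpha>)"
proof -
  have "2 - \<alpha> \<notin> \<int>\<^sub>\<le>\<^sub>0" using alpha by (auto elim!: nonpos_Ints_cases)
  from Gamma_plus1[OF this] show ?thesis by simp
qed

text \<open>The functional equation Gamma (3 - \<alpha>) = (2 - \<alpha>) * Gamma (2 - \<alpha>)
  brings in the constant \<open>K\<close> that governs \<open>Lam\<close>; the two occurrences later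
  cancel.\<close>

lemma b_eq_K: "\<forall>\<^sub>F n in sequentially. real n * truncated_second_moment D (b n) * ((2 - \<alpha>) * K) = (b n)\<^sup>2"
  using b_eq
proof eventually_elim
  case (elim n)
  have "Gamma (2 - \<alpha>) = K * (\<alpha> - 1)" using alpha by (simp add: K_def)
  with elim have "(\<alpha> - 1) * (real n * truncated_second_moment D (b n) * ((2 - \<alpha>) * K)) = (\<alpha> - 1) * (b n)\<^sup>2"
    by (simp add: Gamma_3_minus mult_ac)
  then show ?case using alpha by simp
qed

text \<open>The lower bound of the truncated second moment by \<alpha> / (2 - \<alpha>) * G * b^2,
  inserted into the equation for b. The limiting constant 1 / (\<alpha> * K) is what fixes the
  exponent c0 / \<alpha>.\<close>

lemma n_G_b_le:
  assumes "0 < e"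
  shows "\<forall>\<^sub>F n in sequentially. real n * G (b n) \<le> (1 + e) / (\<alpha> * K)"
proof -
  define c where "c = \<alpha> / (2 - \<alpha>)"
  have c: "c > 0" using alpha by (simp add: c_def)
  \<comment> \<open>The slack is chosen so that c minus it equals c / (1 + e).\<close>
  have "0 < c * e / (1 + e)" using c assms by simp
  from truncated_second_moment_ge[OF this]
  have "\<forall>\<^sub>F x in at_top. (c - c * e / (1 + e)) * G x * x\<^sup>2 \<le> truncated_second_moment D x"
    by (simp only: c_def)
  moreover have "c - c * e / (1 + e) = c / (1 + e)" using assms by (simp add: field_simps)
  ultimately have "\<forall>\<^sub>F x in at_top. c / (1 + e) * G x * x\<^sup>2 \<le> truncated_second_moment D x" by simp
  from filterlim_iff[THEN iffD1, OF b_at_top, rule_format, OF this]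
  show ?thesis using b_eq_K b_ge[of 1]
  proof eventually_elim
    case (elim n)
    have "c / (1 + e) * G (b n) * (b n)\<^sup>2 * (real n * ((2 - \<alpha>) * K)) \<le> truncated_second_moment D (b n) * (real n * ((2 - \<alpha>) * K))"
      using elim K_pos alpha by (intro mult_right_mono) auto
    then have "(c / (1 + e) * G (b n) * (real n * ((2 - \<alpha>) * K))) * (b n)\<^sup>2 \<le> 1 * (b n)\<^sup>2"
      using elim by (simp add: mult_ac)
    then have "c / (1 + e) * G (b n) * (real n * ((2 - \<alpha>) * K)) \<le> 1"
      using elim by (subst (asm) mult_le_cancel_right_pos) auto
    moreover have "c * (2 - \<alpha>) = \<alpha>" using alpha by (simp add: c_def)
    then have "c / (1 + e) * G (b n) * (real n * ((2 - \<alpha>) * K)) = (real n * G (b n)) * (\<alpha> * K) / (1 + e)"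
      by (metis (no_types, opaque_lifting) mult.assoc mult.commute mult.left_commute times_divide_eq_left)
    ultimately show ?case using assms K_pos alpha by (simp add: field_simps)
  qed
qed

text \<open>This only serves to find the order of b, so any positive constant will do. Hence the
  crude estimate of the second moment by \<open>psi\<close>, whose right-tail part b powr (- p) is
  at most a constant times G because p > \<alpha>.\<close>

lemma n_G_b_ge: "\<exists>c>0. \<forall>\<^sub>F n in sequentially. c \<le> real n * G (b n)"
proof -
  have "\<forall>\<^sub>F x in at_top. Lam (1 / x) / G x < K + 1"
    using Lam_asymp_K by (rule order_tendstoD) simp
  from filterlim_iff[THEN iffD1, OF b_at_top, rule_format, OF this]
  have 1: "\<forall>\<^sub>F n in sequentially. Lam (1 / b n) / G (b n) < K + 1" .
  obtain X c where X: "X > 0" "c > 0" and c: "\<And>x. x \<ge> X \<Longrightarrow> c * x powr (- \<alpha> - (p - \<alpha>)) \<le> G x"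
    using regularly_varying_power_bounds[OF G_rv, of "p - \<alpha>"] p_bounds by auto
  define C where "C = 4 * (K + 1) + MP / c"
  have C: "C > 0" using K_pos MP_nonneg X by (auto simp: C_def intro!: add_pos_nonneg)
  have "\<forall>\<^sub>F n in sequentially. 1 / (C * ((2 - \<alpha>) * K)) \<le> real n * G (b n)"
    using 1 b_eq_K b_ge[of 1] b_ge[of X] filterlim_iff[THEN iffD1, OF b_at_top, rule_format, OF G_pos]
  proof eventually_elim
    case (elim n)
    have "psi (b n) \<le> 4 * Lam (1 / b n) + b n powr (- p) * MP"
      using elim by (intro psi_le) simp
    also have "\<dots> \<le> 4 * ((K + 1) * G (b n)) + G (b n) / c * MP"
      using elim X c[of "b n"] MP_nonneg by (intro add_mono mult_left_mono mult_right_mono) (auto simp: field_simps)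
    also have "\<dots> = C * G (b n)" by (simp add: C_def field_simps)
    finally have "(b n)\<^sup>2 * psi (b n) \<le> (b n)\<^sup>2 * (C * G (b n))" by (intro mult_left_mono) auto
    moreover have "truncated_second_moment D (b n) \<le> (b n)\<^sup>2 * psi (b n)"
      using elim by (intro truncated_second_moment_le_psi) simp
    ultimately have "truncated_second_moment D (b n) \<le> (b n)\<^sup>2 * (C * G (b n))" by linarith
    then have "real n * truncated_second_moment D (b n) * ((2 - \<alpha>) * K) \<le> real n * ((b n)\<^sup>2 * (C * G (b n))) * ((2 - \<alpha>) * K)"
      using K_pos alpha by (intro mult_right_mono mult_left_mono) auto
    then have "(b n)\<^sup>2 * 1 \<le> (b n)\<^sup>2 * (real n * G (b n) * (C * ((2 - \<alpha>) * K)))"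
      using elim by (simp add: mult_ac)
    then have "1 \<le> real n * G (b n) * (C * ((2 - \<alpha>) * K))"
      using elim by (subst (asm) mult_le_cancel_left_pos) auto
    then show ?case using C K_pos alpha by (simp add: field_simps)
  qed
  then show ?thesis using C K_pos alpha by (intro exI[of _ "1 / (C * ((2 - \<alpha>) * K))"]) auto
qed

text \<open>Since n * G (b n) stays between positive constants, ln n + ln (G (b n)) is bounded,
  while ln (G (b n)) / ln (b n) tends to - \<alpha>.\<close>

lemma b_order: "has_order b (1 / \<alpha>)"
proof (rule has_orderI)
  show "\<forall>\<^sub>F n in sequentially. 0 < b n" using b_ge[of 1] by eventually_elim simp
  obtain c where c: "c > 0" "\<forall>\<^sub>F n in sequentially. c \<le> real n * G (b n)"
    using n_G_b_ge by auto
  define C where "C = (1 + 1) / (\<alpha> * K)"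
  have C: "\<forall>\<^sub>F n in sequentially. real n * G (b n) \<le> C"
    using n_G_b_le[of 1] by (simp add: C_def)
  have lnb: "filterlim (\<lambda>n. ln (b n)) at_top sequentially"
    by (rule filterlim_compose[OF ln_at_top b_at_top])
  have "(\<lambda>n. ln (real n * G (b n)) / ln (b n)) \<longlonglongrightarrow> 0"
  proof (rule Lim_null_comparison)
    show "(\<lambda>n. (\<bar>ln c\<bar> + \<bar>ln C\<bar>) / ln (b n)) \<longlonglongrightarrow> 0"
      by (rule tendsto_divide_0[OF tendsto_const filterlim_at_top_imp_at_infinity[OF lnb]])
    show "\<forall>\<^sub>F n in sequentially. norm (ln (real n * G (b n)) / ln (b n)) \<le> (\<bar>ln c\<bar> + \<bar>ln C\<bar>) / ln (b n)"
      using c(2) C b_ge[of 2]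
    proof eventually_elim
      case (elim n)
      have "real n * G (b n) > 0" using elim c(1) by linarith
      moreover have "C > 0" using elim c(1) by linarith
      ultimately have "ln c \<le> ln (real n * G (b n))" "ln (real n * G (b n)) \<le> ln C"
        using elim c(1) by (simp_all add: ln_le_cancel_iff del: ln_mult)
      then have "\<bar>ln (real n * G (b n))\<bar> \<le> \<bar>ln c\<bar> + \<bar>ln C\<bar>" by linarith
      then show ?case using elim by (simp add: divide_right_mono)
    qed
  qed
  moreover have "(\<lambda>n. ln (G (b n)) / ln (b n)) \<longlonglongrightarrow> - \<alpha>"
    by (rule filterlim_compose[OF regularly_varying_ln_ratio[OF G_rv] b_at_top])
  ultimately have "(\<lambda>n. ln (real n * G (b n)) / ln (b n) - ln (G (b n)) / ln (b n)) \<longlonglongrightarrow> 0 - (- \<alpha>)"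
    by (rule tendsto_diff)
  moreover have "\<forall>\<^sub>F n in sequentially. ln (real n * G (b n)) / ln (b n) - ln (G (b n)) / ln (b n) = ln (real n) / ln (b n)"
    using filterlim_iff[THEN iffD1, OF b_at_top, rule_format, OF G_pos] eventually_gt_at_top[of 0]
    by eventually_elim (simp add: ln_mult add_divide_distrib)
  ultimately have "(\<lambda>n. ln (real n) / ln (b n)) \<longlonglongrightarrow> 0 - (- \<alpha>)"
    by (rule Lim_transform_eventually)
  from tendsto_inverse[OF this] show "(\<lambda>n. ln (b n) / ln (real n)) \<longlonglongrightarrow> 1 / \<alpha>"
    using alpha by (simp add: field_simps)
qed

text \<open>The solution of c0 - c0 / \<alpha> = \<beta> / \<alpha> - 1.\<close>

definition "c0 = (\<beta> - \<alpha>) / (\<alpha> - 1)"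

lemma c0_pos: "0 < c0"
  using alpha alpha_beta by (simp add: c0_def)

text \<open>The optimal exponential tilt for deviations of size \<open>t * (c0 * ln n) powr ((\<alpha> - 1) / \<alpha>) * b n\<close>.\<close>

definition "tilt n = (c0 * ln (real n)) powr (1 / \<alpha>) / b n"

lemma tilt_order: "has_order tilt (- (1 / \<alpha>))"
proof -
  have "has_order (\<lambda>n. (c0 * ln (real n)) powr (1 / \<alpha>) / b n) (1 / \<alpha> * (0 + 0) - 1 / \<alpha>)"
    by (intro has_order_divide has_order_powr has_order_mult has_order_const has_order_ln b_order c0_pos)
  then show ?thesis by (simp add: tilt_def[abs_def])
qed

lemma tilt_pos: "\<forall>\<^sub>F n in sequentially. 0 < tilt n"
  by (rule has_order_pos[OF tilt_order])

lemma inverse_tilt_at_top: "filterlim (\<lambda>n. 1 / tilt n) at_top sequentially"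
proof (rule has_order_at_top)
  show "has_order (\<lambda>n. 1 / tilt n) (0 - (- (1 / \<alpha>)))"
    by (intro has_order_divide has_order_const tilt_order) simp
qed (use alpha in auto)

text \<open>Four comparisons, each losing a factor 1 + e: \<open>Lam\<close> with K * G by the
  Abelian limit, G at \<open>c * z n\<close> with G at \<open>z n\<close> by regular variation, G at
  \<open>z n\<close> with G at \<open>b n\<close> by the limsup condition, and n * G (b n) with 1 /
  (\<alpha> * K). K cancels and c0 / \<alpha> remains.\<close>

lemma n_Lam_tilt_le_aux:
  assumes e: "0 < e"
  shows "\<forall>\<^sub>F n in sequentially. real n * Lam (tilt n) \<le> (1 + e) ^ 4 * (c0 / \<alpha>) * ln (real n)"
proof -
  define z where "z n = b n / ln (real n) powr (1 / \<alpha>)" for n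
  \<comment> \<open>With this c the reciprocal tilt is \<open>c * z n\<close>, and c powr (-
    \<alpha>) = c0.\<close>
  define c where "c = c0 powr (- (1 / \<alpha>))"
  have c: "c > 0" using c0_pos by (simp add: c_def)
  have zo: "has_order z (1 / \<alpha> - 0)"
    unfolding z_def[abs_def] by (intro has_order_divide b_order has_order_ln_powr)
  have z: "filterlim z at_top sequentially"
    by (rule has_order_at_top[OF zo]) (use alpha in auto)
  have it: "\<forall>\<^sub>F n in sequentially. 1 / tilt n = c * z n"
    using eventually_ln_real_gt[of 0] b_ge[of 1]
  proof eventually_elim
    case (elim n)
    then show ?case using c0_pos by (simp add: tilt_def z_def c_def powr_mult powr_minus field_simps)
  qed
  have "\<forall>\<^sub>F x in at_top. Lam (1 / x) / G x < (1 + e) * K"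
    using Lam_asymp_K by (rule order_tendstoD) (use K_pos e in simp)
  from filterlim_iff[THEN iffD1, OF inverse_tilt_at_top, rule_format, OF this]
  have 1: "\<forall>\<^sub>F n in sequentially. Lam (1 / (1 / tilt n)) / G (1 / tilt n) < (1 + e) * K" .
  have "((\<lambda>x. G (c * x) / G x) \<longlongrightarrow> c powr (- \<alpha>)) at_top"
    using G_rv c by (simp add: regularly_varying_def)
  moreover have "c powr (- \<alpha>) = c0" using c0_pos alpha by (simp add: c_def powr_powr)
  ultimately have "\<forall>\<^sub>F x in at_top. G (c * x) / G x < (1 + e) * c0"
    by (intro order_tendstoD(2)) (use c0_pos e in auto)
  from filterlim_iff[THEN iffD1, OF z, rule_format, OF this]
  have 2: "\<forall>\<^sub>F n in sequentially. G (c * z n) / G (z n) < (1 + e) * c0" .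
  have "limsup (\<lambda>n. ereal (G (z n) / (ln (real n) * G (b n)))) < ereal (1 + e)"
  proof (rule order.strict_trans1)
    show "limsup (\<lambda>n. ereal (G (z n) / (ln (real n) * G (b n)))) \<le> 1"
      using b_limsup unfolding z_def G_def .
    show "1 < ereal (1 + e)" using e by (simp add: one_ereal_def)
  qed
  then have 3: "\<forall>\<^sub>F n in sequentially. G (z n) / (ln (real n) * G (b n)) < 1 + e"
    by (drule_tac Limsup_lessD) simp
  show ?thesis
    using it 1 2 3 n_G_b_le[OF e] tilt_pos eventually_ln_real_gt[of 0]
      filterlim_iff[THEN iffD1, OF inverse_tilt_at_top, rule_format, OF G_pos]
      filterlim_iff[THEN iffD1, OF z, rule_format, OF G_pos]
      filterlim_iff[THEN iffD1, OF b_at_top, rule_format, OF G_pos]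
  proof eventually_elim
    case (elim n)
    have "tilt n = 1 / (1 / tilt n)" by simp
    then have "tilt n = 1 / (c * z n)" by (simp only: elim(1))
    then have "Lam (tilt n) \<le> (1 + e) * K * G (c * z n)"
      using elim(2,8) unfolding elim(1) by (simp add: pos_divide_less_eq)
    also have "\<dots> \<le> (1 + e) * K * ((1 + e) * c0 * G (z n))"
      using elim K_pos e by (intro mult_left_mono) (auto simp: field_simps)
    also have "\<dots> \<le> (1 + e) * K * ((1 + e) * c0 * ((1 + e) * (ln (real n) * G (b n))))"
      using elim K_pos e c0_pos by (intro mult_left_mono) (auto simp: pos_divide_less_eq)
    finally have "real n * Lam (tilt n) \<le> real n * ((1 + e) * K * ((1 + e) * c0 * ((1 + e) * (ln (real n) * G (b n)))))"
      by (intro mult_left_mono) auto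
    also have "\<dots> = (1 + e) ^ 3 * K * c0 * ln (real n) * (real n * G (b n))"
      by (simp add: power3_eq_cube mult_ac)
    also have "\<dots> \<le> (1 + e) ^ 3 * K * c0 * ln (real n) * ((1 + e) / (\<alpha> * K))"
      using elim K_pos e c0_pos by (intro mult_left_mono) auto
    also have "\<dots> = (1 + e) ^ 4 * (c0 / \<alpha>) * ln (real n)"
    proof -
      have "x * k * y * z * (w / (v * k)) = (x * w) * (y / v) * z" if "k \<noteq> 0" for x k y z w v :: real
        using that by simp
      moreover have "(1 + e) ^ 4 = (1 + e) ^ 3 * (1 + e)" by (simp add: eval_nat_numeral)
      ultimately show ?thesis using K_pos by auto
    qed
    finally show ?case .
  qed
qed

lemma n_Lam_tilt_le:
  assumes "c0 / \<alpha> < c"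
  shows "\<forall>\<^sub>F n in sequentially. real n * Lam (tilt n) \<le> c * ln (real n)"
proof -
  have "((\<lambda>e. (1 + e) ^ 4 * (c0 / \<alpha>)) \<longlongrightarrow> (1 + 0) ^ 4 * (c0 / \<alpha>)) (at_right 0)"
    by (intro tendsto_intros)
  then have "\<forall>\<^sub>F e in at_right 0. (1 + e) ^ 4 * (c0 / \<alpha>) < c"
    by (rule order_tendstoD) (use assms in simp)
  then have "\<forall>\<^sub>F e in at_right 0. (1 + e) ^ 4 * (c0 / \<alpha>) < c \<and> e > 0"
    using eventually_at_right_less by (rule eventually_conj)
  then obtain e where e: "(1 + e) ^ 4 * (c0 / \<alpha>) < c" "e > 0"
    using eventually_happens'[OF trivial_limit_at_right_real] by blast
  show ?thesis
    using n_Lam_tilt_le_aux[OF e(2)] eventually_ln_real_gt[of 0]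
  proof eventually_elim
    case (elim n)
    then have "(1 + e) ^ 4 * (c0 / \<alpha>) * ln (real n) \<le> c * ln (real n)"
      using e by (intro mult_right_mono) auto
    with elim show ?case by simp
  qed
qed

definition "thr t n = t * (c0 * ln (real n)) powr ((\<alpha> - 1) / \<alpha>) * b n"

lemma thr_order:
  assumes "0 < t" shows "has_order (thr t) (1 / \<alpha>)"
proof -
  have "has_order (thr t) (0 + (\<alpha> - 1) / \<alpha> * (0 + 0) + 1 / \<alpha>)"
    unfolding thr_def[abs_def]
    by (intro has_order_powr has_order_mult has_order_const has_order_ln b_order c0_pos assms)
  then show ?thesis by simp
qed

lemma thr_at_top:
  assumes "0 < t" shows "filterlim (thr t) at_top sequentially"
  by (rule has_order_at_top[OF thr_order[OF assms]]) (use alpha in auto)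

text \<open>It turns exp (- tilt * x) at the threshold into a pure power of n, with exponent - t *
  c0.\<close>

lemma tilt_thr: "\<forall>\<^sub>F n in sequentially. tilt n * thr t n = t * c0 * ln (real n)"
  using eventually_ln_real_gt[of 0] b_ge[of 1]
proof eventually_elim
  case (elim n)
  have "(c0 * ln (real n)) powr (1 / \<alpha>) * (c0 * ln (real n)) powr ((\<alpha> - 1) / \<alpha>) = (c0 * ln (real n)) powr 1"
    unfolding powr_add[symmetric] using alpha by (simp add: field_simps)
  then show ?case using elim c0_pos by (simp add: tilt_def thr_def)
qed

text \<open>The orders add up to 0 here, so the logarithmic scale cannot decide. The threshold
  exceeds b by the factor \<open>r n\<close>, a constant times a positive power of ln n, and
  Potter's bound from b to the threshold turns this factor into decay.\<close>

lemma n_G_thr_tendsto_0: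
  assumes "0 < t" shows "(\<lambda>n. real n * G (thr t n)) \<longlonglongrightarrow> 0"
proof -
  define r where "r n = t * (c0 * ln (real n)) powr ((\<alpha> - 1) / \<alpha>)" for n
  have r: "filterlim r at_top sequentially"
    unfolding r_def using c0_pos assms alpha by real_asymp
  define e where "e = \<alpha> / 2"
  have e: "e > 0" "- \<alpha> + e < 0" using alpha by (auto simp: e_def)
  obtain X where X: "X > 0" "\<And>x y. x \<ge> X \<Longrightarrow> y \<ge> x \<Longrightarrow> G y \<le> exp e * (y / x) powr (- \<alpha> + e) * G x"
    using regularly_varying_potter[OF G_rv e(1)] by auto
  define C where "C = (1 + 1) / (\<alpha> * K)"
  have "(\<lambda>n. r n powr (- \<alpha> + e)) \<longlonglongrightarrow> 0"
    by (rule tendsto_neg_powr[OF e(2) r])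
  then have l: "(\<lambda>n. exp e * r n powr (- \<alpha> + e) * C) \<longlonglongrightarrow> 0"
    by (intro tendsto_mult_left_zero tendsto_mult_right_zero)
  show ?thesis
  proof (rule Lim_null_comparison[OF _ l])
    have "\<forall>\<^sub>F n in sequentially. 1 \<le> r n" using r by (simp add: filterlim_at_top)
    then show "\<forall>\<^sub>F n in sequentially. norm (real n * G (thr t n)) \<le> exp e * r n powr (- \<alpha> + e) * C"
      using b_ge[of X] b_ge[of 1] n_G_b_le[OF zero_less_one]
    proof eventually_elim
      case (elim n)
      have tr: "thr t n = r n * b n" by (simp add: thr_def r_def)
      have "b n \<le> thr t n" using elim by (simp add: tr)
      then have "G (thr t n) \<le> exp e * r n powr (- \<alpha> + e) * G (b n)"
        using X(2)[of "b n" "thr t n"] elim by (simp add: tr)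
      then have "real n * G (thr t n) \<le> real n * (exp e * r n powr (- \<alpha> + e) * G (b n))"
        by (intro mult_left_mono) auto
      also have "\<dots> = exp e * r n powr (- \<alpha> + e) * (real n * G (b n))" by simp
      also have "\<dots> \<le> exp e * r n powr (- \<alpha> + e) * C"
        using elim by (intro mult_left_mono) (auto simp: C_def)
      finally show ?case using G_bounds(1) by simp
    qed
  qed
qed

text \<open>The bound of \<open>psi\<close> through \<open>Lam (1 / x)\<close> and x powr (- p)
  decreases in x, so uniformity reduces to the threshold itself. There the left part is a multiple
  of n * G and the right part has order 1 - p / \<alpha> < 0.\<close>

lemma n_psi_uniformly_small:
  assumes "0 < t" "0 < e"
  shows "\<forall>\<^sub>F n in sequentially. \<forall>x\<ge>thr t n. real n * psi x < e"
proof -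
  have "\<forall>\<^sub>F x in at_top. Lam (1 / x) / G x < K + 1"
    using Lam_asymp_K by (rule order_tendstoD) simp
  from filterlim_iff[THEN iffD1, OF thr_at_top[OF assms(1)], rule_format, OF this]
  have 1: "\<forall>\<^sub>F n in sequentially. Lam (1 / thr t n) / G (thr t n) < K + 1" .
  have "has_order (\<lambda>n. real n * thr t n powr (- p)) (1 + - p * (1 / \<alpha>))"
    by (intro has_order_mult has_order_powr has_order_real thr_order assms)
  moreover have "1 + - p * (1 / \<alpha>) < 0" using alpha p_bounds by (simp add: field_simps)
  ultimately have "(\<lambda>n. real n * thr t n powr (- p)) \<longlonglongrightarrow> 0" by (rule has_order_tendsto_0)
  then have "(\<lambda>n. 4 * ((K + 1) * (real n * G (thr t n))) + real n * thr t n powr (- p) * MP) \<longlonglongrightarrow> 4 * ((K + 1) * 0) + 0 * MP"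
    by (intro tendsto_intros n_G_thr_tendsto_0 assms)
  then have "\<forall>\<^sub>F n in sequentially. 4 * ((K + 1) * (real n * G (thr t n))) + real n * thr t n powr (- p) * MP < e"
    by (rule order_tendstoD) (use assms in simp)
  then show ?thesis
    using 1 has_order_pos[OF thr_order[OF assms(1)]] filterlim_iff[THEN iffD1, OF thr_at_top[OF assms(1)], rule_format, OF G_pos]
  proof eventually_elim
    case (elim n)
    show ?case
    proof (intro allI impI)
      fix x assume x: "thr t n \<le> x"
      have "psi x \<le> 4 * Lam (1 / x) + x powr (- p) * MP" using x elim by (intro psi_le) simp
      also have "\<dots> \<le> 4 * Lam (1 / thr t n) + thr t n powr (- p) * MP"
        using x elim p_bounds MP_nonneg by (intro add_mono mult_left_mono mult_right_mono Lam_mono powr_mono2') (auto simp: field_simps)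
      also have "\<dots> \<le> 4 * ((K + 1) * G (thr t n)) + thr t n powr (- p) * MP"
        using elim by (simp add: field_simps)
      finally have "real n * psi x \<le> real n * (4 * ((K + 1) * G (thr t n)) + thr t n powr (- p) * MP)"
        by (intro mult_left_mono) auto
      with elim show "real n * psi x < e" by (simp add: algebra_simps)
    qed
  qed
qed

end

section \<open>Random walks\<close>

lemma Delta_cases:
  "shifted_Delta x T = (if T = \<infinity> then {x<..} else {x<..x + real_of_ereal T})" if "0 < T"
proof (cases T)
  case (real r)
  have "y \<in> (\<lambda>y. x + y) ` {y. 0 < y \<and> y \<le> r} \<longleftrightarrow> x < y \<and> y \<le> x + r" for y
    by (auto simp: image_iff intro!: exI[of _ "y - x"])
  then show ?thesis using real by (auto simp: shifted_Delta_def Delta_def)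
next
  case PInf
  have "y \<in> (\<lambda>y. x + y) ` {y. 0 < y} \<longleftrightarrow> x < y" for y
    by (auto simp: image_iff intro!: exI[of _ "y - x"])
  then show ?thesis using PInf by (auto simp: shifted_Delta_def Delta_def)
qed (use that in auto)

lemma mem_shifted_Delta: "y \<in> shifted_Delta x T \<longleftrightarrow> 0 < y - x \<and> ereal (y - x) \<le> T"
  by (auto simp: shifted_Delta_def Delta_def image_iff intro!: exI[of _ "y - x"])

lemma shifted_Delta_borel [measurable]: "shifted_Delta x T \<in> sets borel"
proof (cases "0 < T")
  case True then show ?thesis by (simp add: Delta_cases)
next
  case False
  have "\<not> (0 < y \<and> ereal y \<le> T)" for y
  proof
    assume "0 < y \<and> ereal y \<le> T"
    then have "0 < ereal y" "ereal y \<le> T" by simp_all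
    then have "0 < T" by (rule order.strict_trans2)
    with False show False by simp
  qed
  then have "shifted_Delta x T = {}"
    unfolding shifted_Delta_def Delta_def by blast
  then show ?thesis by simp
qed

text \<open>The Fejer kernel on \<open>{- L..L}\<close>, written so that its Fourier transform is visible.\<close>

definition fejer :: "real \<Rightarrow> real \<Rightarrow> real" where
  "fejer L u = (LINT \<theta>:{0..L}|lborel. (L - \<theta>) * cos (\<theta> * u))"

lemma fejer_integrable: "set_integrable lborel {0..L} (\<lambda>\<theta>. (L - \<theta>) * cos (\<theta> * (u::real)))"
  by (rule borel_integrable_atLeastAtMost') (intro continuous_intros)

lemma fejer_eq:
  assumes "u \<noteq> 0" "0 \<le> L"
  shows "fejer L u = (1 - cos (L * u)) / u\<^sup>2"
proof -
  define F where "F \<theta> = (L - \<theta>) * sin (\<theta> * u) / u - cos (\<theta> * u) / u\<^sup>2" for \<theta>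
  have "((\<lambda>\<theta>. (L - \<theta>) * cos (\<theta> * u)) has_integral F L - F 0) {0..L}"
  proof (rule fundamental_theorem_of_calculus)
    fix \<theta> assume "\<theta> \<in> {0..L}"
    have "(F has_real_derivative (L - \<theta>) * cos (\<theta> * u)) (at \<theta>)"
      unfolding F_def using assms
      by (auto intro!: derivative_eq_intros simp: field_simps power2_eq_square)
    then show "(F has_vector_derivative (L - \<theta>) * cos (\<theta> * u)) (at \<theta> within {0..L})"
      by (simp add: has_real_derivative_iff_has_vector_derivative has_vector_derivative_at_within)
  qed (use assms in simp)
  then have "integral {0..L} (\<lambda>\<theta>. (L - \<theta>) * cos (\<theta> * u)) = F L - F 0"
    by (rule integral_unique)
  then show ?thesis
    unfolding fejer_def set_borel_integral_eq_integral(2)[OF fejer_integrable]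
    by (simp add: F_def diff_divide_distrib)
qed

lemma fejer_zero: "0 \<le> L \<Longrightarrow> 0 \<le> fejer L 0"
  unfolding fejer_def set_lebesgue_integral_def
  by (intro integral_nonneg_AE AE_I2) (auto split: split_indicator)

lemma fejer_nonneg: "0 \<le> L \<Longrightarrow> 0 \<le> fejer L u"
  by (cases "u = 0") (auto simp: fejer_eq fejer_zero)

lemma cos_ge_half:
  fixes x :: real assumes "0 \<le> x" "x \<le> 1/2" shows "1/2 \<le> cos x"
proof -
  have "cos (pi / 3) \<le> cos x" using assms pi_ge_two pi_gt3 by (intro cos_monotone_0_pi_le) auto
  then show ?thesis by (simp add: cos_60)
qed

text \<open>For \<open>L * u\<close> up to 1/2 every cosine in the integral is at least 1/2. The
  kernel therefore dominates a multiple of the indicator of an interval of length at most 1 / (2 *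
  L).\<close>

lemma fejer_ge:
  assumes "0 \<le> L" "0 \<le> u" "L * u \<le> 1/2"
  shows "L\<^sup>2 / 4 \<le> fejer L u"
proof -
  have "((\<lambda>\<theta>. (L - \<theta>) / 2) has_integral (L * L / 2 - L\<^sup>2 / 4) - (L * 0 / 2 - 0\<^sup>2 / 4)) {0..L}"
    using assms by (intro fundamental_theorem_of_calculus)
      (auto intro!: derivative_eq_intros simp: field_simps simp flip: has_real_derivative_iff_has_vector_derivative)
  then have I: "(LINT \<theta>:{0..L}|lborel. (L - \<theta>) / 2) = L\<^sup>2 / 4"
    by (subst nonneg_has_integral_imp_set_integral(2)) (auto simp: power2_eq_square)
  have I2: "set_integrable lborel {0..L} (\<lambda>\<theta>. (L - \<theta>) / 2)"
    by (intro borel_integrable_atLeastAtMost' continuous_intros) simp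
  show ?thesis
    unfolding I[symmetric] fejer_def
  proof (rule set_integral_mono[OF I2 fejer_integrable])
    fix \<theta> assume \<theta>: "\<theta> \<in> {0..L}"
    have "\<theta> * u \<le> L * u" using \<theta> assms by (intro mult_right_mono) auto
    then have "1/2 \<le> cos (\<theta> * u)" using assms \<theta> by (intro cos_ge_half) auto
    then have "(L - \<theta>) * (1/2) \<le> (L - \<theta>) * cos (\<theta> * u)" using \<theta> by (intro mult_left_mono) auto
    then show "(L - \<theta>) / 2 \<le> (L - \<theta>) * cos (\<theta> * u)" by simp
  qed
qed

section \<open>Independent summands with common law D\<close>

locale iid_walk = prob_space M for M :: "'a measure" +
  fixes X :: "nat \<Rightarrow> 'a \<Rightarrow> real" and D :: "real measure"
  assumes indep: "indep_vars (\<lambda>_. borel) X {1..}"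
    and distr_X: "\<And>i. i \<ge> 1 \<Longrightarrow> distr M borel (X i) = D"
begin

lemma rv_X: "i \<ge> 1 \<Longrightarrow> X i \<in> borel_measurable M"
  using indep by (auto simp: indep_vars_def)

lemma sets_D [measurable_cong, simp]: "sets D = sets borel"
  using distr_X[of 1] by (metis order_refl sets_distr)

lemma D_prob_space: "prob_space D"
  using distr_X[of 1] prob_space_distr[OF rv_X[of 1]] by simp

lemma sum_measurable: "J \<subseteq> {1..} \<Longrightarrow> (\<lambda>\<omega>. \<Sum>i\<in>J. X i \<omega>) \<in> borel_measurable M"
  using rv_X by (intro borel_measurable_sum) auto

lemma expectation_X:
  fixes g :: "real \<Rightarrow> 'c :: {banach, second_countable_topology}"
  assumes "i \<ge> 1" "g \<in> borel_measurable borel"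
  shows "expectation (\<lambda>\<omega>. g (X i \<omega>)) = (LINT y|D. g y)"
  using integral_distr[OF rv_X[OF assms(1)] assms(2)] distr_X[OF assms(1)] by simp

lemma integrable_X:
  fixes g :: "real \<Rightarrow> 'c :: {banach, second_countable_topology}"
  assumes "i \<ge> 1" "g \<in> borel_measurable borel" "integrable D g"
  shows "integrable M (\<lambda>\<omega>. g (X i \<omega>))"
  using integrable_distr_eq[OF rv_X[OF assms(1)] assms(2)] distr_X[OF assms(1)] assms(3) by simp

lemma prob_X:
  assumes "i \<ge> 1" "A \<in> sets borel"
  shows "prob {\<omega>\<in>space M. X i \<omega> \<in> A} = measure D A"
proof -
  have "measure (distr M borel (X i)) A = prob (X i -` A \<inter> space M)"
    by (rule measure_distr[OF rv_X[OF assms(1)] assms(2)])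
  moreover have "X i -` A \<inter> space M = {\<omega>\<in>space M. X i \<omega> \<in> A}" by auto
  ultimately show ?thesis using distr_X[OF assms(1)] by simp
qed

lemma indep_compose:
  assumes "\<And>i. i \<in> J \<Longrightarrow> g i \<in> borel_measurable borel" "J \<subseteq> {1..}"
  shows "indep_vars (\<lambda>_. borel) (\<lambda>i \<omega>. g i (X i \<omega>)) J"
  by (rule indep_vars_compose2[OF indep_vars_subset[OF indep assms(2)] assms(1)])

lemma expectation_prod:
  fixes g :: "real \<Rightarrow> 'c :: {real_normed_field, banach, second_countable_topology}"
  assumes g: "g \<in> borel_measurable borel" "integrable D g"
  shows "expectation (\<lambda>\<omega>. \<Prod>i=1..n. g (X i \<omega>)) = (LINT y|D. g y) ^ n"
    "integrable M (\<lambda>\<omega>. \<Prod>i=1..n. g (X i \<omega>))"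
proof -
  have i: "indep_vars (\<lambda>_. borel) (\<lambda>i \<omega>. g (X i \<omega>)) {1..n}"
    using g by (intro indep_compose) auto
  have "expectation (\<lambda>\<omega>. \<Prod>i=1..n. g (X i \<omega>)) = (\<Prod>i=1..n. expectation (\<lambda>\<omega>. g (X i \<omega>)))"
    by (rule indep_vars_lebesgue_integral[OF _ i integrable_X]) (use g in auto)
  also have "\<dots> = (\<Prod>i=1..n. LINT y|D. g y)"
    using g by (intro prod.cong expectation_X) auto
  finally show "expectation (\<lambda>\<omega>. \<Prod>i=1..n. g (X i \<omega>)) = (LINT y|D. g y) ^ n" by simp
  show "integrable M (\<lambda>\<omega>. \<Prod>i=1..n. g (X i \<omega>))"
    by (rule indep_vars_integrable[OF _ i integrable_X]) (use g in auto)
qed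

lemma truncated_exp_integrable:
  assumes "0 \<le> s"
  shows "integrable D (\<lambda>y. indicator {..h} y * exp (s * y) :: real)"
proof -
  interpret D: prob_space D by (rule D_prob_space)
  show ?thesis
  proof (rule D.integrable_const_bound[where B="exp (s * h)"])
    show "AE y in D. norm (indicator {..h} y * exp (s * y)) \<le> exp (s * h)"
      using assms by (intro AE_I2) (auto split: split_indicator simp: mult_left_mono)
  qed simp
qed

text \<open>One factor per summand carries both the constraint and the exponential weight, so the
  constraint on the maximum survives factorisation by independence.\<close>

lemma prod_truncated_exp:
  "(\<Prod>i=1..n. indicator {..h} (X i \<omega>) * exp (s * X i \<omega>)) =
    (if \<forall>i\<in>{1..n}. X i \<omega> \<le> h then exp (s * (\<Sum>i=1..n. X i \<omega>)) else (0::real))"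
proof (cases "\<forall>i\<in>{1..n}. X i \<omega> \<le> h")
  case True
  then have "(\<Prod>i=1..n. indicator {..h} (X i \<omega>) * exp (s * X i \<omega>)) = (\<Prod>i=1..n. exp (s * X i \<omega>))"
    by (intro prod.cong) auto
  then show ?thesis using True by (simp add: exp_sum sum_distrib_left)
next
  case False
  then obtain i where "i \<in> {1..n}" "\<not> X i \<omega> \<le> h" by auto
  then show ?thesis using False by (auto intro!: prod_zero bexI[of _ i])
qed

lemma truncated_event_measurable:
  assumes "A \<in> sets borel"
  shows "{\<omega>\<in>space M. (\<Sum>i=1..n. X i \<omega>) \<in> A \<and> (\<forall>i\<in>{1..n}. X i \<omega> \<le> h)} \<in> events"
proof -
  have 1: "{\<omega>\<in>space M. (\<Sum>i=1..n. X i \<omega>) \<in> A} \<in> events"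
    using measurable_sets[OF sum_measurable[of "{1..n}"] assms] by (simp add: vimage_def Int_def conj_commute)
  have "{\<omega>\<in>space M. \<forall>i\<in>{1..n}. X i \<omega> \<le> h} \<in> events"
    using rv_X by (intro sets.sets_Collect_finite_All) auto
  with 1 have "{\<omega>\<in>space M. (\<Sum>i=1..n. X i \<omega>) \<in> A} \<inter> {\<omega>\<in>space M. \<forall>i\<in>{1..n}. X i \<omega> \<le> h} \<in> events"
    by (rule sets.Int)
  then show ?thesis by (rule back_subst[of "\<lambda>B. B \<in> events"]) blast
qed

text \<open>The exponential Chebyshev inequality for the truncated weight. It sees only that the sum
  exceeds x and gains nothing from a short interval.\<close>

lemma prob_truncated_le_exp:
  assumes "0 \<le> s"
  shows "prob {\<omega>\<in>space M. (\<Sum>i=1..n. X i \<omega>) \<in> shifted_Delta x T \<and> (\<forall>i\<in>{1..n}. X i \<omega> \<le> h)}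
    \<le> exp (- s * x) * (LINT y|D. indicator {..h} y * exp (s * y)) ^ n" (is "prob ?A \<le> _")
proof -
  let ?g = "\<lambda>y. indicator {..h} y * exp (s * y) :: real"
  have g: "?g \<in> borel_measurable borel" by measurable
  have "prob ?A = expectation (indicator ?A)"
    using truncated_event_measurable[of "shifted_Delta x T"] by simp
  also have "\<dots> \<le> expectation (\<lambda>\<omega>. exp (- s * x) * (\<Prod>i=1..n. ?g (X i \<omega>)))"
  proof (rule integral_mono)
    show "integrable M (indicator ?A :: 'a \<Rightarrow> real)"
      using truncated_event_measurable[of "shifted_Delta x T"] by (simp add: less_top[symmetric])
    show "integrable M (\<lambda>\<omega>. exp (- s * x) * (\<Prod>i=1..n. ?g (X i \<omega>)))"
      by (intro integrable_mult_right expectation_prod g truncated_exp_integrable assms)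
    fix \<omega>
    have "1 \<le> exp (- s * x) * exp (s * S)" if "x < S" for S
      using that assms by (simp flip: exp_add add: mult_left_mono)
    then show "indicator ?A \<omega> \<le> exp (- s * x) * (\<Prod>i=1..n. ?g (X i \<omega>))"
      unfolding prod_truncated_exp by (auto simp: mem_shifted_Delta split: split_indicator)
  qed
  also have "\<dots> = exp (- s * x) * (LINT y|D. ?g y) ^ n"
    using expectation_prod(1)[OF g truncated_exp_integrable[OF assms]] by simp
  finally show ?thesis .
qed

text \<open>The indicator of the interval is dominated by 4 / L^2 times the Fejer kernel at S - x,
  multiplied by exp (s * (S - x)) \<ge> 1. Fubini turns this into an integral over frequencies in
  [0, L] of the real part of a rotated n-th power of the tilted transform. Frequencies below
  \<theta>1 are bounded by A and the others by B, so the first term carries the short length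
  \<theta>1.\<close>

lemma prob_truncated_le_fourier:
  fixes s h x :: real
  defines "\<phi> \<equiv> \<lambda>\<theta>. LINT y|D. complex_of_real (indicator {..h} y * exp (s * y)) * cis (\<theta> * y)"
  assumes s: "0 \<le> s" and T: "0 < T" "T < \<infinity>" and L: "0 < L" "L * real_of_ereal T \<le> 1/2"
    and A: "\<And>\<theta>. norm (\<phi> \<theta>) \<le> A" and B: "\<And>\<theta>. \<theta>1 \<le> \<theta> \<Longrightarrow> \<theta> \<le> L \<Longrightarrow> norm (\<phi> \<theta>) \<le> B" "0 \<le> B"
    and \<theta>1: "0 \<le> \<theta>1"
  shows "prob {\<omega>\<in>space M. (\<Sum>i=1..n. X i \<omega>) \<in> shifted_Delta x T \<and> (\<forall>i\<in>{1..n}. X i \<omega> \<le> h)}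
    \<le> exp (- s * x) * (4 / L * (\<theta>1 * A ^ n + L * B ^ n))" (is "prob ?A \<le> _")
proof -
  let ?g = "\<lambda>y. indicator {..h} y * exp (s * y) :: real"
  define G where "G \<omega> = (\<Prod>i=1..n. ?g (X i \<omega>))" for \<omega>
  define S where "S \<omega> = (\<Sum>i=1..n. X i \<omega>)" for \<omega>
  have S[measurable]: "S \<in> borel_measurable M" unfolding S_def[abs_def] by (rule sum_measurable) auto
  have gm: "?g \<in> borel_measurable borel" by measurable
  have Gint: "integrable M G" unfolding G_def[abs_def]
    by (intro expectation_prod gm truncated_exp_integrable s)
  then have G[measurable]: "G \<in> borel_measurable M" by simp
  have G0: "0 \<le> G \<omega>" for \<omega> unfolding G_def by (intro prod_nonneg) auto
  interpret pair_sigma_finite M lborel ..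
  \<comment> \<open>Integrated over \<theta> this gives the kernel times the product weight;
    integrated over \<omega> it is controlled by the n-th power of the transform.\<close>
  define F where "F \<omega> \<theta> = indicator {0..L} \<theta> * ((L - \<theta>) * cos (\<theta> * (S \<omega> - x)) * G \<omega>)" for \<omega> \<theta>
  have Fint: "integrable (M \<Otimes>\<^sub>M lborel) (case_prod F)"
  proof (rule Fubini_integrable)
    show "case_prod F \<in> borel_measurable (M \<Otimes>\<^sub>M lborel)" unfolding F_def by measurable
    have Fi: "integrable lborel (F \<omega>)" for \<omega>
      using integrable_mult_left[OF fejer_integrable[of L "S \<omega> - x", unfolded set_integrable_def], of "G \<omega>"]
      by (simp add: F_def[abs_def] mult_ac)
    then show "AE \<omega> in M. integrable lborel (\<lambda>\<theta>. case_prod F (\<omega>, \<theta>))" by simp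
    have "norm (F \<omega> \<theta>) \<le> indicator {0..L} \<theta> * (L * G \<omega>)" for \<omega> \<theta>
    proof (cases "\<theta> \<in> {0..L}")
      case True
      have "\<bar>L - \<theta>\<bar> * \<bar>cos (\<theta> * (S \<omega> - x))\<bar> \<le> L * 1" using True by (intro mult_mono) auto
      then have "\<bar>L - \<theta>\<bar> * \<bar>cos (\<theta> * (S \<omega> - x))\<bar> * G \<omega> \<le> L * 1 * G \<omega>" by (intro mult_right_mono G0)
      then show ?thesis using True G0 by (simp add: F_def abs_mult)
    qed (simp add: F_def)
    moreover have "integrable lborel (\<lambda>\<theta>. indicator {0..L} \<theta> * (L * G \<omega>))" for \<omega>
      using L by (intro integrable_mult_left integrable_real_indicator) auto
    ultimately have "(LINT \<theta>|lborel. norm (F \<omega> \<theta>)) \<le> (LINT \<theta>|lborel. indicator {0..L} \<theta> * (L * G \<omega>))" for \<omega>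
      by (intro integral_mono Fi integrable_norm) auto
    then have "(LINT \<theta>|lborel. norm (F \<omega> \<theta>)) \<le> L * L * G \<omega>" for \<omega>
      using L by (simp add: mult.assoc)
    then have N: "norm (LINT \<theta>|lborel. norm (F \<omega> \<theta>)) \<le> norm (L * L * G \<omega>)" for \<omega>
      using G0 by (simp add: abs_of_nonneg integral_nonneg_AE)
    have I: "integrable M (\<lambda>\<omega>. L * L * G \<omega>)" using Gint by simp
    have "(\<lambda>\<omega>. LINT \<theta>|lborel. norm (F \<omega> \<theta>)) \<in> borel_measurable M"
      unfolding F_def by measurable
    from Bochner_Integration.integrable_bound[OF I this AE_I2[OF N]]
    show "integrable M (\<lambda>\<omega>. LINT \<theta>|lborel. norm (case_prod F (\<omega>, \<theta>)))" by simp
  qed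
  have Ff: "(LINT \<theta>|lborel. F \<omega> \<theta>) = fejer L (S \<omega> - x) * G \<omega>" for \<omega>
    unfolding F_def fejer_def set_lebesgue_integral_def
    by (subst Bochner_Integration.integral_mult_left_zero[symmetric]) (simp add: mult_ac)
  have inner: "\<bar>LINT \<omega>|M. F \<omega> \<theta>\<bar> \<le> indicator {0..L} \<theta> * (L * norm (\<phi> \<theta>) ^ n)" for \<theta>
  proof (cases "\<theta> \<in> {0..L}")
    case True
    let ?gc = "\<lambda>y. complex_of_real (?g y) * cis (\<theta> * y)"
    have gcm: "?gc \<in> borel_measurable borel" by (simp add: cis_conv_exp) 
    have gci: "integrable D ?gc"
    proof (rule Bochner_Integration.integrable_bound[OF truncated_exp_integrable[OF s, of h]])
      show "AE y in D. norm (?gc y) \<le> norm (?g y)" by (simp add: norm_mult)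
    qed (use gcm in simp)
    have E: "expectation (\<lambda>\<omega>. \<Prod>i=1..n. ?gc (X i \<omega>)) = \<phi> \<theta> ^ n" "integrable M (\<lambda>\<omega>. \<Prod>i=1..n. ?gc (X i \<omega>))"
      unfolding \<phi>_def using expectation_prod[OF gcm gci] by auto
    have cs: "(\<Prod>i=1..n. cis (\<theta> * X i \<omega>)) = cis (\<theta> * S \<omega>)" for \<omega>
    proof -
      have "(\<Prod>i\<in>I. cis (\<theta> * X i \<omega>)) = cis (\<theta> * (\<Sum>i\<in>I. X i \<omega>))" if "finite I" for I
        using that by induction (auto simp: cis_mult distrib_left)
      then show ?thesis by (simp add: S_def)
    qed
    have pr: "(\<Prod>i=1..n. ?gc (X i \<omega>)) = complex_of_real (G \<omega>) * cis (\<theta> * S \<omega>)" for \<omega>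
      unfolding cs[symmetric] G_def by (simp add: prod.distrib)
    have "F \<omega> \<theta> = (L - \<theta>) * Re (cis (- (\<theta> * x)) * (\<Prod>i=1..n. ?gc (X i \<omega>)))" for \<omega>
    proof -
      have eq: "cis (- (\<theta> * x)) * (complex_of_real (G \<omega>) * cis (\<theta> * S \<omega>)) = complex_of_real (G \<omega>) * cis (\<theta> * (S \<omega> - x))"
        by (simp add: cis_mult algebra_simps mult.left_commute[of "cis _"])
      show ?thesis unfolding pr eq using True by (simp add: F_def)
    qed
    then have "(LINT \<omega>|M. F \<omega> \<theta>) = (L - \<theta>) * Re (cis (- (\<theta> * x)) * \<phi> \<theta> ^ n)"
      using E by (simp add: integral_Re)
    also have "\<bar>\<dots>\<bar> \<le> (L - \<theta>) * norm (cis (- (\<theta> * x)) * \<phi> \<theta> ^ n)"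
      using True abs_Re_le_cmod[of "cis (- (\<theta> * x)) * \<phi> \<theta> ^ n"] by (simp add: abs_mult mult_left_mono)
    also have "\<dots> \<le> L * norm (cis (- (\<theta> * x)) * \<phi> \<theta> ^ n)"
      using True by (intro mult_right_mono) auto
    finally show ?thesis using True by (simp add: norm_mult norm_power)
  qed (simp add: F_def)
  have A0: "0 \<le> A" using A[of 0] norm_ge_zero order_trans by blast
  have "(LINT \<omega>|M. fejer L (S \<omega> - x) * G \<omega>) = (LINT \<theta>|lborel. LINT \<omega>|M. F \<omega> \<theta>)"
    unfolding Ff[symmetric] using Fubini_integral[OF Fint] by simp
  also have "\<dots> \<le> (LINT \<theta>|lborel. indicator {0..\<theta>1} \<theta> * (L * A ^ n) + indicator {0..L} \<theta> * (L * B ^ n))"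
  proof (rule integral_mono)
    show "integrable lborel (\<lambda>\<theta>. LINT \<omega>|M. F \<omega> \<theta>)"
      using integrable_snd[OF Fint] .
    show "integrable lborel (\<lambda>\<theta>. indicator {0..\<theta>1} \<theta> * (L * A ^ n) + indicator {0..L} \<theta> * (L * B ^ n))"
      using L \<theta>1 by (intro Bochner_Integration.integrable_add integrable_mult_left integrable_real_indicator) auto
    fix \<theta>
    have "norm (\<phi> \<theta>) ^ n \<le> A ^ n" by (intro power_mono A) simp
    moreover have "norm (\<phi> \<theta>) ^ n \<le> B ^ n" if "\<theta>1 \<le> \<theta>" "\<theta> \<le> L" using that by (intro power_mono B) auto
    ultimately have "indicator {0..L} \<theta> * (L * norm (\<phi> \<theta>) ^ n) \<le> indicator {0..\<theta>1} \<theta> * (L * A ^ n) + indicator {0..L} \<theta> * (L * B ^ n)"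
      using L A0 B(2) by (cases "\<theta> \<le> \<theta>1") (auto split: split_indicator simp: add_increasing2)
    then show "(LINT \<omega>|M. F \<omega> \<theta>) \<le> indicator {0..\<theta>1} \<theta> * (L * A ^ n) + indicator {0..L} \<theta> * (L * B ^ n)"
      using inner[of \<theta>] by linarith
  qed
  also have "\<dots> = \<theta>1 * (L * A ^ n) + L * (L * B ^ n)"
    using \<theta>1 L by simp
  finally have main: "(LINT \<omega>|M. fejer L (S \<omega> - x) * G \<omega>) \<le> L * (\<theta>1 * A ^ n + L * B ^ n)"
    by (simp add: algebra_simps)
  have fGint: "integrable M (\<lambda>\<omega>. fejer L (S \<omega> - x) * G \<omega>)"
    using integrable_fst[OF Fint] by (simp add: Ff)
  have "prob ?A = expectation (indicator ?A)"
    using truncated_event_measurable[of "shifted_Delta x T"] by simp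
  also have "\<dots> \<le> expectation (\<lambda>\<omega>. exp (- s * x) * (4 / L\<^sup>2) * (fejer L (S \<omega> - x) * G \<omega>))"
  proof (rule integral_mono)
    show "integrable M (indicator ?A :: 'a \<Rightarrow> real)"
      using truncated_event_measurable[of "shifted_Delta x T"] by (simp add: less_top[symmetric])
    show "integrable M (\<lambda>\<omega>. exp (- s * x) * (4 / L\<^sup>2) * (fejer L (S \<omega> - x) * G \<omega>))"
      by (intro integrable_mult_right fGint)
    fix \<omega>
    show "indicator ?A \<omega> \<le> exp (- s * x) * (4 / L\<^sup>2) * (fejer L (S \<omega> - x) * G \<omega>)"
    proof (cases "\<omega> \<in> ?A")
      case True
      then have SD: "x < S \<omega>" "S \<omega> \<le> x + real_of_ereal T"
        using T by (auto simp: S_def Delta_cases)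
      have GS: "G \<omega> = exp (s * S \<omega>)" unfolding G_def prod_truncated_exp S_def using True by simp
      have "L * (S \<omega> - x) \<le> L * real_of_ereal T" using SD L by (intro mult_left_mono) auto
      then have "L * (S \<omega> - x) \<le> 1 / 2" using L(2) by linarith
      then have "L\<^sup>2 / 4 \<le> fejer L (S \<omega> - x)" using SD L by (intro fejer_ge) simp_all
      then have 1: "1 \<le> 4 / L\<^sup>2 * fejer L (S \<omega> - x)" using L by (simp add: field_simps)
      have 2: "1 \<le> exp (- s * x) * G \<omega>"
        unfolding GS using SD s by (simp flip: exp_add add: mult_left_mono)
      have "1 * 1 \<le> (4 / L\<^sup>2 * fejer L (S \<omega> - x)) * (exp (- s * x) * G \<omega>)"
        using 1 2 by (intro mult_mono) auto
      then show ?thesis using True by (simp add: mult_ac)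
    next
      case False
      have "0 \<le> exp (- s * x) * (4 / L\<^sup>2) * (fejer L (S \<omega> - x) * G \<omega>)"
        using L by (intro mult_nonneg_nonneg fejer_nonneg G0) auto
      then show ?thesis using False by simp
    qed
  qed
  also have "\<dots> = exp (- s * x) * (4 / L\<^sup>2) * expectation (\<lambda>\<omega>. fejer L (S \<omega> - x) * G \<omega>)" by simp
  also have "\<dots> \<le> exp (- s * x) * (4 / L\<^sup>2) * (L * (\<theta>1 * A ^ n + L * B ^ n))"
    by (intro mult_left_mono main) auto
  also have "\<dots> = exp (- s * x) * (4 / L * (\<theta>1 * A ^ n + L * B ^ n))"
    using L by (simp add: power2_eq_square field_simps)
  finally show ?thesis .
qed

section \<open>Chebyshev bound for partial sums by truncation\<close>

lemma second_moment_centered_sum: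
  assumes g: "g \<in> borel_measurable borel" and bd: "\<And>y. \<bar>g y\<bar> \<le> c" and z: "(LINT y|D. g y) = 0"
    and J: "finite J" "J \<subseteq> {1..}"
  shows "expectation (\<lambda>\<omega>. (\<Sum>i\<in>J. g (X i \<omega>))\<^sup>2) = real (card J) * (LINT y|D. (g y)\<^sup>2)"
    "integrable M (\<lambda>\<omega>. (\<Sum>i\<in>J. g (X i \<omega>))\<^sup>2)"
proof -
  have m: "i \<in> J \<Longrightarrow> (\<lambda>\<omega>. g (X i \<omega>)) \<in> borel_measurable M" for i
    using J rv_X[of i] g by (auto intro!: measurable_compose[OF _ g])
  have c: "0 \<le> c" using bd[of 0] by linarith
  have int: "integrable M (\<lambda>\<omega>. g (X i \<omega>) * g (X j \<omega>))" if "i \<in> J" "j \<in> J" for i j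
  proof (rule integrable_const_bound[where B="c * c"])
    show "AE \<omega> in M. norm (g (X i \<omega>) * g (X j \<omega>)) \<le> c * c"
      using bd c by (auto simp: abs_mult intro!: mult_mono)
  qed (use m that in measurable)
  have int1: "integrable M (\<lambda>\<omega>. g (X i \<omega>))" if "i \<in> J" for i
    by (rule integrable_const_bound[where B=c]) (use bd m that in auto)
  have e: "expectation (\<lambda>\<omega>. g (X i \<omega>) * g (X j \<omega>)) = (if i = j then (LINT y|D. (g y)\<^sup>2) else 0)" if "i \<in> J" "j \<in> J" for i j
  proof (cases "i = j")
    case True
    have "expectation (\<lambda>\<omega>. (g (X i \<omega>))\<^sup>2) = (LINT y|D. (g y)\<^sup>2)"
      using that J g by (intro expectation_X) auto
    then show ?thesis using True by (simp add: power2_eq_square)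
  next
    case False
    have "indep_var borel (\<lambda>\<omega>. g (X i \<omega>)) borel (\<lambda>\<omega>. g (X j \<omega>))"
    proof -
      have "indep_var borel (X i) borel (X j)"
      proof -
        have "indep_var (PiM {i} (\<lambda>_. borel)) (\<lambda>\<omega>. restrict (\<lambda>i. X i \<omega>) {i}) (PiM {j} (\<lambda>_. borel)) (\<lambda>\<omega>. restrict (\<lambda>i. X i \<omega>) {j})"
          using that J False by (intro indep_var_restrict[OF indep]) auto
        then have "indep_var borel ((\<lambda>v. v i) \<circ> (\<lambda>\<omega>. restrict (\<lambda>i. X i \<omega>) {i})) borel ((\<lambda>v. v j) \<circ> (\<lambda>\<omega>. restrict (\<lambda>i. X i \<omega>) {j}))"
          by (rule indep_var_compose) (auto intro: measurable_component_singleton)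
        then show ?thesis by (simp add: comp_def)
      qed
      then show ?thesis using indep_var_compose[OF _ g g] by (simp add: comp_def)
    qed
    then have "expectation (\<lambda>\<omega>. g (X i \<omega>) * g (X j \<omega>)) = expectation (\<lambda>\<omega>. g (X i \<omega>)) * expectation (\<lambda>\<omega>. g (X j \<omega>))"
      using int1 that by (intro indep_var_lebesgue_integral) auto
    then show ?thesis using that J g False z by (auto simp: expectation_X subset_iff)
  qed
  have sq: "(\<Sum>i\<in>J. g (X i \<omega>))\<^sup>2 = (\<Sum>i\<in>J. \<Sum>j\<in>J. g (X i \<omega>) * g (X j \<omega>))" for \<omega>
    by (simp add: power2_eq_square sum_product)
  show "integrable M (\<lambda>\<omega>. (\<Sum>i\<in>J. g (X i \<omega>))\<^sup>2)"
    unfolding sq by (intro Bochner_Integration.integrable_sum int)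
  have "expectation (\<lambda>\<omega>. (\<Sum>i\<in>J. g (X i \<omega>))\<^sup>2) = (\<Sum>i\<in>J. \<Sum>j\<in>J. expectation (\<lambda>\<omega>. g (X i \<omega>) * g (X j \<omega>)))"
    unfolding sq using int by (simp add: Bochner_Integration.integral_sum Bochner_Integration.integrable_sum)
  also have "\<dots> = (\<Sum>i\<in>J. \<Sum>j\<in>J. if i = j then (LINT y|D. (g y)\<^sup>2) else 0)"
    by (intro sum.cong refl e)
  also have "\<dots> = real (card J) * (LINT y|D. (g y)\<^sup>2)"
    using J by (simp add: sum.delta)
  finally show "expectation (\<lambda>\<omega>. (\<Sum>i\<in>J. g (X i \<omega>))\<^sup>2) = real (card J) * (LINT y|D. (g y)\<^sup>2)" .
qed

text \<open>Each summand is split at size x: the centred bounded part is handled by its second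
  moment, the rest by its first absolute moment. Since D has mean 0, the mean m of the bounded part
  is minus that of the rest, so centring costs at most x * \<open>ps\<close> per summand. Giving
  half of e * x to each part produces 4 / e^2 and 4 / e.\<close>

lemma prob_sum_gt_le:
  assumes int: "integrable D (\<lambda>y. y)" and z: "(LINT y|D. y) = 0"
    and J: "finite J" "J \<subseteq> {1..}" and e: "0 < e" and x: "0 < x"
  shows "prob {\<omega>\<in>space M. \<bar>\<Sum>i\<in>J. X i \<omega>\<bar> > e * x}
    \<le> (4 / e\<^sup>2 + 4 / e) * real (card J) * (LINT y|D. min ((y / x)\<^sup>2) \<bar>y / x\<bar>)"
proof -
  interpret D: prob_space D by (rule D_prob_space)
  define ps where "ps = (LINT y|D. min ((y / x)\<^sup>2) \<bar>y / x\<bar>)"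
  have psi: "integrable D (\<lambda>y. min ((y / x)\<^sup>2) \<bar>y / x\<bar>)"
  proof (rule Bochner_Integration.integrable_bound)
    show "integrable D (\<lambda>y. y / x)" using int by simp
  qed auto
  have min_small: "(y / x)\<^sup>2 \<le> \<bar>y / x\<bar>" if "\<bar>y\<bar> \<le> x" for y
  proof -
    have "\<bar>y / x\<bar> \<le> 1" using that x by simp
    then have "\<bar>y / x\<bar> * \<bar>y / x\<bar> \<le> \<bar>y / x\<bar>" by (intro mult_left_le) auto
    then show ?thesis by (simp add: power2_eq_square flip: abs_mult)
  qed
  have min_large: "\<bar>y / x\<bar> \<le> (y / x)\<^sup>2" if "\<bar>y\<bar> > x" for y
  proof -
    have "\<bar>y / x\<bar> \<ge> 1" using that x by simp
    then have "\<bar>y / x\<bar> * \<bar>y / x\<bar> \<ge> \<bar>y / x\<bar> * 1" by (intro mult_left_mono) auto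
    then show ?thesis by (simp add: power2_eq_square flip: abs_mult)
  qed
  define Y where "Y y = indicator {-x..x} y * y" for y :: real
  define Z where "Z y = indicator (- {-x..x}) y * \<bar>y\<bar>" for y :: real
  define W where "W y = indicator (- {-x..x}) y * y" for y :: real
  have Ym: "Y \<in> borel_measurable borel" and Zm: "Z \<in> borel_measurable borel" and Wm: "W \<in> borel_measurable borel"
    unfolding Y_def[abs_def] Z_def[abs_def] W_def[abs_def] by measurable
  have Yb: "\<bar>Y y\<bar> \<le> x" for y using x by (auto simp: Y_def split: split_indicator)
  have Yi: "integrable D Y"
    by (rule D.integrable_const_bound[where B=x]) (use Yb Ym in auto)
  have Yi2: "integrable D (\<lambda>y. (Y y)\<^sup>2)"
    by (rule D.integrable_const_bound[where B="x\<^sup>2"]) (use Yb Ym x in \<open>auto simp: abs_le_square_iff[symmetric]\<close>)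
  have Zi: "integrable D Z" by (rule Bochner_Integration.integrable_bound[OF int]) (use Zm in \<open>auto simp: Z_def split: split_indicator\<close>)
  have Wi: "integrable D W" by (rule Bochner_Integration.integrable_bound[OF int]) (use Wm in \<open>auto simp: W_def split: split_indicator\<close>)
  define m where "m = (LINT y|D. Y y)"
  have mW: "(LINT y|D. W y) = - m"
  proof -
    have "(LINT y|D. Y y + W y) = (LINT y|D. y)"
      by (intro Bochner_Integration.integral_cong) (auto simp: Y_def W_def split: split_indicator)
    then show ?thesis using Yi Wi z by (simp add: m_def)
  qed
  have mZ: "\<bar>m\<bar> \<le> (LINT y|D. Z y)"
  proof -
    have "\<bar>LINT y|D. W y\<bar> \<le> (LINT y|D. \<bar>W y\<bar>)" by (rule integral_abs_bound)
    also have "(LINT y|D. \<bar>W y\<bar>) = (LINT y|D. Z y)"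
      by (intro Bochner_Integration.integral_cong) (auto simp: Z_def W_def split: split_indicator)
    finally show ?thesis by (simp add: mW)
  qed
  have Zps: "(LINT y|D. Z y) \<le> x * ps"
  proof -
    have "(LINT y|D. Z y) \<le> (LINT y|D. x * min ((y / x)\<^sup>2) \<bar>y / x\<bar>)"
    proof (rule integral_mono[OF Zi])
      fix y show "Z y \<le> x * min ((y / x)\<^sup>2) \<bar>y / x\<bar>"
        using min_large[of y] x by (auto simp: Z_def min_absorb2 split: split_indicator)
    qed (use psi in simp)
    then show ?thesis by (simp add: ps_def)
  qed
  have Yps: "(LINT y|D. (Y y)\<^sup>2) \<le> x\<^sup>2 * ps"
  proof -
    have "(LINT y|D. (Y y)\<^sup>2) \<le> (LINT y|D. x\<^sup>2 * min ((y / x)\<^sup>2) \<bar>y / x\<bar>)"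
    proof (rule integral_mono[OF Yi2])
      fix y show "(Y y)\<^sup>2 \<le> x\<^sup>2 * min ((y / x)\<^sup>2) \<bar>y / x\<bar>"
        using min_small[of y] x by (auto simp: Y_def min_absorb1 power_divide split: split_indicator)
    qed (use psi in simp)
    then show ?thesis by (simp add: ps_def)
  qed
  define Y' where "Y' y = Y y - m" for y
  have Y'm: "Y' \<in> borel_measurable borel" unfolding Y'_def[abs_def] using Ym by simp
  have Y'b: "\<bar>Y' y\<bar> \<le> x + \<bar>m\<bar>" for y using Yb[of y] by (simp add: Y'_def)
  have Y'z: "(LINT y|D. Y' y) = 0" unfolding Y'_def using Yi D.prob_space by (simp add: m_def)
  have Y'2: "(LINT y|D. (Y' y)\<^sup>2) \<le> x\<^sup>2 * ps"
  proof -
    have "(LINT y|D. (Y' y)\<^sup>2) = (LINT y|D. (Y y)\<^sup>2 - (2 * m) * Y y + m\<^sup>2)"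
      unfolding Y'_def by (intro Bochner_Integration.integral_cong) (auto simp: power2_diff)
    also have "\<dots> = (LINT y|D. (Y y)\<^sup>2) - m\<^sup>2"
      using Yi Yi2 D.prob_space by (simp add: m_def power2_eq_square)
    finally show ?thesis using Yps zero_le_power2[of m] by linarith
  qed
  define U V where "U \<omega> = (\<Sum>i\<in>J. Y' (X i \<omega>))" and "V \<omega> = (\<Sum>i\<in>J. Z (X i \<omega>) + \<bar>m\<bar>)" for \<omega>
  have U2: "expectation (\<lambda>\<omega>. (U \<omega>)\<^sup>2) \<le> real (card J) * (x\<^sup>2 * ps)" and U2i: "integrable M (\<lambda>\<omega>. (U \<omega>)\<^sup>2)"
    unfolding U_def using second_moment_centered_sum[OF Y'm Y'b Y'z J] Y'2 by (auto intro!: mult_left_mono)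
  have Vi: "integrable M V"
    unfolding V_def using J Zi Zm by (auto intro!: Bochner_Integration.integrable_sum Bochner_Integration.integrable_add integrable_X)
  have V1: "expectation V \<le> real (card J) * (2 * x * ps)"
  proof -
    have "expectation V = (\<Sum>i\<in>J. expectation (\<lambda>\<omega>. Z (X i \<omega>)) + \<bar>m\<bar>)"
      unfolding V_def using J Zi Zm prob_space
      by (subst Bochner_Integration.integral_sum) (auto intro!: Bochner_Integration.integrable_add integrable_X sum.cong Bochner_Integration.integral_add[THEN trans])
    also have "\<dots> = (\<Sum>i\<in>J. (LINT y|D. Z y) + \<bar>m\<bar>)"
      using J Zm by (intro sum.cong) (auto simp: expectation_X subset_iff)
    also have "\<dots> \<le> (\<Sum>i\<in>J. 2 * x * ps)"
      using mZ Zps by (intro sum_mono) auto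
    finally show ?thesis by simp
  qed
  have split: "\<bar>\<Sum>i\<in>J. X i \<omega>\<bar> \<le> \<bar>U \<omega>\<bar> + V \<omega>" for \<omega>
  proof -
    have eq: "y = Y' y + (W y + m)" for y by (auto simp: Y'_def Y_def W_def split: split_indicator)
    have "(\<Sum>i\<in>J. X i \<omega>) = (\<Sum>i\<in>J. Y' (X i \<omega>) + (W (X i \<omega>) + m))"
      using eq by (intro sum.cong) auto
    also have "\<dots> = U \<omega> + (\<Sum>i\<in>J. W (X i \<omega>) + m)" by (simp add: U_def sum.distrib)
    finally have 1: "(\<Sum>i\<in>J. X i \<omega>) = U \<omega> + (\<Sum>i\<in>J. W (X i \<omega>) + m)" .
    have "\<bar>W y + m\<bar> \<le> Z y + \<bar>m\<bar>" for y by (auto simp: W_def Z_def split: split_indicator)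
    then have "\<bar>\<Sum>i\<in>J. W (X i \<omega>) + m\<bar> \<le> V \<omega>"
      unfolding V_def by (intro order_trans[OF sum_abs] sum_mono)
    with 1 show ?thesis by linarith
  qed
  have V0: "0 \<le> V \<omega>" for \<omega> unfolding V_def by (intro sum_nonneg) (auto simp: Z_def)
  have Um: "U \<in> borel_measurable M"
  proof -
    have "(\<lambda>\<omega>. Y' (X i \<omega>)) \<in> borel_measurable M" if "i \<in> J" for i
      using that J by (intro measurable_compose[OF rv_X Y'm]) auto
    then show ?thesis unfolding U_def by (intro borel_measurable_sum)
  qed
  have Vm: "V \<in> borel_measurable M" using Vi by simp
  have "prob {\<omega>\<in>space M. \<bar>\<Sum>i\<in>J. X i \<omega>\<bar> > e * x}
    \<le> prob ({\<omega>\<in>space M. (U \<omega>)\<^sup>2 \<ge> (e * x / 2)\<^sup>2} \<union> {\<omega>\<in>space M. V \<omega> \<ge> e * x / 2})"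
  proof (rule finite_measure_mono)
    show "{\<omega>\<in>space M. \<bar>\<Sum>i\<in>J. X i \<omega>\<bar> > e * x} \<subseteq> {\<omega>\<in>space M. (U \<omega>)\<^sup>2 \<ge> (e * x / 2)\<^sup>2} \<union> {\<omega>\<in>space M. V \<omega> \<ge> e * x / 2}"
    proof
      fix \<omega> assume w: "\<omega> \<in> {\<omega>\<in>space M. \<bar>\<Sum>i\<in>J. X i \<omega>\<bar> > e * x}"
      have "e * x / 2 \<le> \<bar>U \<omega>\<bar> \<or> e * x / 2 \<le> V \<omega>" using split[of \<omega>] w by auto
      moreover have "(e * x / 2)\<^sup>2 \<le> (U \<omega>)\<^sup>2" if "e * x / 2 \<le> \<bar>U \<omega>\<bar>"
        using power_mono[OF that, of 2] e x by simp
      ultimately show "\<omega> \<in> {\<omega>\<in>space M. (U \<omega>)\<^sup>2 \<ge> (e * x / 2)\<^sup>2} \<union> {\<omega>\<in>space M. V \<omega> \<ge> e * x / 2}"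
        using w by blast
    qed
  qed (use Um Vm in measurable)
  also have "\<dots> \<le> prob {\<omega>\<in>space M. (U \<omega>)\<^sup>2 \<ge> (e * x / 2)\<^sup>2} + prob {\<omega>\<in>space M. V \<omega> \<ge> e * x / 2}"
    by (intro measure_subadditive) (use Um Vm in auto)
  also have "\<dots> \<le> expectation (\<lambda>\<omega>. (U \<omega>)\<^sup>2) / (e * x / 2)\<^sup>2 + expectation V / (e * x / 2)"
    using e x V0 by (intro add_mono integral_Markov_inequality_measure[where A="{}"] U2i Vi) auto
  also have "\<dots> \<le> real (card J) * (x\<^sup>2 * ps) / (e * x / 2)\<^sup>2 + real (card J) * (2 * x * ps) / (e * x / 2)"
    using e x by (intro add_mono divide_right_mono U2 V1) auto
  also have "\<dots> = (4 / e\<^sup>2 + 4 / e) * real (card J) * ps"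
    using e x by (simp add: power2_eq_square field_simps)
  finally show ?thesis by (simp add: ps_def)
qed

text \<open>Fubini on the product law. V is left arbitrary because the lower bound for one jump
  conditions on a modified sum.\<close>

lemma prob_indep_pair:
  assumes ind: "indep_var borel (X i) borel V" and i: "i \<ge> 1" and B: "B \<in> sets (borel \<Otimes>\<^sub>M borel)"
  shows "prob {\<omega>\<in>space M. (X i \<omega>, V \<omega>) \<in> B} = expectation (\<lambda>\<omega>. measure D {y. (y, V \<omega> :: real) \<in> B})"
    "(\<lambda>\<omega>. measure D {y. (y, V \<omega>) \<in> B}) \<in> borel_measurable M"
proof -
  interpret D: prob_space D by (rule D_prob_space)
  have Vm: "V \<in> borel_measurable M" using ind by (rule indep_var_rv2)
  interpret V: prob_space "distr M borel V" by (rule prob_space_distr[OF Vm])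
  interpret P: pair_prob_space D "distr M borel V" ..
  have eq: "D \<Otimes>\<^sub>M distr M borel V = distr M (borel \<Otimes>\<^sub>M borel) (\<lambda>\<omega>. (X i \<omega>, V \<omega>))"
    using ind distr_X[OF i] unfolding indep_var_distribution_eq by simp
  have Bs: "B \<in> sets (D \<Otimes>\<^sub>M distr M borel V)"
    using B sets_pair_measure_cong[of D borel "distr M borel V" borel] by simp
  have pm: "(\<lambda>\<omega>. (X i \<omega>, V \<omega>)) \<in> measurable M (borel \<Otimes>\<^sub>M borel)"
    using rv_X[OF i] Vm by measurable
  have mm: "(\<lambda>v. measure D ((\<lambda>y. (y, v)) -` B)) \<in> borel_measurable (distr M borel V)"
    using P.measurable_emeasure_Pair2[OF Bs]
    unfolding measure_def by simp
  then have mm': "(\<lambda>v. measure D ((\<lambda>y. (y, v)) -` B)) \<in> borel_measurable borel" by simp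
  show "(\<lambda>\<omega>. measure D {y. (y, V \<omega>) \<in> B}) \<in> borel_measurable M"
    using measurable_compose[OF Vm mm'] by (simp add: vimage_def)
  have "prob {\<omega>\<in>space M. (X i \<omega>, V \<omega>) \<in> B} = measure (distr M (borel \<Otimes>\<^sub>M borel) (\<lambda>\<omega>. (X i \<omega>, V \<omega>))) B"
    using measure_distr[OF pm B] by (simp add: vimage_def Int_def conj_commute)
  also have "\<dots> = measure (D \<Otimes>\<^sub>M distr M borel V) B" by (simp add: eq)
  also have "\<dots> = (LINT v|distr M borel V. measure D ((\<lambda>y. (y, v)) -` B))"
  proof -
    have "emeasure (D \<Otimes>\<^sub>M distr M borel V) B = (\<integral>\<^sup>+v. emeasure D ((\<lambda>y. (y, v)) -` B) \<partial>distr M borel V)"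
      by (rule P.emeasure_pair_measure_alt2[OF Bs])
    also have "\<dots> = (\<integral>\<^sup>+v. ennreal (measure D ((\<lambda>y. (y, v)) -` B)) \<partial>distr M borel V)"
      by (simp add: D.emeasure_eq_measure)
    also have "\<dots> = ennreal (LINT v|distr M borel V. measure D ((\<lambda>y. (y, v)) -` B))"
      by (intro nn_integral_eq_integral V.integrable_const_bound[where B=1] mm) auto
    finally show ?thesis
      by (simp add: measure_def integral_nonneg_AE)
  qed
  also have "\<dots> = expectation (\<lambda>\<omega>. measure D ((\<lambda>y. (y, V \<omega>)) -` B))"
    by (rule integral_distr[OF Vm mm'])
  finally show "prob {\<omega>\<in>space M. (X i \<omega>, V \<omega>) \<in> B} = expectation (\<lambda>\<omega>. measure D {y. (y, V \<omega> :: real) \<in> B})"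
    by (simp add: vimage_def)
qed

lemma indep_var_function_of_others:
  assumes "i \<ge> 1" "J \<subseteq> {1..}" "i \<notin> J" "\<Phi> \<in> borel_measurable (PiM J (\<lambda>_. borel))"
  shows "indep_var borel (X i) borel (\<lambda>\<omega>. \<Phi> (restrict (\<lambda>j. X j \<omega>) J))"
proof -
  have "indep_var (PiM {i} (\<lambda>_. borel)) (\<lambda>\<omega>. restrict (\<lambda>i. X i \<omega>) {i}) (PiM J (\<lambda>_. borel)) (\<lambda>\<omega>. restrict (\<lambda>i. X i \<omega>) J)"
    using assms by (intro indep_var_restrict[OF indep]) auto
  then have "indep_var borel ((\<lambda>v. v i) \<circ> (\<lambda>\<omega>. restrict (\<lambda>i. X i \<omega>) {i})) borel (\<Phi> \<circ> (\<lambda>\<omega>. restrict (\<lambda>i. X i \<omega>) J))"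
    by (rule indep_var_compose) (auto intro: measurable_component_singleton assms)
  then show ?thesis by (simp add: comp_def)
qed

end

section \<open>Local regular variation and Fourier transforms\<close>

text \<open>As 1 - cos w is twice the square of sin (w / 2), its square root acts as a distance on
  the circle, and this is the triangle inequality squared.\<close>

lemma one_minus_cos_diff_le:
  fixes u v :: real
  shows "1 - cos (u - v) \<le> 2 * ((1 - cos u) + (1 - cos v))"
proof -
  have c: "1 - cos w = 2 * (sin (w / 2))\<^sup>2" for w :: real
    using cos_double_sin[of "w / 2"] by simp
  have "sin ((u - v) / 2) = sin (u / 2) * cos (v / 2) - cos (u / 2) * sin (v / 2)"
    by (simp add: diff_divide_distrib sin_diff)
  moreover have "\<bar>sin (u / 2) * cos (v / 2)\<bar> \<le> \<bar>sin (u / 2)\<bar> * 1"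
    unfolding abs_mult by (intro mult_left_mono) auto
  moreover have "\<bar>cos (u / 2) * sin (v / 2)\<bar> \<le> 1 * \<bar>sin (v / 2)\<bar>"
    unfolding abs_mult by (intro mult_right_mono) auto
  ultimately have "\<bar>sin ((u - v) / 2)\<bar> \<le> \<bar>sin (u / 2)\<bar> + \<bar>sin (v / 2)\<bar>" by linarith
  then have "(sin ((u - v) / 2))\<^sup>2 \<le> (\<bar>sin (u / 2)\<bar> + \<bar>sin (v / 2)\<bar>)\<^sup>2"
    using power_mono[of "\<bar>sin ((u - v) / 2)\<bar>" _ 2] by simp
  also have "\<dots> \<le> 2 * ((sin (u / 2))\<^sup>2 + (sin (v / 2))\<^sup>2)"
    using sum_squares_bound[of "\<bar>sin (u / 2)\<bar>" "\<bar>sin (v / 2)\<bar>"] by (simp add: power2_sum)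
  finally show ?thesis unfolding c by simp
qed

lemma cos_le_half:
  fixes w :: real assumes "pi / 3 \<le> w" "w \<le> 5 * pi / 3" shows "cos w \<le> 1 / 2"
proof (cases "w \<le> pi")
  case True
  have "cos w \<le> cos (pi / 3)" using assms True by (intro cos_monotone_0_pi_le) auto
  then show ?thesis by (simp add: cos_60)
next
  case False
  have "cos (2 * pi - w) \<le> cos (pi / 3)" using assms False by (intro cos_monotone_0_pi_le) auto
  then show ?thesis by (simp add: cos_60 cos_diff)
qed

text \<open>After rotating the transform onto the positive real axis, no point of \<open>A\<close> and point of \<open>B\<close> can
  both be nearly in phase.\<close>

lemma (in real_distribution) fourier_gap:
  fixes g :: "real \<Rightarrow> real"
  assumes g: "integrable M g" "\<And>y. 0 \<le> g y"
    and A: "A \<in> sets borel" "B \<in> sets borel"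
    and sep: "\<And>x y. x \<in> A \<Longrightarrow> y \<in> B \<Longrightarrow> 1 / 2 \<le> 1 - cos (\<theta> * x - \<theta> * y)"
    and \<gamma>: "0 \<le> \<gamma>" "\<And>y. y \<in> A \<union> B \<Longrightarrow> \<gamma> \<le> g y"
  shows "norm (LINT y|M. complex_of_real (g y) * cis (\<theta> * y))
    \<le> (LINT y|M. g y) - \<gamma> / 8 * min (prob A) (prob B)"
proof -
  let ?\<phi> = "LINT y|M. complex_of_real (g y) * cis (\<theta> * y)"
  have gm[measurable]: "g \<in> borel_measurable borel" using borel_measurable_integrable[OF g(1)] by simp
  have cint: "integrable M (\<lambda>y. complex_of_real (g y) * cis (\<theta> * y))"
  proof (rule Bochner_Integration.integrable_bound[OF g(1)])
    show "(\<lambda>y. complex_of_real (g y) * cis (\<theta> * y)) \<in> borel_measurable M"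
      by (simp add: cis_conv_exp)
  qed (simp add: norm_mult)
  define a where "a = Arg ?\<phi>"
  define q where "q y = 1 - cos (\<theta> * y - a)" for y
  have q0: "0 \<le> q y" for y by (simp add: q_def)
  have qm[measurable]: "q \<in> borel_measurable borel" unfolding q_def[abs_def] by measurable
  have gq: "integrable M (\<lambda>y. g y * cos (\<theta> * y - a))"
    by (rule Bochner_Integration.integrable_bound[OF g(1)]) (auto simp: abs_mult mult_left_le)
  have "complex_of_real (norm z) = cis (- Arg z) * z" for z
  proof -
    have "cis (- Arg z) * z = cis (- Arg z) * (complex_of_real (norm z) * cis (Arg z))"
      using rcis_cmod_Arg[of z] by (simp add: rcis_def)
    also have "\<dots> = complex_of_real (norm z) * (cis (- Arg z) * cis (Arg z))" by (simp only: mult_ac)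
    finally show ?thesis by (simp add: cis_mult)
  qed
  then have "complex_of_real (norm ?\<phi>) = cis (- a) * ?\<phi>" unfolding a_def .
  also have "\<dots> = (LINT y|M. cis (- a) * (complex_of_real (g y) * cis (\<theta> * y)))" by simp
  finally have "norm ?\<phi> = Re (LINT y|M. cis (- a) * (complex_of_real (g y) * cis (\<theta> * y)))"
    by (metis Re_complex_of_real)
  also have "\<dots> = (LINT y|M. Re (cis (- a) * (complex_of_real (g y) * cis (\<theta> * y))))"
    using cint by (intro integral_Re[symmetric] integrable_mult_right)
  also have "\<dots> = (LINT y|M. g y * cos (\<theta> * y - a))"
  proof (intro Bochner_Integration.integral_cong refl)
    fix y
    have eq: "cis (- a) * (complex_of_real (g y) * cis (\<theta> * y)) = complex_of_real (g y) * cis (\<theta> * y - a)"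
      by (simp add: cis_mult mult.left_commute[of "cis _"] algebra_simps)
    show "Re (cis (- a) * (complex_of_real (g y) * cis (\<theta> * y))) = g y * cos (\<theta> * y - a)"
      unfolding eq by simp
  qed
  finally have n: "norm ?\<phi> = (LINT y|M. g y * cos (\<theta> * y - a))" .
  have "(LINT y|M. g y) - norm ?\<phi> = (LINT y|M. g y * q y)"
    unfolding n using g(1) gq by (subst Bochner_Integration.integral_diff[symmetric]) (auto simp: q_def algebra_simps)
  moreover have "\<gamma> / 8 * min (prob A) (prob B) \<le> (LINT y|M. g y * q y)"
  proof -
    have gqi: "integrable M (\<lambda>y. g y * q y)"
      using Bochner_Integration.integrable_diff[OF g(1) gq] by (simp add: q_def algebra_simps)
    have lower: "\<gamma> / 8 * prob C \<le> (LINT y|M. g y * q y)"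
      if C: "C \<in> sets borel" "C \<subseteq> A \<union> B" "\<And>y. y \<in> C \<Longrightarrow> 1 / 8 \<le> q y" for C
    proof -
      have "\<gamma> / 8 * prob C = (LINT y|M. \<gamma> / 8 * indicator C y)" using C by simp
      also have "\<dots> \<le> (LINT y|M. g y * q y)"
      proof (intro integral_mono gqi)
        show "integrable M (\<lambda>y. \<gamma> / 8 * indicator C y)"
          using C by (intro integrable_mult_right integrable_real_indicator) (auto simp: less_top[symmetric])
        fix y
        have "\<gamma> * (1 / 8) \<le> g y * q y" if "y \<in> C"
          using that C \<gamma> g(2) by (intro mult_mono) auto
        then show "\<gamma> / 8 * indicator C y \<le> g y * q y"
          using g(2)[of y] q0[of y] by (auto split: split_indicator)
      qed
      finally show ?thesis .
    qed
    \<comment> \<open>Either all of A is out of phase by 1/8, or one point x of A with q x < 1/8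
      forces all of B out of phase: 1/2 \<le> 2 * (q x + q y) leaves q y > 1/8.\<close>
    show ?thesis
    proof (cases "\<forall>x\<in>A. 1 / 8 \<le> q x")
      case True
      then have "\<gamma> / 8 * prob A \<le> (LINT y|M. g y * q y)" using A by (intro lower) auto
      moreover have "\<gamma> / 8 * min (prob A) (prob B) \<le> \<gamma> / 8 * prob A" using \<gamma> by (intro mult_left_mono) auto
      ultimately show ?thesis by linarith
    next
      case False
      then obtain x where x: "x \<in> A" "q x < 1 / 8" by auto
      have "1 / 8 \<le> q y" if "y \<in> B" for y
        using one_minus_cos_diff_le[of "\<theta> * x - a" "\<theta> * y - a"] sep[OF x(1) that] x(2) by (simp add: q_def)
      then have "\<gamma> / 8 * prob B \<le> (LINT y|M. g y * q y)" using A by (intro lower) auto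
      moreover have "\<gamma> / 8 * min (prob A) (prob B) \<le> \<gamma> / 8 * prob B" using \<gamma> by (intro mult_left_mono) auto
      ultimately show ?thesis by linarith
    qed
  qed
  ultimately show ?thesis by linarith
qed

section \<open>Regular variation of the mass of x + \<Delta>\<close>

locale heavy_left_tail_local = heavy_left_tail_norming +
  fixes T :: ereal
  assumes T_pos: "0 < T" and f_rv_ex: "\<exists>\<rho>. regularly_varying (\<lambda>x. measure D (shifted_Delta x T)) \<rho>"
begin

definition "f x = prob (shifted_Delta x T)"

text \<open>Only the existence of an index is given; one is selected, and its sign is then recovered
  from the right tail.\<close>

definition "\<rho> = (SOME r. regularly_varying f r)"

lemma f_rv: "regularly_varying f \<rho>"
  using someI_ex[OF f_rv_ex] unfolding \<rho>_def f_def[abs_def] by simp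

lemma f_pos: "\<exists>X>0. \<forall>x\<ge>X. 0 < f x"
  using regularly_varying_potter[OF f_rv zero_less_one] by auto

lemma f_le_tail: "f x \<le> prob {x<..}"
  unfolding f_def by (rule finite_measure_mono) (auto simp: mem_shifted_Delta)

text \<open>Since f is bounded by the right tail, comparing logarithms over ln x gives \<rho> \<le>
  - \<beta>.\<close>

lemma rho_neg: "\<rho> < 0"
proof -
  have "\<rho> \<le> - \<beta>"
  proof (rule tendsto_le[OF _ regularly_varying_ln_ratio[OF right_rv] regularly_varying_ln_ratio[OF f_rv]])
    obtain X where X: "X > 0" "\<And>x. x \<ge> X \<Longrightarrow> 0 < f x" using f_pos by auto
    show "\<forall>\<^sub>F x in at_top. ln (f x) / ln x \<le> ln (prob {x<..}) / ln x"
      using eventually_ge_at_top[of X] eventually_gt_at_top[of 1]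
    proof eventually_elim
      case (elim x)
      then have "ln (f x) \<le> ln (prob {x<..})"
        using X(2)[of x] f_le_tail[of x] by (intro ln_mono) auto
      then show ?case using elim by (intro divide_right_mono) auto
    qed
  qed simp
  then show ?thesis using alpha alpha_beta by linarith
qed

text \<open>For finite T the function f need not be monotone, and this bound replaces monotonicity.
  Potter's slack is taken equal to - \<rho>, so that the upper exponent is 0 and the power of w /
  (\<delta> * x) becomes 1.\<close>

lemma f_le_const:
  assumes "0 < \<delta>" "\<delta> \<le> 1"
  shows "\<exists>X>0. \<exists>C>0. \<forall>x\<ge>X. \<forall>w\<ge>\<delta> * x. f w \<le> C * f x"
proof -
  define e where "e = - \<rho>"
  have e: "e > 0" using rho_neg by (simp add: e_def)
  obtain X where X: "X > 0" "\<And>x y. x \<ge> X \<Longrightarrow> y \<ge> x \<Longrightarrow> 0 < f x \<and> f y \<le> exp e * (y / x) powr (\<rho> + e) * f x"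
    using regularly_varying_potter[OF f_rv e] by auto
  obtain Y where Y: "Y > 0" "\<And>x. x \<ge> Y \<Longrightarrow> 0 < f x \<and> f (\<delta> * x) \<le> exp 1 * \<delta> powr \<rho> * f x"
    using regularly_varying_uniform[OF f_rv assms(1) zero_less_one, of \<delta>] by auto
  show ?thesis
  proof (rule exI[of _ "max Y (X / \<delta>)"], intro conjI exI[of _ "exp e * (exp 1 * \<delta> powr \<rho>)"] allI impI)
    fix x w assume x: "max Y (X / \<delta>) \<le> x" and w: "\<delta> * x \<le> w"
    have dx: "X \<le> \<delta> * x" using x assms by (simp add: field_simps)
    have "f w \<le> exp e * (w / (\<delta> * x)) powr (\<rho> + e) * f (\<delta> * x)" using X(2)[OF dx w] by simp
    also have "(w / (\<delta> * x)) powr (\<rho> + e) = 1"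
    proof -
      have "0 < \<delta> * x" "0 < w" using dx w X(1) by linarith+
      then have "w / (\<delta> * x) \<noteq> 0" by auto
      then show ?thesis by (simp only: e_def add.right_inverse powr_zero_eq_one if_False)
    qed
    also have "exp e * 1 * f (\<delta> * x) \<le> exp e * (exp 1 * \<delta> powr \<rho> * f x)" using Y(2)[of x] x by simp
    finally show "f w \<le> exp e * (exp 1 * \<delta> powr \<rho>) * f x" by (simp add: mult_ac)
  qed (use Y(1) assms in auto)
qed

text \<open>A shift by u with |u| \<le> \<eta> * x is a dilation by c = 1 - u / x close to 1, where
  regular variation is uniform.\<close>

lemma f_shift_close:
  assumes "0 < e"
  shows "\<exists>\<eta>>0. \<eta> < 1/2 \<and> (\<exists>X>0. \<forall>x\<ge>X. \<forall>u. \<bar>u\<bar> \<le> \<eta> * x \<longrightarrow> (1 - e) * f x \<le> f (x - u) \<and> f (x - u) \<le> (1 + e) * f x)"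
proof -
  \<comment> \<open>Half a logarithm, because two factors exp d are lost: one in uniform
    convergence, one in c powr \<rho> near c = 1.\<close>
  define d where "d = ln (1 + min e (1/2)) / 2"
  have d: "d > 0" using assms by (simp add: d_def)
  have e1: "exp (2 * d) \<le> 1 + e" "1 - e \<le> exp (- (2 * d))"
  proof -
    have 1: "exp (2 * d) = 1 + min e (1/2)" using assms by (simp add: d_def)
    then show "exp (2 * d) \<le> 1 + e" by simp
    have "(1 - min e (1/2)) * (1 + min e (1/2)) \<le> 1" by (simp add: algebra_simps)
    then have "1 - min e (1/2) \<le> 1 / (1 + min e (1/2))" using assms by (simp add: field_simps)
    then show "1 - e \<le> exp (- (2 * d))" unfolding exp_minus 1 by (simp add: inverse_eq_divide)
  qed
  have "((\<lambda>c. c powr \<rho>) \<longlongrightarrow> 1 powr \<rho>) (at 1)" by (intro tendsto_powr tendsto_intros) auto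
  then have "\<forall>\<^sub>F c in at 1. c powr \<rho> \<in> {exp (- d)<..<exp d}"
    using d by (intro topological_tendstoD) auto
  then obtain r where r: "r > 0" "\<And>c. c \<noteq> 1 \<Longrightarrow> dist c 1 < r \<Longrightarrow> exp (- d) < c powr \<rho> \<and> c powr \<rho> < exp d"
    unfolding eventually_at by auto
  define \<eta> where "\<eta> = min (r / 2) (1/4)"
  have \<eta>: "\<eta> > 0" "\<eta> < 1/2" "\<eta> < r" using r by (auto simp: \<eta>_def min_def)
  have cr: "exp (- d) \<le> c powr \<rho> \<and> c powr \<rho> \<le> exp d" if "\<bar>c - 1\<bar> \<le> \<eta>" for c
    using r(2)[of c] that \<eta> d by (cases "c = 1") (auto simp: dist_real_def)
  obtain X where X: "X > 0" "\<And>x c. x \<ge> X \<Longrightarrow> c \<in> {1 - \<eta>..1 + \<eta>} \<Longrightarrow> 0 < f x \<and>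
    exp (- d) * c powr \<rho> * f x \<le> f (c * x) \<and> f (c * x) \<le> exp d * c powr \<rho> * f x"
    using regularly_varying_uniform[OF f_rv _ d, of "1 - \<eta>" "1 + \<eta>"] \<eta> by auto
  show ?thesis
  proof (rule exI[of _ \<eta>], intro conjI \<eta>(1,2), rule exI[of _ X], intro conjI X(1) allI impI)
    fix x u assume x: "X \<le> x" and u: "\<bar>u\<bar> \<le> \<eta> * x"
    define c where "c = 1 - u / x"
    have x0: "x > 0" using x X(1) by simp
    have c1: "\<bar>c - 1\<bar> \<le> \<eta>" using u x0 by (simp add: c_def abs_divide pos_divide_le_eq)
    then have "c \<in> {1 - \<eta>..1 + \<eta>}" by auto
    note b = X(2)[OF x this]
    have cx: "c * x = x - u" using x0 by (simp add: c_def field_simps)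
    have dd: "exp (- d) * exp (- d) = exp (- (2 * d))" "exp d * exp d = exp (2 * d)" by (simp_all flip: exp_add)
    have "(1 - e) * f x \<le> exp (- d) * exp (- d) * f x" using e1 b unfolding dd by (intro mult_right_mono) auto
    also have "\<dots> \<le> exp (- d) * c powr \<rho> * f x" using cr[OF c1] b by (intro mult_right_mono mult_left_mono) auto
    also have "\<dots> \<le> f (x - u)" using b by (simp add: cx)
    finally show "(1 - e) * f x \<le> f (x - u)" .
    have "f (x - u) \<le> exp d * c powr \<rho> * f x" using b by (simp add: cx)
    also have "\<dots> \<le> exp d * exp d * f x" using cr[OF c1] b by (intro mult_right_mono mult_left_mono) auto
    also have "\<dots> \<le> (1 + e) * f x" using e1 b unfolding dd by (intro mult_right_mono) auto
    finally show "f (x - u) \<le> (1 + e) * f x" .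
  qed
qed

text \<open>The power of x by which f may fall below the right tail: none for the half-line, one for
  a bounded interval.\<close>

definition "\<tau> = (if T = \<infinity> then 0 else 1 :: real)"

text \<open>The block \<open>{x<..2 * x}\<close> holds at least half of the tail mass, as 2 powr (-
  \<beta>) < 1/2, and it is covered by at most q * x translates of (0, T], each of mass at most C *
  f x.\<close>

lemma f_lower_finite:
  assumes "T < \<infinity>"
  shows "\<exists>X>0. \<exists>c>0. \<forall>x\<ge>X. c * prob {x<..} / x \<le> f x"
proof -
  define r where "r = real_of_ereal T"
  have r: "r > 0" using T_pos assms by (cases T) (auto simp: r_def)
  have fr: "f x = prob {x<..x + r}" for x
    using T_pos assms by (simp add: f_def Delta_cases r_def)
  obtain X C where X: "X > 0" and C: "C > 0" "\<And>x w. x \<ge> X \<Longrightarrow> w \<ge> 1 * x \<Longrightarrow> f w \<le> C * f x"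
    using f_le_const[of 1] by auto
  have "((\<lambda>x. prob {2 * x<..} / prob {x<..}) \<longlongrightarrow> 2 powr (- \<beta>)) at_top"
    using right_rv by (auto simp: regularly_varying_def)
  moreover have "(2::real) powr (- \<beta>) < 2 powr (- 1)" using alpha alpha_beta by (intro powr_less_mono) auto
  then have "(2::real) powr (- \<beta>) < 1 / 2" by simp
  ultimately have "\<forall>\<^sub>F x in at_top. prob {2 * x<..} / prob {x<..} < 1 / 2" by (rule order_tendstoD)
  then obtain Y where Y: "\<And>x. x \<ge> Y \<Longrightarrow> prob {2 * x<..} / prob {x<..} < 1 / 2" by (auto simp: eventually_at_top_linorder)
  obtain X2 where X2: "\<And>x. x \<ge> X2 \<Longrightarrow> 0 < f x" using f_pos by auto
  define q where "q = 1 / r + 1"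
  have q: "q > 0" using r by (simp add: q_def add_pos_pos)
  define c where "c = 1 / (2 * q * C)"
  have c: "c > 0" using q C by (simp add: c_def)
  have "c * prob {x<..} / x \<le> f x" if x: "x \<ge> max (max X 1) (max Y X2)" for x
  proof -
    have x1: "x \<ge> 1" using x by simp
    define N where "N = nat \<lceil>x / r\<rceil>"
    have "0 \<le> x / r" using x1 r by simp
    then have N: "x / r \<le> real N" "real N \<le> x / r + 1" unfolding N_def by linarith+
    have "{x<..2 * x} \<subseteq> (\<Union>k<N. {x + real k * r<..x + real k * r + r})"
    proof
      fix y assume y: "y \<in> {x<..2 * x}"
      \<comment> \<open>The pieces are closed on the right, hence the ceiling minus 1: an endpoint
        belongs to the piece that ends there.\<close>
      define k where "k = nat (\<lceil>(y - x) / r\<rceil> - 1)"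
      have p: "(y - x) / r > 0" using y r by simp
      then have k: "real k < (y - x) / r" "(y - x) / r \<le> real k + 1"
        unfolding k_def by (linarith)+
      have "(y - x) / r \<le> x / r" using y r by (intro divide_right_mono) auto
      with k N have "real k < real N" by linarith
      then have "k < N" by simp
      moreover have "y \<in> {x + real k * r<..x + real k * r + r}"
        using k r by (auto simp: field_simps)
      ultimately show "y \<in> (\<Union>k<N. {x + real k * r<..x + real k * r + r})" by blast
    qed
    then have "prob {x<..2 * x} \<le> prob (\<Union>k<N. {x + real k * r<..x + real k * r + r})"
      by (intro finite_measure_mono) auto
    also have "\<dots> \<le> (\<Sum>k<N. prob {x + real k * r<..x + real k * r + r})"
      by (intro finite_measure_subadditive_finite) auto
    also have "\<dots> \<le> (\<Sum>k<N. C * f x)"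
      using x r by (intro sum_mono) (auto simp: fr[symmetric] intro!: C(2))
    also have "\<dots> = real N * (C * f x)" by simp
    also have "\<dots> \<le> (q * x) * (C * f x)"
    proof (intro mult_right_mono)
      show "real N \<le> q * x" using N x1 by (simp add: q_def algebra_simps)
    qed (use C(1) X2[of x] x in \<open>auto intro!: mult_nonneg_nonneg\<close>)
    finally have 1: "prob {x<..2 * x} \<le> (q * x) * (C * f x)" .
    have "prob {x<..} = prob {x<..2 * x} + prob {2 * x<..}"
      using x1 by (subst finite_measure_Union[symmetric]) (auto intro!: arg_cong[where f=prob])
    moreover have px: "prob {x<..} > 0" using X2[of x] f_le_tail[of x] x by linarith
    moreover have "prob {2 * x<..} < prob {x<..} / 2" using Y[of x] x px by (simp add: field_simps)
    ultimately have "prob {x<..} / 2 \<le> (q * x) * (C * f x)" using 1 by linarith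
    then have "prob {x<..} \<le> (2 * q * C) * (f x * x)" by (simp add: mult_ac)
    then show ?thesis
      using q C x1 by (simp add: c_def pos_divide_le_eq mult_ac)
  qed
  then show ?thesis using X c by (intro exI[of _ "max (max X 1) (max Y X2)"] conjI exI[of _ c]) auto
qed

lemma f_lower:
  assumes "0 < e"
  shows "\<exists>X>0. \<exists>c>0. \<forall>x\<ge>X. c * x powr (- (\<beta> + \<tau> + e)) \<le> f x"
proof -
  obtain X c where X: "X > 0" "c > 0" and b: "\<And>x. x \<ge> X \<Longrightarrow> c * x powr (- \<beta> - e) \<le> prob {x<..}"
    using regularly_varying_power_bounds[OF right_rv assms] by auto
  show ?thesis
  proof (cases "T = \<infinity>")
    case True
    then have fx: "f x = prob {x<..}" for x unfolding f_def using Delta_cases[OF T_pos, of x] by simp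
    have \<tau>0: "\<tau> = 0" unfolding \<tau>_def using True by simp
    show ?thesis unfolding \<tau>0 fx
    proof (rule exI[of _ X], intro conjI X(1), rule exI[of _ c], intro conjI X(2) allI impI)
      fix x assume "X \<le> x"
      then show "c * x powr (- (\<beta> + 0 + e)) \<le> prob {x<..}" using b[of x] by simp
    qed
  next
    case False
    then obtain Y c' where Y: "Y > 0" "c' > 0" "\<And>x. x \<ge> Y \<Longrightarrow> c' * prob {x<..} / x \<le> f x"
      using f_lower_finite by (auto simp: less_top)
    show ?thesis
    proof (rule exI[of _ "max X Y"], intro conjI exI[of _ "c' * c"] allI impI)
      fix x assume x: "max X Y \<le> x"
      have x0: "x > 0" using x X(1) by simp
      have "x powr (- (\<beta> + \<tau> + e)) = x powr (- \<beta> - e) * x powr (- 1)"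
      proof -
        have "- (\<beta> + \<tau> + e) = (- \<beta> - e) + - 1" using False by (simp add: \<tau>_def)
        then show ?thesis by (simp only: powr_add)
      qed
      then have "c' * c * x powr (- (\<beta> + \<tau> + e)) = c' * (c * x powr (- \<beta> - e)) / x"
        using x0 by (simp add: powr_minus_divide)
      also have "\<dots> \<le> c' * prob {x<..} / x"
        using b[of x] x x0 Y by (intro divide_right_mono mult_left_mono) auto
      also have "\<dots> \<le> f x" using Y x by auto
      finally show "c' * c * x powr (- (\<beta> + \<tau> + e)) \<le> f x" .
    qed (use X Y in auto)
  qed
qed

end

section \<open>Gap between the tilted transform and its value at the origin\<close>

context heavy_left_tail_local
begin

definition "mgf s h = (LINT y|D. indicator {..h} y * exp (s * y))"

definition "chf s h \<theta> = (LINT y|D. complex_of_real (indicator {..h} y * exp (s * y)) * cis (\<theta> * y))"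

lemma norm_chf_le_mgf:
  assumes "0 \<le> s" shows "norm (chf s h \<theta>) \<le> mgf s h"
proof -
  have "norm (chf s h \<theta>) \<le> (LINT y|D. norm (complex_of_real (indicator {..h} y * exp (s * y)) * cis (\<theta> * y)))"
    unfolding chf_def by (rule integral_norm_bound)
  then show ?thesis by (simp add: mgf_def norm_mult)
qed

lemma body_mass: "\<exists>c>0. 1 / 2 \<le> prob {-c..c}"
proof -
  have "(\<lambda>n. prob {- real n..real n}) \<longlonglongrightarrow> prob (\<Union>n. {- real n..real n})"
    by (intro finite_Lim_measure_incseq) (auto simp: incseq_def)
  moreover have "(\<Union>n. {- real n..real n}) = UNIV"
  proof -
    have "\<exists>n. x \<in> {- real n..real n}" for x :: real
    proof -
      obtain n where "\<bar>x\<bar> \<le> real n" using real_arch_simple by blast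
      then have "x \<in> {- real n..real n}" by auto
      then show ?thesis ..
    qed
    then show ?thesis by blast
  qed
  ultimately have "(\<lambda>n. prob {- real n..real n}) \<longlonglongrightarrow> 1" using prob_space by simp
  then have "\<forall>\<^sub>F n in sequentially. 1 / 2 < prob {- real n..real n}" by (rule order_tendstoD) simp
  then have "\<forall>\<^sub>F n in sequentially. 1 / 2 < prob {- real n..real n} \<and> n > 0"
    using eventually_gt_at_top[of "0::nat"] by (rule eventually_conj)
  then obtain n where "1 / 2 < prob {- real n..real n}" "n > 0"
    using eventually_happens'[OF sequentially_bot] by blast
  then show ?thesis by (intro exI[of _ "real n"]) auto
qed

text \<open>A far left block of mass comparable to G x. At frequency 1 / x its phases lie between -3
  and -2, well away from those of the bulk near 0.\<close>

lemma left_mass: "\<exists>d>0. \<exists>X>0. \<forall>x\<ge>X. d * G x \<le> prob {- (3 * x)<..- (2 * x)}"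
proof -
  define d where "d = (2 powr (- \<alpha>) - 3 powr (- \<alpha>)) / 2"
  have d: "d > 0" using alpha by (simp add: d_def powr_less_mono2_neg)
  have "((\<lambda>x. G (2 * x) / G x - G (3 * x) / G x) \<longlongrightarrow> 2 powr (- \<alpha>) - 3 powr (- \<alpha>)) at_top"
    using G_rv by (intro tendsto_diff) (auto simp: regularly_varying_def)
  then have "\<forall>\<^sub>F x in at_top. d < G (2 * x) / G x - G (3 * x) / G x"
    by (rule order_tendstoD) (use d in \<open>simp add: d_def\<close>)
  then have "\<forall>\<^sub>F x in at_top. d * G x \<le> prob {- (3 * x)<..- (2 * x)}"
    using G_pos eventually_gt_at_top[of 0]
  proof eventually_elim
    case (elim x)
    have "G (2 * x) = prob {..- (3 * x)} + prob {- (3 * x)<..- (2 * x)}"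
      unfolding G_def cdf_def using elim
      by (subst finite_measure_Union[symmetric]) (auto intro!: arg_cong[where f=prob])
    then have "G (2 * x) - G (3 * x) = prob {- (3 * x)<..- (2 * x)}" by (simp add: G_def cdf_def)
    moreover have "d * G x \<le> G (2 * x) - G (3 * x)" using elim by (simp add: field_simps)
    ultimately show ?case by simp
  qed
  then obtain X where "\<And>x. x \<ge> X \<Longrightarrow> d * G x \<le> prob {- (3 * x)<..- (2 * x)}"
    by (auto simp: eventually_at_top_linorder)
  then show ?thesis using d by (rule_tac exI[where x=d], intro conjI, simp, rule_tac exI[where x="max X 1"]) auto
qed

text \<open>Frequencies between \<open>s\<close> and a constant: a far left block against the bulk.\<close>

lemma chf_gap_small:
  "\<exists>\<theta>0>0. \<exists>d>0. \<exists>h0\<ge>0. \<forall>s h \<theta>. 0 \<le> s \<longrightarrow> s \<le> \<theta> \<longrightarrow> \<theta> \<le> \<theta>0 \<longrightarrow> h0 \<le> h \<longrightarrow> 0 < \<theta> \<longrightarrow>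
    norm (chf s h \<theta>) \<le> mgf s h - min d (d * G (1 / \<theta>))"
proof -
  obtain c where c: "c > 0" "1 / 2 \<le> prob {-c..c}" using body_mass by auto
  obtain d X where d: "d > 0" and X: "X > 0" and dX: "\<And>x. x \<ge> X \<Longrightarrow> d * G x \<le> prob {- (3 * x)<..- (2 * x)}"
    using left_mass by blast
  \<comment> \<open>The bound 1 / X makes the left block available at x = 1 / \<theta>; 1 / (2 * c)
    keeps the phases of the bulk within 1/2 of 0. Phase differences then lie in [3/2, 7/2], where
    the cosine is at most 1/2.\<close>
  define \<theta>0 where "\<theta>0 = min (1 / X) (1 / (2 * c))"
  \<comment> \<open>The tilt weight is smallest at y = - 3 * x, where s * y \<ge> - 3 because s
    \<le> \<theta> = 1 / x.\<close>
  define \<gamma> where "\<gamma> = exp (- 3 :: real)"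
  have \<gamma>: "0 < \<gamma>" by (simp add: \<gamma>_def)
  define d' where "d' = \<gamma> / 8 * min d (1 / 2)"
  have d': "0 < d'" using \<gamma> d by (simp add: d'_def)
  have "norm (chf s h \<theta>) \<le> mgf s h - min d' (d' * G (1 / \<theta>))"
    if s: "0 \<le> s" "s \<le> \<theta>" and \<theta>: "\<theta> \<le> \<theta>0" "0 < \<theta>" and h: "c \<le> h" for s h \<theta>
  proof -
    define x where "x = 1 / \<theta>"
    have x: "x \<ge> X" "x \<ge> 2 * c" using \<theta> X c by (auto simp: x_def \<theta>0_def field_simps)
    have tx: "\<theta> * x = 1" using \<theta> by (simp add: x_def)
    define A B where "A = {- (3 * x)<..- (2 * x)}" and "B = {-c..c}"
    have "norm (chf s h \<theta>) \<le> mgf s h - \<gamma> / 8 * min (prob A) (prob B)"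
      unfolding chf_def mgf_def
    proof (rule fourier_gap)
      show "integrable D (\<lambda>y. indicator {..h} y * exp (s * y))"
        by (rule integrable_truncated_exp[OF s(1)])
      fix a b assume ab: "a \<in> A" "b \<in> B"
      have "\<theta> * (b - a) \<le> \<theta> * (c + 3 * x)" "\<theta> * (2 * x - c) \<le> \<theta> * (b - a)"
        using ab \<theta> by (auto simp: A_def B_def intro!: mult_left_mono)
      moreover have "\<theta> * c \<le> 1 / 2" using mult_left_mono[OF x(2), of \<theta>] \<theta> tx by simp
      moreover have "\<theta> * (c + 3 * x) = \<theta> * c + 3" "\<theta> * (2 * x - c) = 2 - \<theta> * c" using tx by (simp_all add: algebra_simps)
      ultimately have "3 / 2 \<le> \<theta> * (b - a)" "\<theta> * (b - a) \<le> 7 / 2" by linarith+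
      then have "cos (\<theta> * (b - a)) \<le> 1 / 2" using pi_gt3 pi_less_4 by (intro cos_le_half) auto
      then have "cos (\<theta> * a - \<theta> * b) \<le> 1 / 2" using cos_minus[of "\<theta> * (b - a)"] by (simp add: algebra_simps)
      then show "1 / 2 \<le> 1 - cos (\<theta> * a - \<theta> * b)" by simp
    next
      fix y assume y: "y \<in> A \<union> B"
      have cx: "c \<le> 3 * x" using x c by linarith
      have "y \<ge> - (3 * x)" "y \<le> c" using y cx x X c by (auto simp: A_def B_def)
      moreover have "s * - (3 * x) \<le> s * y" using s calculation by (intro mult_left_mono) auto
      moreover have "s * (3 * x) \<le> \<theta> * (3 * x)" using s x X by (intro mult_right_mono) auto
      ultimately show "\<gamma> \<le> indicator {..h} y * exp (s * y)"
        using h tx by (auto simp: \<gamma>_def)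
    qed (use \<gamma> in \<open>auto simp: A_def B_def\<close>)
    moreover have "min d' (d' * G (1 / \<theta>)) \<le> \<gamma> / 8 * min (prob A) (prob B)"
    proof -
      have "min d' (d' * G x) \<le> \<gamma> / 8 * prob A"
      proof -
        have "d' * G x \<le> \<gamma> / 8 * (d * G x)"
          unfolding d'_def mult.assoc using \<gamma> G_bounds by (intro mult_left_mono mult_right_mono) auto
        also have "\<dots> \<le> \<gamma> / 8 * prob A" using dX[OF x(1)] \<gamma> by (intro mult_left_mono) (auto simp: A_def)
        finally show ?thesis by simp
      qed
      moreover have "min d' (d' * G x) \<le> \<gamma> / 8 * prob B"
      proof -
        have "d' \<le> \<gamma> / 8 * prob B" unfolding d'_def B_def using \<gamma> c by (intro mult_left_mono) auto
        then show ?thesis by simp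
      qed
      ultimately show ?thesis using \<gamma> by (simp add: x_def min_def split: if_splits)
    qed
    ultimately show ?thesis by linarith
  qed
  moreover have "\<theta>0 > 0" using X c by (simp add: \<theta>0_def)
  ultimately show ?thesis using d' c
    by (rule_tac exI[of _ \<theta>0], intro conjI, simp, rule_tac exI[of _ d'], intro conjI, simp, rule_tac exI[of _ c]) auto
qed

text \<open>Frequencies bounded away from zero: two translates of the interval \<open>(0, T]\<close> on the right,
  both of which are charged.\<close>

lemma chf_gap_large:
  assumes "T < \<infinity>" "0 < \<theta>0"
  shows "\<exists>d>0. \<exists>h0\<ge>0. \<forall>s h \<theta>. 0 \<le> s \<longrightarrow> \<theta>0 \<le> \<theta> \<longrightarrow> \<theta> * real_of_ereal T \<le> 1 / 2 \<longrightarrow> h0 \<le> h \<longrightarrow>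
    norm (chf s h \<theta>) \<le> mgf s h - d"
proof -
  define r where "r = real_of_ereal T"
  have r: "r > 0" using T_pos assms by (cases T) (auto simp: r_def)
  have fr: "f x = prob {x<..x + r}" for x
    using T_pos assms by (simp add: f_def Delta_cases r_def)
  obtain X where X: "X > 0" "\<And>x. x \<ge> X \<Longrightarrow> 0 < f x" using f_pos by auto
  \<comment> \<open>The translate used for \<theta> has index at most pi / (\<theta> * r), so this N
    serves every \<theta> from \<theta>0 on, and the minimum of finitely many positive masses is
    positive.\<close>
  define N where "N = nat \<lceil>pi / (\<theta>0 * r)\<rceil>"
  define m where "m = Min ((\<lambda>k. f (X + real k * r)) ` {..N})"
  have m: "m > 0" unfolding m_def using X r by (subst Min_gr_iff) auto
  have mk: "m \<le> f (X + real k * r)" if "k \<le> N" for k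
    unfolding m_def using that by (intro Min_le) auto
  have "norm (chf s h \<theta>) \<le> mgf s h - m / 8"
    if s: "0 \<le> s" and \<theta>: "\<theta>0 \<le> \<theta>" "\<theta> * r \<le> 1 / 2" and h: "X + (real N + 1) * r \<le> h" for s h \<theta>
  proof -
    have \<theta>r: "0 < \<theta> * r" using \<theta> assms r by simp
    \<comment> \<open>Moving by k intervals turns the phase by nearly pi. Rounding k and the
      positions inside the two intervals each contribute an error of at most \<theta> * r \<le>
      1/2.\<close>
    define k where "k = nat \<lfloor>pi / (\<theta> * r)\<rfloor>"
    have "0 \<le> pi / (\<theta> * r)" using \<theta>r by simp
    then have k1: "real k \<le> pi / (\<theta> * r)" "pi / (\<theta> * r) \<le> real k + 1" unfolding k_def by linarith+
    then have k: "real k * (\<theta> * r) \<le> pi" "pi \<le> (real k + 1) * (\<theta> * r)"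
      using \<theta>r by (simp_all add: field_simps)
    have "pi / (\<theta> * r) \<le> pi / (\<theta>0 * r)" using \<theta> r assms by (intro divide_left_mono mult_right_mono) auto
    moreover have "pi / (\<theta>0 * r) \<le> real N" unfolding N_def by (rule real_nat_ceiling_ge)
    ultimately have "real k \<le> real N" using k1(1) by (metis order_trans)
    then have kN: "k \<le> N" by simp
    define A B where "A = {X<..X + r}" and "B = {X + real k * r<..X + real k * r + r}"
    have "norm (chf s h \<theta>) \<le> mgf s h - 1 / 8 * min (prob A) (prob B)"
      unfolding chf_def mgf_def
    proof (rule fourier_gap)
      show "integrable D (\<lambda>y. indicator {..h} y * exp (s * y))"
        by (rule integrable_truncated_exp[OF s])
      fix a b assume ab: "a \<in> A" "b \<in> B"
      have t0: "0 < \<theta>" using \<theta> assms by simp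
      have "\<theta> * (real k * r - r) \<le> \<theta> * (b - a)" "\<theta> * (b - a) \<le> \<theta> * (real k * r + r)"
        using ab t0 by (auto simp: A_def B_def intro!: mult_left_mono)
      then have w: "real k * (\<theta> * r) - \<theta> * r \<le> \<theta> * (b - a)" "\<theta> * (b - a) \<le> real k * (\<theta> * r) + \<theta> * r"
        by (simp_all add: algebra_simps)
      have "pi - \<theta> * r \<le> real k * (\<theta> * r)" using k(2) by (simp add: algebra_simps)
      moreover have "P - 1 \<le> v \<and> v \<le> P + 1 / 2"
        if "q - y \<le> v" "v \<le> q + y" "P - y \<le> q" "q \<le> P" "y \<le> 1 / 2" for q y v P :: real
        using that by argo
      ultimately have "pi - 1 \<le> \<theta> * (b - a)" "\<theta> * (b - a) \<le> pi + 1 / 2" using w k(1) \<theta>(2) by blast+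
      then have "cos (\<theta> * (b - a)) \<le> 1 / 2" using pi_gt3 by (intro cos_le_half) auto
      then have "cos (\<theta> * a - \<theta> * b) \<le> 1 / 2" using cos_minus[of "\<theta> * (b - a)"] by (simp add: algebra_simps)
      then show "1 / 2 \<le> 1 - cos (\<theta> * a - \<theta> * b)" by simp
    next
      fix y assume y: "y \<in> A \<union> B"
      have "real k * r \<le> real N * r" "0 \<le> real N * r" "0 \<le> real k * r" using kN r by (auto intro!: mult_right_mono)
      moreover have "X + real N * r + r \<le> h" using h by (simp add: algebra_simps)
      moreover have "(X < y \<and> y \<le> X + r) \<or> (X + real k * r < y \<and> y \<le> X + real k * r + r)"
        using y by (auto simp: A_def B_def)
      ultimately have "y > X" "y \<le> h" by linarith+
      then show "1 \<le> indicator {..h} y * exp (s * y)" using s X by simp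
    qed (auto simp: A_def B_def)
    moreover have "m \<le> prob A" "m \<le> prob B"
      using mk[of 0] mk[OF kN] by (simp_all add: A_def B_def fr add.assoc)
    ultimately show ?thesis by linarith
  qed
  then show ?thesis using m X r
    by (rule_tac exI[of _ "m / 8"], intro conjI, simp, rule_tac exI[of _ "X + (real N + 1) * r"]) (auto simp: r_def)
qed

text \<open>Up to \<theta>0 the lower bound for the gap grows with \<theta>, since G (1 / \<theta>)
  \<ge> G (1 / \<theta>1). Beyond \<theta>0 it is constant, and G \<le> 1 brings it into the same
  form.\<close>

lemma chf_gap:
  assumes "T < \<infinity>"
  shows "\<exists>d>0. d \<le> 1 \<and> (\<exists>h0\<ge>0. \<forall>s h \<theta>1 \<theta>. 0 \<le> s \<longrightarrow> s \<le> \<theta>1 \<longrightarrow> 0 < \<theta>1 \<longrightarrow> \<theta>1 \<le> \<theta> \<longrightarrow> \<theta> * real_of_ereal T \<le> 1 / 2 \<longrightarrow> h0 \<le> h \<longrightarrow>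
    norm (chf s h \<theta>) \<le> mgf s h - d * G (1 / \<theta>1))"
proof -
  obtain \<theta>0 d1 h1 where 1: "\<theta>0 > 0" "d1 > 0" "h1 \<ge> 0"
    and g1: "\<And>s h \<theta>. 0 \<le> s \<Longrightarrow> s \<le> \<theta> \<Longrightarrow> \<theta> \<le> \<theta>0 \<Longrightarrow> h1 \<le> h \<Longrightarrow> 0 < \<theta> \<Longrightarrow>
      norm (chf s h \<theta>) \<le> mgf s h - min d1 (d1 * G (1 / \<theta>))"
    using chf_gap_small by blast
  obtain d2 h2 where 2: "d2 > 0" "h2 \<ge> 0"
    and g2: "\<And>s h \<theta>. 0 \<le> s \<Longrightarrow> \<theta>0 \<le> \<theta> \<Longrightarrow> \<theta> * real_of_ereal T \<le> 1 / 2 \<Longrightarrow> h2 \<le> h \<Longrightarrow>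
      norm (chf s h \<theta>) \<le> mgf s h - d2"
    using chf_gap_large[OF assms 1(1)] by blast
  define d where "d = min 1 (min d1 d2)"
  have d: "d > 0" "d \<le> 1" "d \<le> d1" "d \<le> d2" using 1 2 by (auto simp: d_def)
  have "norm (chf s h \<theta>) \<le> mgf s h - d * G (1 / \<theta>1)"
    if "0 \<le> s" "s \<le> \<theta>1" "0 < \<theta>1" "\<theta>1 \<le> \<theta>" "\<theta> * real_of_ereal T \<le> 1 / 2" "max h1 h2 \<le> h" for s h \<theta>1 \<theta>
  proof (cases "\<theta> \<le> \<theta>0")
    case True
    have "G (1 / \<theta>1) \<le> G (1 / \<theta>)" using that by (intro G_antimono divide_left_mono) auto
    then have "d * G (1 / \<theta>1) \<le> d1 * G (1 / \<theta>)" using d G_bounds by (intro mult_mono) auto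
    moreover have "d1 * G (1 / \<theta>) \<le> d1 * 1" using 1 G_bounds by (intro mult_left_mono) auto
    ultimately have "d * G (1 / \<theta>1) \<le> min d1 (d1 * G (1 / \<theta>))" by simp
    then show ?thesis using g1[of s \<theta> h] True that by auto
  next
    case False
    have "d * G (1 / \<theta>1) \<le> d2 * 1" using d G_bounds by (intro mult_mono) auto
    then show ?thesis using g2[of s \<theta> h] False that by auto
  qed
  then show ?thesis using d 1 2
    by (rule_tac exI[of _ d], intro conjI, simp, simp, rule_tac exI[of _ "max h1 h2"]) auto
qed

end

section \<open>One big jump\<close>

locale heavy_walk = heavy_left_tail_local D \<alpha> \<beta> b T + W: iid_walk M X D
  for D :: "real measure" and \<alpha> \<beta> :: real and b :: "nat \<Rightarrow> real" and T :: ereal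
    and M :: "'a measure" and X :: "nat \<Rightarrow> 'a \<Rightarrow> real" +
  fixes t :: real
  assumes t_gt_1: "1 < t"
begin

definition "small n h x = W.prob {\<omega>\<in>space M. (\<Sum>i=1..n. X i \<omega>) \<in> shifted_Delta x T \<and> (\<forall>i\<in>{1..n}. X i \<omega> \<le> h)}"

text \<open>What positive values up to h add to the truncated Laplace transform. With the cut h =
  \<delta> * x, \<delta> is later taken so small that n times this is at most 1.\<close>

definition "rem s h = exp (s * h) * s powr p * MP"

lemma rem_nonneg: "0 \<le> rem s h"
  using MP_nonneg by (simp add: rem_def)

lemma mgf_le: "0 \<le> s \<Longrightarrow> 0 \<le> h \<Longrightarrow> mgf s h \<le> 1 + (Lam s + rem s h)"
  using truncated_mgf_le[of s h] by (simp add: mgf_def rem_def)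

lemma mgf_nonneg: "0 \<le> mgf s h"
  unfolding mgf_def by (intro integral_nonneg_AE) auto

lemma power_le_exp:
  fixes x u :: real assumes "0 \<le> x" "x \<le> 1 + u" shows "x ^ n \<le> exp (real n * u)"
proof -
  have "x ^ n \<le> exp u ^ n"
    using assms exp_ge_add_one_self[of u] by (intro power_mono) linarith+
  then show ?thesis by (simp add: exp_of_nat_mult)
qed

lemma small_le_exp:
  assumes "0 \<le> s" "0 \<le> h"
  shows "small n h x \<le> exp (- s * x) * exp (real n * (Lam s + rem s h))"
proof -
  have "small n h x \<le> exp (- s * x) * mgf s h ^ n"
    unfolding small_def mgf_def by (rule W.prob_truncated_le_exp[OF assms(1)])
  also have "\<dots> \<le> exp (- s * x) * exp (real n * (Lam s + rem s h))"
    using mgf_le[OF assms] mgf_nonneg by (intro mult_left_mono power_le_exp) auto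
  finally show ?thesis .
qed

text \<open>\<open>Loc\<close> isolates the local gain, so that one computation of exponents covers
  both kinds of \<Delta>. For a bounded interval the cut-off frequency \<open>\<theta>1 n\<close>
  sits slightly above 1 / b: low frequencies contribute a factor close to 1 / b, and above the
  cut-off n times the gap has positive order \<alpha> * e, so that its negative exponential beats
  every power of n.\<close>

lemma small_le_tilt:
  assumes e: "0 < e" "e < 1 / \<alpha>"
  shows "\<exists>Loc. has_order Loc (- \<tau> * (1 / \<alpha> - e)) \<and> (\<exists>h0\<ge>0. \<forall>\<^sub>F n in sequentially. \<forall>x h. h0 \<le> h \<longrightarrow>
    real n * rem (tilt n) h \<le> 1 \<longrightarrow> small n h x \<le> exp (- tilt n * x) * exp (real n * Lam (tilt n) + 1) * Loc n)"
proof (cases "T = \<infinity>")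
  case True
  have "\<forall>\<^sub>F n in sequentially. \<forall>x h. 0 \<le> h \<longrightarrow>
    real n * rem (tilt n) h \<le> 1 \<longrightarrow> small n h x \<le> exp (- tilt n * x) * exp (real n * Lam (tilt n) + 1) * 1"
    using tilt_pos
  proof eventually_elim
    case (elim n)
    show ?case
    proof (intro allI impI)
      fix x h :: real assume h: "0 \<le> h" "real n * rem (tilt n) h \<le> 1"
      have "small n h x \<le> exp (- tilt n * x) * exp (real n * (Lam (tilt n) + rem (tilt n) h))"
        using elim h by (intro small_le_exp) auto
      also have "\<dots> \<le> exp (- tilt n * x) * exp (real n * Lam (tilt n) + 1)"
        using h by (simp add: distrib_left)
      finally show "small n h x \<le> exp (- tilt n * x) * exp (real n * Lam (tilt n) + 1) * 1" by simp
    qed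
  qed
  moreover have "has_order (\<lambda>n. 1) (- \<tau> * (1 / \<alpha> - e))"
    using has_order_const[of 1] True unfolding \<tau>_def by simp
  ultimately show ?thesis by (rule_tac exI[of _ "\<lambda>n. 1"], intro conjI, simp, rule_tac exI[of _ 0]) auto
next
  case False
  then have T: "T < \<infinity>" by (simp add: less_top)
  have \<tau>1: "\<tau> = 1" unfolding \<tau>_def using False by simp
  obtain d h0 where d: "d > 0" "d \<le> 1" "h0 \<ge> 0"
    and gap: "\<And>s h \<theta>1 \<theta>. 0 \<le> s \<Longrightarrow> s \<le> \<theta>1 \<Longrightarrow> 0 < \<theta>1 \<Longrightarrow> \<theta>1 \<le> \<theta> \<Longrightarrow> \<theta> * real_of_ereal T \<le> 1 / 2 \<Longrightarrow> h0 \<le> h \<Longrightarrow>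
      norm (chf s h \<theta>) \<le> mgf s h - d * G (1 / \<theta>1)"
    using chf_gap[OF T] by blast
  define r where "r = real_of_ereal T"
  have r: "r > 0" using T_pos T by (cases T) (auto simp: r_def)
  define L where "L = 1 / (2 * r)"
  have L: "L > 0" "L * r \<le> 1 / 2" using r by (auto simp: L_def)
  define \<theta>1 where "\<theta>1 n = real n powr e / b n" for n
  have \<theta>o: "has_order \<theta>1 (e - 1 / \<alpha>)"
    unfolding \<theta>1_def[abs_def] by (intro has_order_divide has_order_real_powr b_order)
  have it: "has_order (\<lambda>n. 1 / \<theta>1 n) (0 - (e - 1 / \<alpha>))"
    by (intro has_order_divide has_order_const \<theta>o) simp
  then have it_top: "filterlim (\<lambda>n. 1 / \<theta>1 n) at_top sequentially"
    by (rule has_order_at_top) (use e in simp)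
  \<comment> \<open>This is n times the gap above \<theta>1. Having positive order it exceeds (2 /
    \<alpha>) * ln n, and n powr (- (2 / \<alpha>)) falls below \<theta>1 / L because 2 / \<alpha> >
    1 / \<alpha> - e.\<close>
  define q where "q n = d * (real n * G (1 / \<theta>1 n))" for n
  have qo: "has_order q (0 + (1 + - \<alpha> * (0 - (e - 1 / \<alpha>))))"
    unfolding q_def[abs_def]
    by (intro has_order_mult has_order_const d has_order_real has_order_regularly_varying[OF G_rv it it_top])
  have "0 + (1 + - \<alpha> * (0 - (e - 1 / \<alpha>))) = \<alpha> * e" using alpha by (simp add: algebra_simps)
  with qo have qo: "has_order q (\<alpha> * e)" by simp
  have "\<forall>\<^sub>F n in sequentially. ln (real n) \<le> 1 / (2 / \<alpha>) * q n"
    by (rule has_order_le[OF has_order_ln qo]) (use alpha e in auto)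
  moreover have "\<forall>\<^sub>F n in sequentially. real n powr (- (2 / \<alpha>)) \<le> 1 / L * \<theta>1 n"
  proof (rule has_order_le[OF has_order_real_powr \<theta>o])
    have "0 < 1 / \<alpha>" using alpha by simp
    moreover have "2 / \<alpha> = 2 * (1 / \<alpha>)" by simp
    ultimately show "- (2 / \<alpha>) < e - 1 / \<alpha>" using e by linarith
  qed (use L in simp)
  moreover have "\<forall>\<^sub>F n in sequentially. tilt n \<le> 1 * \<theta>1 n"
    by (rule has_order_le[OF tilt_order \<theta>o]) (use e in auto)
  moreover have "\<forall>\<^sub>F n in sequentially. \<theta>1 n \<le> L * 1"
    by (rule has_order_le[OF \<theta>o has_order_const]) (use e L in auto)
  ultimately have "\<forall>\<^sub>F n in sequentially. \<forall>x h. h0 \<le> h \<longrightarrow>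
    real n * rem (tilt n) h \<le> 1 \<longrightarrow> small n h x \<le> exp (- tilt n * x) * exp (real n * Lam (tilt n) + 1) * (8 / L * \<theta>1 n)"
    using tilt_pos eventually_gt_at_top[of 0]
  proof eventually_elim
    case (elim n)
    show ?case
    proof (intro allI impI)
      fix x h assume h: "h0 \<le> h" "real n * rem (tilt n) h \<le> 1"
      define s where "s = tilt n"
      define u where "u = Lam s + rem s h"
      define A where "A = mgf s h"
      define B where "B = A - d * G (1 / \<theta>1 n)"
      have s: "0 < s" "s \<le> \<theta>1 n" using elim by (auto simp: s_def)
      have h1: "0 \<le> h" using h d by simp
      have \<theta>1: "0 < \<theta>1 n" using s by simp
      have Bb: "norm (chf s h \<theta>) \<le> B" if "\<theta>1 n \<le> \<theta>" "\<theta> \<le> L" for \<theta>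
      proof -
        have "\<theta> * r \<le> L * r" using that r by (intro mult_right_mono) auto
        then have "\<theta> * real_of_ereal T \<le> 1 / 2" using L(2) unfolding r_def by linarith
        then show ?thesis unfolding A_def B_def using s \<theta>1 that h by (intro gap) auto
      qed
      have "norm (chf s h (\<theta>1 n)) \<le> B" using elim by (intro Bb) auto
      then have B0: "0 \<le> B" by (rule order_trans[OF norm_ge_zero])
      have "small n h x \<le> exp (- s * x) * (4 / L * (\<theta>1 n * A ^ n + L * B ^ n))"
        unfolding small_def
      proof (rule W.prob_truncated_le_fourier)
        show "\<theta>1 n \<le> \<theta> \<Longrightarrow> \<theta> \<le> L \<Longrightarrow> cmod (LINT y|D. complex_of_real (indicator {..h} y * exp (s * y)) * cis (\<theta> * y)) \<le> B" for \<theta>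
          using Bb unfolding chf_def .
        show "cmod (LINT y|D. complex_of_real (indicator {..h} y * exp (s * y)) * cis (\<theta> * y)) \<le> A" for \<theta>
          using norm_chf_le_mgf[of s h \<theta>] s unfolding chf_def A_def by simp
      qed (use s T_pos T L B0 \<theta>1 in \<open>auto simp: r_def\<close>)
      also have "\<dots> \<le> exp (- s * x) * (4 / L * (\<theta>1 n * exp (real n * u) + L * (exp (real n * u) * (\<theta>1 n / L))))"
      proof (intro mult_left_mono add_mono)
        show "A ^ n \<le> exp (real n * u)"
          using mgf_le[of s h] mgf_nonneg s h1 by (intro power_le_exp) (auto simp: A_def u_def)
        have "B ^ n \<le> exp (real n * (u - d * G (1 / \<theta>1 n)))"
          using mgf_le[of s h] s h1 B0 by (intro power_le_exp) (auto simp: A_def B_def u_def)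
        also have "\<dots> = exp (real n * u) * exp (- q n)"
          by (simp add: q_def algebra_simps flip: exp_add)
        also have "exp (- q n) \<le> \<theta>1 n / L"
        proof -
          have "(2 / \<alpha>) * ln (real n) \<le> q n" using elim alpha by (simp add: field_simps)
          then have "exp (- q n) \<le> exp (- ((2 / \<alpha>) * ln (real n)))" by simp
          also have "\<dots> = real n powr (- (2 / \<alpha>))" using elim by (simp add: powr_def)
          finally show ?thesis using elim by simp
        qed
        finally show "B ^ n \<le> exp (real n * u) * (\<theta>1 n / L)" by simp
      qed (use \<theta>1 L in auto)
      also have "\<dots> = exp (- s * x) * exp (real n * u) * (8 / L * \<theta>1 n)" using L by (simp add: algebra_simps)
      also have "\<dots> \<le> exp (- s * x) * exp (real n * Lam s + 1) * (8 / L * \<theta>1 n)"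
        using h \<theta>1 L by (intro mult_right_mono mult_left_mono) (auto simp: u_def s_def distrib_left)
      finally show "small n h x \<le> exp (- tilt n * x) * exp (real n * Lam (tilt n) + 1) * (8 / L * \<theta>1 n)"
        by (simp add: s_def)
    qed
  qed
  moreover have "has_order (\<lambda>n. 8 / L * \<theta>1 n) (- \<tau> * (1 / \<alpha> - e))"
    using has_order_mult[OF has_order_const \<theta>o, of "8 / L"] L \<tau>1 by simp
  ultimately show ?thesis using d
    by (rule_tac exI[of _ "\<lambda>n. 8 / L * \<theta>1 n"], intro conjI, simp, rule_tac exI[of _ h0]) auto
qed

text \<open>The window up to V times the threshold is treated with the optimal tilt. Half of the
  surplus \<kappa> enters c as margin over c0 / \<alpha>; an eighth covers the loss e2 in the local
  factor and another the loss e3 in the lower bound of f, so at least a quarter is left. Uniformity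
  in x is monotonicity: exp (- tilt * x) is largest at the left end of the window, the power below f
  is smallest at the right end.\<close>

lemma small_moderate:
  assumes V: "1 \<le> V"
  shows "\<exists>\<delta>0>0. \<forall>\<delta>>0. \<delta> \<le> \<delta>0 \<longrightarrow> (\<forall>e>0. \<forall>\<^sub>F n in sequentially. \<forall>x. thr t n \<le> x \<and> x \<le> V * thr t n \<longrightarrow>
    small n (\<delta> * x) x \<le> e * (real n * f x))"
proof -
  have t0: "0 < t" using t_gt_1 by simp
  define \<kappa> where "\<kappa> = (t - 1) * c0"
  have \<kappa>: "\<kappa> > 0" using t_gt_1 c0_pos by (simp add: \<kappa>_def)
  define e2 where "e2 = min (\<kappa> / 8) (1 / (2 * \<alpha>))"
  have e2: "0 < e2" "e2 < 1 / \<alpha>" "e2 \<le> \<kappa> / 8" using \<kappa> alpha by (auto simp: e2_def min_def field_simps)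
  define e3 where "e3 = \<kappa> / 8"
  have e3: "0 < e3" using \<kappa> by (simp add: e3_def)
  obtain Loc h0 where Loc: "has_order Loc (- \<tau> * (1 / \<alpha> - e2))" and h0: "h0 \<ge> 0"
    and loc: "\<forall>\<^sub>F n in sequentially. \<forall>x h. h0 \<le> h \<longrightarrow>
    real n * rem (tilt n) h \<le> 1 \<longrightarrow> small n h x \<le> exp (- tilt n * x) * exp (real n * Lam (tilt n) + 1) * Loc n"
    using small_le_tilt[OF e2(1,2)] by blast
  obtain X1 c1 where X1: "X1 > 0" "c1 > 0" and f1: "\<And>x. x \<ge> X1 \<Longrightarrow> c1 * x powr (- (\<beta> + \<tau> + e3)) \<le> f x"
    using f_lower[OF e3] by blast
  define a where "a = V * (t * c0)"
  have a: "a > 0" using V t0 c0_pos by (simp add: a_def)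
  \<comment> \<open>On the window exp (tilt * \<delta> * x) is at most n powr (\<delta> * a). Half
    of the margin p / \<alpha> - 1 > 0 pays for it, so n * \<open>rem\<close> still has negative
    order.\<close>
  define \<delta>0 where "\<delta>0 = (p / \<alpha> - 1) / (2 * a)"
  have p\<alpha>: "p / \<alpha> - 1 > 0" using p_bounds alpha by (simp add: field_simps)
  have \<delta>0: "\<delta>0 > 0" using a p\<alpha> by (simp add: \<delta>0_def)
  define c where "c = c0 / \<alpha> + \<kappa> / 2"
  have "\<forall>\<^sub>F n in sequentially. \<forall>x. thr t n \<le> x \<and> x \<le> V * thr t n \<longrightarrow> small n (\<delta> * x) x \<le> e * (real n * f x)"
    if \<delta>: "\<delta> > 0" "\<delta> \<le> \<delta>0" and e: "e > 0" for \<delta> e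
  proof -
    have da: "\<delta> * a \<le> (p / \<alpha> - 1) / 2" using \<delta> a mult_right_mono[of \<delta> \<delta>0 a] by (simp add: \<delta>0_def)
    have o1: "has_order (\<lambda>n. real n * (real n powr (\<delta> * a) * tilt n powr p)) (1 + (\<delta> * a + p * (- (1 / \<alpha>))))"
      by (intro has_order_mult has_order_real has_order_real_powr has_order_powr tilt_order)
    have E1: "\<forall>\<^sub>F n in sequentially. real n * (real n powr (\<delta> * a) * tilt n powr p) \<le> 1 / (MP + 1) * 1"
      by (rule has_order_le[OF o1 has_order_const]) (use da p\<alpha> MP_nonneg in auto)
    have o2: "has_order (\<lambda>n. real n powr (- (t * c0)) * (exp 1 * real n powr c) * Loc n) (- (t * c0) + (0 + c) + - \<tau> * (1 / \<alpha> - e2))"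
      by (intro has_order_mult has_order_real_powr has_order_const Loc) simp
    have o3: "has_order (\<lambda>n. real n * (V * thr t n) powr (- (\<beta> + \<tau> + e3))) (1 + (- (\<beta> + \<tau> + e3)) * (0 + 1 / \<alpha>))"
      using V t0 by (intro has_order_mult has_order_real has_order_powr has_order_const thr_order) auto
    have "- (t * c0) + (0 + c) + - \<tau> * (1 / \<alpha> - e2) < 1 + (- (\<beta> + \<tau> + e3)) * (0 + 1 / \<alpha>)"
    proof -
      have c0': "c0 * (\<alpha> - 1) = \<beta> - \<alpha>" using alpha by (simp add: c0_def)
      have "c0 / \<alpha> - c0 = - (c0 * (\<alpha> - 1)) / \<alpha>" using alpha by (simp add: field_simps)
      then have "c0 / \<alpha> - c0 = - (\<beta> - \<alpha>) / \<alpha>" by (simp only: c0')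
      also have "\<dots> = 1 - \<beta> / \<alpha>" using alpha by (simp add: field_simps)
      finally have 1: "c0 / \<alpha> - c0 = 1 - \<beta> / \<alpha>" .
      have 2: "\<tau> * e2 \<le> \<kappa> / 8" using e2 \<kappa> unfolding \<tau>_def by auto
      have 3: "e3 / \<alpha> \<le> \<kappa> / 8" using alpha \<kappa> by (simp add: e3_def field_simps)
      have 4: "- (t * c0) = - \<kappa> - c0" by (simp add: \<kappa>_def algebra_simps)
      have "- (t * c0) + (0 + c) + - \<tau> * (1 / \<alpha> - e2) = (c0 / \<alpha> - c0) - \<kappa> / 2 - \<tau> / \<alpha> + \<tau> * e2"
        unfolding 4 c_def by (simp add: algebra_simps)
      also have "\<dots> < 1 - \<beta> / \<alpha> - \<tau> / \<alpha> - e3 / \<alpha>" using 1 2 3 \<kappa> by linarith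
      also have "\<dots> = 1 + (- (\<beta> + \<tau> + e3)) * (0 + 1 / \<alpha>)" by (simp add: add_divide_distrib diff_divide_distrib)
      finally show ?thesis .
    qed
    then have E2: "\<forall>\<^sub>F n in sequentially. real n powr (- (t * c0)) * (exp 1 * real n powr c) * Loc n
      \<le> (e * c1) * (real n * (V * thr t n) powr (- (\<beta> + \<tau> + e3)))"
      by (rule has_order_le[OF o2 o3]) (use e X1 in simp)
    have E3: "\<forall>\<^sub>F n in sequentially. real n * Lam (tilt n) \<le> c * ln (real n)"
      by (rule n_Lam_tilt_le) (use \<kappa> in \<open>simp add: c_def\<close>)
    have E4: "\<forall>\<^sub>F n in sequentially. max X1 (h0 / \<delta>) \<le> thr t n"
      using thr_at_top[OF t0] by (simp only: filterlim_at_top)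
    show ?thesis
      using loc E1 E2 E3 E4 tilt_thr[of t] tilt_pos has_order_pos[OF Loc] eventually_gt_at_top[of 0]
    proof eventually_elim
      case (elim n)
      show ?case
      proof (intro allI impI)
        fix x assume x: "thr t n \<le> x \<and> x \<le> V * thr t n"
        have n0: "real n > 0" using elim by simp
        have h: "h0 \<le> \<delta> * x"
        proof -
          have "h0 / \<delta> \<le> x" using x elim by linarith
          then show ?thesis using \<delta> by (simp add: field_simps)
        qed
        have "tilt n * (\<delta> * x) \<le> tilt n * (\<delta> * (V * thr t n))" using x elim \<delta> by (intro mult_left_mono) auto
        also have "\<dots> = \<delta> * V * (tilt n * thr t n)" by (simp add: mult_ac)
        also have "\<dots> = \<delta> * a * ln (real n)" using elim by (simp add: a_def mult_ac)
        finally have "exp (tilt n * (\<delta> * x)) \<le> exp (\<delta> * a * ln (real n))" by simp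
        also have "\<dots> = real n powr (\<delta> * a)" using n0 by (simp add: powr_def)
        finally have "rem (tilt n) (\<delta> * x) \<le> real n powr (\<delta> * a) * tilt n powr p * MP"
          unfolding rem_def using MP_nonneg by (intro mult_right_mono) auto
        then have "real n * rem (tilt n) (\<delta> * x) \<le> real n * (real n powr (\<delta> * a) * tilt n powr p) * MP"
          using n0 by (simp add: mult.assoc)
        also have "\<dots> \<le> 1 / (MP + 1) * MP" using elim MP_nonneg by (intro mult_right_mono) auto
        also have "\<dots> \<le> 1" using MP_nonneg by simp
        finally have rm: "real n * rem (tilt n) (\<delta> * x) \<le> 1" .
        have "small n (\<delta> * x) x \<le> exp (- tilt n * x) * exp (real n * Lam (tilt n) + 1) * Loc n"
          using elim h rm by blast
        also have "\<dots> \<le> real n powr (- (t * c0)) * (exp 1 * real n powr c) * Loc n"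
        proof (intro mult_right_mono mult_mono)
          have "tilt n * thr t n \<le> tilt n * x" using x elim by (intro mult_left_mono) auto
          then have "exp (- tilt n * x) \<le> exp (- (tilt n * thr t n))" by simp
          also have "\<dots> = real n powr (- (t * c0))" using elim n0 by (simp add: powr_def)
          finally show "exp (- tilt n * x) \<le> real n powr (- (t * c0))" .
          have "exp (real n * Lam (tilt n) + 1) \<le> exp (c * ln (real n) + 1)" using elim by simp
          also have "\<dots> = exp 1 * real n powr c" using n0 by (simp add: powr_def exp_add)
          finally show "exp (real n * Lam (tilt n) + 1) \<le> exp 1 * real n powr c" .
        qed (use elim in auto)
        also have "\<dots> \<le> (e * c1) * (real n * (V * thr t n) powr (- (\<beta> + \<tau> + e3)))" using elim by simp
        also have "\<dots> \<le> (e * c1) * (real n * x powr (- (\<beta> + \<tau> + e3)))"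
        proof (intro mult_left_mono powr_mono2')
          have "0 \<le> \<tau>" unfolding \<tau>_def by simp
          then show "- (\<beta> + \<tau> + e3) \<le> 0" using alpha alpha_beta e3 by linarith
          show "0 < x" using x elim X1 by linarith
        qed (use x e X1 in auto)
        also have "\<dots> = e * (real n * (c1 * x powr (- (\<beta> + \<tau> + e3))))" by simp
        also have "\<dots> \<le> e * (real n * f x)"
        proof (intro mult_left_mono f1)
          show "X1 \<le> x" using x elim by linarith
        qed (use e in auto)
        finally show "small n (\<delta> * x) x \<le> e * (real n * f x)" .
      qed
    qed
  qed
  then show ?thesis using \<delta>0 by (intro exI[of _ \<delta>0]) auto
qed

text \<open>Beyond V times the threshold the tilt has to decrease with x because the cut \<delta> *
  x grows. For s = A * ln x / x the factors exp (- s * x) and exp (s * \<delta> * x) are plain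
  powers of x, and V is so large that s stays below \<open>tilt n\<close>, which carries the bound
  on n * \<open>Lam\<close> over. As A may be large, the plain exponential bound suffices even for
  bounded intervals.\<close>

lemma small_large:
  "\<exists>V\<ge>1. \<exists>\<delta>0>0. \<forall>\<delta>>0. \<delta> \<le> \<delta>0 \<longrightarrow> (\<forall>e>0. \<forall>\<^sub>F n in sequentially. \<forall>x. V * thr t n \<le> x \<longrightarrow>
    small n (\<delta> * x) x \<le> e * (real n * f x))"
proof -
  have t0: "0 < t" using t_gt_1 by simp
  have \<tau>0: "0 \<le> \<tau>" unfolding \<tau>_def by simp
  define c where "c = 2 * c0 / \<alpha>"
  have c: "c0 / \<alpha> < c" "0 < c" using c0_pos alpha by (auto simp: c_def divide_strict_right_mono)
  \<comment> \<open>The lower bound of f has exponent \<beta> + \<tau> + 1, one further power makes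
    the ratio small, and 2 * \<alpha> * c absorbs n * \<open>Lam s\<close>, which is at most c * ln
    n \<le> 2 * \<alpha> * c * ln x.\<close>
  define A where "A = \<beta> + \<tau> + 2 + 2 * \<alpha> * c"
  have A: "A > 0" using alpha alpha_beta c \<tau>0 by (simp add: A_def add_pos_nonneg)
  define V where "V = max 1 (2 * A / (t * c0))"
  have V: "V \<ge> 1" "2 * A \<le> V * (t * c0)" using t0 c0_pos by (auto simp: V_def max_def field_simps)
  \<comment> \<open>One third each for n \<le> x powr (\<alpha> + g), for exp (s * \<delta> * x) and
    for the power of ln x; together with - p the exponents add up to 0.\<close>
  define g where "g = (p - \<alpha>) / 3"
  have g: "g > 0" using p_bounds by (simp add: g_def)
  define \<delta>0 where "\<delta>0 = g / A"
  have \<delta>0: "\<delta>0 > 0" using g A by (simp add: \<delta>0_def)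
  obtain X1 c1 where X1: "X1 > 0" "c1 > 0" and f1: "\<And>x. x \<ge> X1 \<Longrightarrow> c1 * x powr (- (\<beta> + \<tau> + 1)) \<le> f x"
    using f_lower[OF zero_less_one] by blast
  have "((\<lambda>x. (A * ln x) powr p * MP / x powr g) \<longlongrightarrow> 0) at_top"
    using g A p_bounds by real_asymp
  then have "\<forall>\<^sub>F x in at_top. (A * ln x) powr p * MP / x powr g < 1" by (rule order_tendstoD) simp
  then obtain X2 where X2: "\<And>x. x \<ge> X2 \<Longrightarrow> (A * ln x) powr p * MP / x powr g < 1"
    by (auto simp: eventually_at_top_linorder)
  have "\<forall>\<^sub>F n in sequentially. \<forall>x. V * thr t n \<le> x \<longrightarrow> small n (\<delta> * x) x \<le> e * (real n * f x)"
    if \<delta>: "\<delta> > 0" "\<delta> \<le> \<delta>0" and e: "e > 0" for \<delta> e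
  proof -
    have E1: "\<forall>\<^sub>F n in sequentially. real n \<le> 1 * (V * thr t n) powr (2 * \<alpha>)"
      by (rule has_order_le[OF has_order_real has_order_powr[OF has_order_mult[OF has_order_const thr_order[OF t0]]]])
        (use V alpha in auto)
    have E2: "\<forall>\<^sub>F n in sequentially. real n \<le> 1 * (V * thr t n) powr (\<alpha> + g)"
      by (rule has_order_le[OF has_order_real has_order_powr[OF has_order_mult[OF has_order_const thr_order[OF t0]]]])
        (use V alpha g in \<open>auto simp: field_simps\<close>)
    have E3: "\<forall>\<^sub>F n in sequentially. V * thr t n < real n powr 2"
      by (rule has_order_less[OF has_order_mult[OF has_order_const thr_order[OF t0]] has_order_real_powr])
        (use V alpha in \<open>auto simp: field_simps\<close>)
    have E4: "\<forall>\<^sub>F n in sequentially. real n * Lam (tilt n) \<le> c * ln (real n)"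
      by (rule n_Lam_tilt_le[OF c(1)])
    have E5: "\<forall>\<^sub>F n in sequentially. max (max X1 (exp 1)) (max X2 (exp 1 / (c1 * e))) \<le> thr t n"
      using thr_at_top[OF t0] by (simp only: filterlim_at_top)
    show ?thesis
      using E1 E2 E3 E4 E5 tilt_thr[of t] tilt_pos eventually_gt_at_top[of 0]
    proof eventually_elim
      case (elim n)
      show ?case
      proof (intro allI impI)
        fix x assume x: "V * thr t n \<le> x"
        have n0: "real n > 0" using elim by simp
        have th: "thr t n > 0" using elim X1 by linarith
        have Vt: "thr t n \<le> V * thr t n" using V th by simp
        have xs: "X1 \<le> x" "exp 1 \<le> x" "X2 \<le> x" "exp 1 / (c1 * e) \<le> x" using elim Vt x by linarith+
        have x0: "x > 0" using xs X1 by linarith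
        have x1: "x \<ge> 1" using xs(2) exp_ge_add_one_self[of 1] by linarith
        have lx: "ln x > 0" using xs(2) x0 by (metis exp_gt_one less_le_trans ln_gt_zero zero_less_one)
        define s where "s = A * (ln x / x)"
        have s0: "s > 0" using A lx x0 by (simp add: s_def)
        have st: "s \<le> tilt n"
        proof -
          \<comment> \<open>From exp 1 on ln x / x decreases, so the comparison with the fixed tilt
            is needed only at V times the threshold.\<close>
          have "exp 1 \<le> V * thr t n" using elim Vt by linarith
          then have "ln x / x \<le> ln (V * thr t n) / (V * thr t n)" using x by (rule ln_x_over_x_mono)
          also have "\<dots> \<le> 2 * ln (real n) / (V * thr t n)"
          proof (intro divide_right_mono)
            have "ln (V * thr t n) \<le> ln (real n powr 2)" using elim V th by (intro ln_mono) auto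
            then show "ln (V * thr t n) \<le> 2 * ln (real n)" using n0 by (simp add: ln_realpow)
          qed (use V th in auto)
          finally have "s \<le> A * (2 * ln (real n) / (V * thr t n))" unfolding s_def using A by (intro mult_left_mono) auto
          also have "\<dots> = (2 * A) * ln (real n) / (V * thr t n)" by simp
          also have "\<dots> \<le> (V * (t * c0)) * ln (real n) / (V * thr t n)"
            using V th elim by (intro divide_right_mono mult_right_mono) auto
          also have "\<dots> = V * (tilt n * thr t n) / (V * thr t n)" using elim by simp
          also have "\<dots> = tilt n" using V th by simp
          finally show ?thesis .
        qed
        have "real n * Lam s \<le> real n * Lam (tilt n)" using s0 st by (intro mult_left_mono Lam_mono) auto
        also have "\<dots> \<le> c * ln (real n)" using elim by simp
        also have "\<dots> \<le> c * (2 * \<alpha> * ln x)"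
        proof (intro mult_left_mono)
          have "(V * thr t n) powr (2 * \<alpha>) \<le> x powr (2 * \<alpha>)" using x V th alpha by (intro powr_mono2) auto
          then have "real n \<le> x powr (2 * \<alpha>)" using elim by linarith
          then have "ln (real n) \<le> ln (x powr (2 * \<alpha>))" using n0 by (intro ln_mono) auto
          then show "ln (real n) \<le> 2 * \<alpha> * ln x" using x0 by (simp add: ln_powr)
        qed (use c in simp)
        finally have L1: "real n * Lam s \<le> 2 * \<alpha> * c * ln x" by (simp add: mult_ac)
        have "rem s (\<delta> * x) \<le> x powr g * ((A * ln x) powr p * x powr (- p)) * MP"
          unfolding rem_def
        proof (intro mult_right_mono mult_mono)
          have "s * (\<delta> * x) = A * \<delta> * ln x" using x0 by (simp add: s_def)
          also have "\<dots> \<le> g * ln x" using \<delta> A lx by (intro mult_right_mono) (auto simp: \<delta>0_def field_simps)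
          finally show "exp (s * (\<delta> * x)) \<le> x powr g" using x0 by (simp add: powr_def)
          show "s powr p \<le> (A * ln x) powr p * x powr (- p)"
            using A lx x0 by (simp add: s_def powr_mult powr_divide powr_minus field_simps)
        qed (use MP_nonneg in auto)
        also have "\<dots> = x powr g * x powr (- p) * ((A * ln x) powr p * MP)" by (simp add: mult_ac)
        also have "\<dots> \<le> x powr g * x powr (- p) * x powr g"
          using X2[OF xs(3)] x0 by (intro mult_left_mono) (auto simp: field_simps)
        finally have "rem s (\<delta> * x) \<le> x powr (g - p + g)" by (simp flip: powr_add)
        moreover have "real n \<le> x powr (\<alpha> + g)"
        proof -
          have "(V * thr t n) powr (\<alpha> + g) \<le> x powr (\<alpha> + g)" using x V th alpha g by (intro powr_mono2) auto
          then show ?thesis using elim by linarith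
        qed
        ultimately have "real n * rem s (\<delta> * x) \<le> x powr (\<alpha> + g) * x powr (g - p + g)"
          using rem_nonneg by (intro mult_mono) auto
        also have "\<dots> = x powr ((\<alpha> + g) + (g - p + g))" by (simp only: powr_add)
        also have "(\<alpha> + g) + (g - p + g) = 0" by (simp add: g_def field_simps)
        finally have L2: "real n * rem s (\<delta> * x) \<le> 1" using x0 by simp
        have "small n (\<delta> * x) x \<le> exp (- s * x) * exp (real n * (Lam s + rem s (\<delta> * x)))"
          using s0 \<delta> x0 by (intro small_le_exp) auto
        also have "\<dots> \<le> exp (- A * ln x) * exp (2 * \<alpha> * c * ln x + 1)"
          using L1 L2 x0 by (intro mult_mono) (auto simp: s_def distrib_left)
        also have "\<dots> = exp 1 * x powr (- (\<beta> + \<tau> + 2))"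
          using x0 by (simp add: A_def powr_def algebra_simps flip: exp_add)
        also have "\<dots> = exp 1 / x * x powr (- (\<beta> + \<tau> + 1))"
        proof -
          have "- (\<beta> + \<tau> + 2) = - 1 + - (\<beta> + \<tau> + 1)" by simp
          then have "x powr (- (\<beta> + \<tau> + 2)) = x powr (- 1) * x powr (- (\<beta> + \<tau> + 1))" by (simp only: powr_add)
          then show ?thesis using x0 by (simp add: powr_minus_divide)
        qed
        also have "\<dots> \<le> (e * c1) * x powr (- (\<beta> + \<tau> + 1))"
          using xs(4) e X1 x0 by (intro mult_right_mono) (auto simp: field_simps)
        also have "\<dots> = e * (1 * (c1 * x powr (- (\<beta> + \<tau> + 1))))" by simp
        also have "\<dots> \<le> e * (real n * f x)"
          using e elim X1 by (intro mult_left_mono mult_mono f1 xs) auto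
        finally show "small n (\<delta> * x) x \<le> e * (real n * f x)" .
      qed
    qed
  qed
  then show ?thesis using \<delta>0 V
    by (rule_tac exI[of _ V], intro conjI, simp, rule_tac exI[of _ \<delta>0]) auto
qed

text \<open>The far range fixes V first; only then can the window be treated, as its \<delta>
  depends on V. The cap 1/2 serves to separate the one-jump events.\<close>

lemma small_negligible:
  "\<exists>\<delta>>0. \<delta> \<le> 1/2 \<and> (\<forall>e>0. \<forall>\<^sub>F n in sequentially. \<forall>x. thr t n \<le> x \<longrightarrow> small n (\<delta> * x) x \<le> e * (real n * f x))"
proof -
  obtain V \<delta>1 where V: "V \<ge> 1" "\<delta>1 > 0"
    and 1: "\<And>\<delta> e. \<delta> > 0 \<Longrightarrow> \<delta> \<le> \<delta>1 \<Longrightarrow> e > 0 \<Longrightarrow> \<forall>\<^sub>F n in sequentially. \<forall>x. V * thr t n \<le> x \<longrightarrow> small n (\<delta> * x) x \<le> e * (real n * f x)"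
    using small_large by blast
  obtain \<delta>2 where \<delta>2: "\<delta>2 > 0"
    and 2: "\<And>\<delta> e. \<delta> > 0 \<Longrightarrow> \<delta> \<le> \<delta>2 \<Longrightarrow> e > 0 \<Longrightarrow> \<forall>\<^sub>F n in sequentially. \<forall>x. thr t n \<le> x \<and> x \<le> V * thr t n \<longrightarrow> small n (\<delta> * x) x \<le> e * (real n * f x)"
    using small_moderate[OF V(1)] by blast
  define \<delta> where "\<delta> = min (1/2) (min \<delta>1 \<delta>2)"
  have \<delta>: "\<delta> > 0" "\<delta> \<le> \<delta>1" "\<delta> \<le> \<delta>2" "\<delta> \<le> 1/2" using V \<delta>2 by (auto simp: \<delta>_def)
  have "\<forall>\<^sub>F n in sequentially. \<forall>x. thr t n \<le> x \<longrightarrow> small n (\<delta> * x) x \<le> e * (real n * f x)" if "e > 0" for e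
    using 1[OF \<delta>(1,2) that] 2[OF \<delta>(1,3) that]
    by eventually_elim (meson linear)
  then show ?thesis using \<delta> by (intro exI[of _ \<delta>]) auto
qed

text \<open>Both estimates come from n * \<open>psi x\<close> being uniformly small: the first by
  the truncated Chebyshev bound, the second because the integrand of \<open>psi\<close> is at least
  \<delta>^2 for y > \<delta> * x when \<delta> \<le> 1.\<close>

lemma others_small:
  assumes "0 < \<eta>" "0 < \<delta>" "\<delta> \<le> 1" "0 < e"
  shows "\<forall>\<^sub>F n in sequentially. \<forall>x. thr t n \<le> x \<longrightarrow> (\<forall>J. J \<subseteq> {1..n} \<longrightarrow>
    W.prob {\<omega>\<in>space M. \<bar>\<Sum>i\<in>J. X i \<omega>\<bar> > \<eta> * x} \<le> e) \<and> real n * prob {\<delta> * x<..} \<le> e"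
proof -
  have t0: "0 < t" using t_gt_1 by simp
  define C where "C = 4 / \<eta>\<^sup>2 + 4 / \<eta> + 1 / \<delta>\<^sup>2"
  have C: "C > 0" "4 / \<eta>\<^sup>2 + 4 / \<eta> \<le> C" "1 / \<delta>\<^sup>2 \<le> C" using assms by (auto simp: C_def add_pos_pos)
  have "\<forall>\<^sub>F n in sequentially. 1 \<le> thr t n" using thr_at_top[OF t0] by (simp only: filterlim_at_top)
  moreover have "\<forall>\<^sub>F n in sequentially. \<forall>x\<ge>thr t n. real n * psi x < e / C"
    using assms C by (intro n_psi_uniformly_small t0) simp
  ultimately show ?thesis
  proof eventually_elim
    case (elim n)
    show ?case
    proof (intro allI impI conjI)
      fix x assume x: "thr t n \<le> x"
      then have x0: "x > 0" using elim by simp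
      have psi0: "0 \<le> psi x" unfolding psi_def by (intro integral_nonneg_AE) auto
      have ps: "C * (real n * psi x) \<le> e" using elim x C by (simp add: field_simps less_imp_le)
      {
        fix J assume J: "J \<subseteq> {1..n}"
        then have fJ: "finite J" "J \<subseteq> {1..}" by (auto intro: finite_subset)
        have "card J \<le> n" using card_mono[OF _ J] by simp
        have "W.prob {\<omega>\<in>space M. \<bar>\<Sum>i\<in>J. X i \<omega>\<bar> > \<eta> * x} \<le> (4 / \<eta>\<^sup>2 + 4 / \<eta>) * real (card J) * psi x"
          unfolding psi_def by (rule W.prob_sum_gt_le[OF integrable_id mean_zero fJ assms(1) x0])
        also have "\<dots> \<le> C * real n * psi x"
          using C \<open>card J \<le> n\<close> assms psi0 by (intro mult_right_mono mult_mono) auto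
        finally show "W.prob {\<omega>\<in>space M. \<bar>\<Sum>i\<in>J. X i \<omega>\<bar> > \<eta> * x} \<le> e" using ps by (simp add: mult.assoc)
      }
      have "\<delta>\<^sup>2 * prob {\<delta> * x<..} = (LINT y|D. \<delta>\<^sup>2 * indicator {\<delta> * x<..} y)" by simp
      also have "\<dots> \<le> psi x"
        unfolding psi_def
      proof (intro integral_mono psi_integrable)
        show "integrable D (\<lambda>y. \<delta>\<^sup>2 * indicator {\<delta> * x<..} y)"
          by (intro integrable_mult_right integrable_real_indicator) (auto simp: less_top[symmetric])
        fix y
        show "\<delta>\<^sup>2 * indicator {\<delta> * x<..} y \<le> min ((y / x)\<^sup>2) \<bar>y / x\<bar>"
        proof (cases "\<delta> * x < y")
          case True
          then have yx: "\<delta> \<le> y / x" using x0 by (simp add: field_simps)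
          then have "\<delta>\<^sup>2 \<le> (y / x)\<^sup>2" using assms by (intro power_mono) auto
          moreover have "\<delta>\<^sup>2 \<le> \<delta> * 1" unfolding power2_eq_square using assms by (intro mult_left_mono) auto
          moreover have "\<delta> \<le> \<bar>y / x\<bar>" using yx by linarith
          ultimately have "\<delta>\<^sup>2 \<le> min ((y / x)\<^sup>2) \<bar>y / x\<bar>" by linarith
          then show ?thesis using True by simp
        qed simp
      qed
      finally have "prob {\<delta> * x<..} \<le> 1 / \<delta>\<^sup>2 * psi x" using assms by (simp add: field_simps)
      also have "\<dots> \<le> C * psi x" using C psi0 by (intro mult_right_mono) auto
      finally have "real n * prob {\<delta> * x<..} \<le> real n * (C * psi x)" by (intro mult_left_mono) auto
      with ps show "real n * prob {\<delta> * x<..} \<le> e" by (simp add: mult_ac)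
    qed
  qed
qed

section \<open>Decomposition by the big jump\<close>

definition "pS n x = W.prob {\<omega>\<in>space M. (\<Sum>i=1..n. X i \<omega>) \<in> shifted_Delta x T}"

lemma sum_split_off:
  assumes "i \<in> {1..n}"
  shows "(\<Sum>j=1..n. X j \<omega>) = X i \<omega> + (\<Sum>j\<in>{1..n} - {i}. X j \<omega>)"
  using assms by (intro sum.remove) auto

lemma measure_shifted: "prob {y. y + v \<in> shifted_Delta x T} = f (x - v)"
  unfolding f_def by (rule arg_cong[where f=prob]) (auto simp: mem_shifted_Delta algebra_simps)

lemma pair_set_measurable:
  "{(y, v). y + v \<in> shifted_Delta x T \<and> h < y} \<in> sets (borel \<Otimes>\<^sub>M borel)"
  "{(y, v). y + v \<in> shifted_Delta x T \<and> \<bar>v\<bar> \<le> h} \<in> sets (borel \<Otimes>\<^sub>M borel)"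
proof -
  have 1: "(\<lambda>z. fst z + snd z :: real) -` shifted_Delta x T \<inter> space (borel \<Otimes>\<^sub>M borel) \<in> sets (borel \<Otimes>\<^sub>M borel)"
    by (rule measurable_sets[OF _ shifted_Delta_borel]) measurable
  have 2: "(fst :: real \<times> real \<Rightarrow> real) -` {h<..} \<inter> space (borel \<Otimes>\<^sub>M borel) \<in> sets (borel \<Otimes>\<^sub>M borel)"
    by (rule measurable_sets[of _ _ borel]) auto
  have 3: "(snd :: real \<times> real \<Rightarrow> real) -` {-h..h} \<inter> space (borel \<Otimes>\<^sub>M borel) \<in> sets (borel \<Otimes>\<^sub>M borel)"
    by (rule measurable_sets[of _ _ borel]) auto
  have "{(y, v). y + v \<in> shifted_Delta x T \<and> h < y} = ((\<lambda>z. fst z + snd z :: real) -` shifted_Delta x T \<inter> space (borel \<Otimes>\<^sub>M borel)) \<inter> (fst -` {h<..} \<inter> space (borel \<Otimes>\<^sub>M borel))"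
    by (auto simp: space_pair_measure)
  then show "{(y, v). y + v \<in> shifted_Delta x T \<and> h < y} \<in> sets (borel \<Otimes>\<^sub>M borel)"
    using sets.Int[OF 1 2] by simp
  have "{(y, v). y + v \<in> shifted_Delta x T \<and> \<bar>v\<bar> \<le> h} = ((\<lambda>z. fst z + snd z :: real) -` shifted_Delta x T \<inter> space (borel \<Otimes>\<^sub>M borel)) \<inter> (snd -` {-h..h} \<inter> space (borel \<Otimes>\<^sub>M borel))"
    by (auto simp: space_pair_measure)
  then show "{(y, v). y + v \<in> shifted_Delta x T \<and> \<bar>v\<bar> \<le> h} \<in> sets (borel \<Otimes>\<^sub>M borel)"
    using sets.Int[OF 1 3] by simp
qed

text \<open>Conditioning on the sum U of the other summands. If U is within \<eta> * x, then
  \<open>X i\<close> falls in x - U + \<Delta>, of mass at most c1. Otherwise x - U may be anywhere,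
  but \<open>X i > h\<close> still bounds the mass by c2, and this is paid only with the probability
  of a large U.\<close>

lemma jump_upper:
  assumes i: "i \<in> {1..n}" and c: "0 \<le> c1" "0 \<le> c2"
    and near: "\<And>u. \<bar>u\<bar> \<le> \<eta> * x \<Longrightarrow> f (x - u) \<le> c1" and far: "\<And>w. w \<ge> h \<Longrightarrow> f w \<le> c2"
  shows "W.prob {\<omega>\<in>space M. (\<Sum>j=1..n. X j \<omega>) \<in> shifted_Delta x T \<and> h < X i \<omega>}
    \<le> c1 + c2 * W.prob {\<omega>\<in>space M. \<bar>\<Sum>j\<in>{1..n} - {i}. X j \<omega>\<bar> > \<eta> * x}"
proof -
  define U where "U \<omega> = (\<Sum>j\<in>{1..n} - {i}. X j \<omega>)" for \<omega>
  define B where "B = {(y, v). y + v \<in> shifted_Delta x T \<and> h < y}"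
  have Bm: "B \<in> sets (borel \<Otimes>\<^sub>M borel)" unfolding B_def by (rule pair_set_measurable)
  have i1: "i \<ge> 1" using i by simp
  have "W.indep_var borel (X i) borel (\<lambda>\<omega>. (\<lambda>z. \<Sum>j\<in>{1..n} - {i}. z j) (restrict (\<lambda>j. X j \<omega>) ({1..n} - {i})))"
    by (rule W.indep_var_function_of_others[OF i1]) (auto intro!: borel_measurable_sum measurable_component_singleton)
  then have ind: "W.indep_var borel (X i) borel U" by (simp add: U_def[abs_def])
  have Um: "U \<in> borel_measurable M" using ind by (rule W.indep_var_rv2)
  have "{\<omega>\<in>space M. (\<Sum>j=1..n. X j \<omega>) \<in> shifted_Delta x T \<and> h < X i \<omega>} = {\<omega>\<in>space M. (X i \<omega>, U \<omega>) \<in> B}"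
    unfolding B_def U_def using sum_split_off[OF i] by auto
  then have "W.prob {\<omega>\<in>space M. (\<Sum>j=1..n. X j \<omega>) \<in> shifted_Delta x T \<and> h < X i \<omega>} = W.expectation (\<lambda>\<omega>. prob {y. (y, U \<omega>) \<in> B})"
    using W.prob_indep_pair(1)[OF ind i1 Bm] by simp
  also have "\<dots> \<le> W.expectation (\<lambda>\<omega>. c1 + c2 * indicator {\<omega>\<in>space M. \<bar>U \<omega>\<bar> > \<eta> * x} \<omega>)"
  proof (rule integral_mono)
    show "integrable M (\<lambda>\<omega>. prob {y. (y, U \<omega>) \<in> B})"
      by (rule W.integrable_const_bound[where B=1]) (use W.prob_indep_pair(2)[OF ind i1 Bm] in auto)
    show "integrable M (\<lambda>\<omega>. c1 + c2 * indicator {\<omega>\<in>space M. \<bar>U \<omega>\<bar> > \<eta> * x} \<omega>)"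
      by (rule W.integrable_const_bound[where B="c1 + c2"]) (use Um c in \<open>auto split: split_indicator\<close>)
    fix \<omega> assume \<omega>: "\<omega> \<in> space M"
    show "prob {y. (y, U \<omega>) \<in> B} \<le> c1 + c2 * indicator {\<omega>\<in>space M. \<bar>U \<omega>\<bar> > \<eta> * x} \<omega>"
    proof (cases "\<bar>U \<omega>\<bar> \<le> \<eta> * x")
      case True
      have "prob {y. (y, U \<omega>) \<in> B} \<le> prob {y. y + U \<omega> \<in> shifted_Delta x T}"
        unfolding B_def by (intro finite_measure_mono) (auto intro!: measurable_sets[of "\<lambda>y. y + U \<omega>" borel borel, simplified vimage_def, simplified])
      then show ?thesis using near[OF True] True by (simp add: measure_shifted)
    next
      case False
      \<comment> \<open>The part of x - U + \<Delta> above h lies in the translate of \<Delta> that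
        starts at v, and v \<ge> h.\<close>
      define v where "v = max h (x - U \<omega>)"
      have "prob {y. (y, U \<omega>) \<in> B} \<le> prob (shifted_Delta v T)"
      proof (intro finite_measure_mono)
        show "{y. (y, U \<omega>) \<in> B} \<subseteq> shifted_Delta v T"
        proof
          fix y assume "y \<in> {y. (y, U \<omega>) \<in> B}"
          then have y: "0 < y + U \<omega> - x" "ereal (y + U \<omega> - x) \<le> T" "h < y" by (auto simp: B_def mem_shifted_Delta)
          have "ereal (y - v) \<le> ereal (y + U \<omega> - x)" by (simp add: v_def)
          then have "ereal (y - v) \<le> T" using y(2) by (rule order_trans)
          then show "y \<in> shifted_Delta v T" using y by (simp add: mem_shifted_Delta v_def)
        qed
      qed simp
      also have "\<dots> \<le> c2" using far[of v] by (simp add: f_def v_def)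
      finally show ?thesis using False \<omega> c by simp
    qed
  qed
  also have "\<dots> = c1 + c2 * W.prob {\<omega>\<in>space M. \<bar>U \<omega>\<bar> > \<eta> * x}"
  proof -
    have s: "{\<omega>\<in>space M. \<bar>U \<omega>\<bar> > \<eta> * x} \<in> sets M" using Um by measurable
    then have "integrable M (indicator {\<omega>\<in>space M. \<bar>U \<omega>\<bar> > \<eta> * x} :: _ \<Rightarrow> real)"
      by (intro integrable_real_indicator) (auto simp: less_top[symmetric])
    then show ?thesis using s W.prob_space by simp
  qed
  finally show ?thesis by (simp add: U_def)
qed

text \<open>The event also requires every other summand to be at most h, which later makes the
  events for different i disjoint. The loss is the probability that the others have a large sum or
  contain a large summand.\<close>

lemma jump_lower:
  fixes h :: real
  assumes i: "i \<in> {1..n}" and c: "0 \<le> c1" and \<eta>: "\<eta> * x < x"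
    and near: "\<And>u. \<bar>u\<bar> \<le> \<eta> * x \<Longrightarrow> c1 \<le> f (x - u)"
  defines "E \<equiv> {\<omega>\<in>space M. (\<Sum>j=1..n. X j \<omega>) \<in> shifted_Delta x T \<and> \<bar>\<Sum>j\<in>{1..n} - {i}. X j \<omega>\<bar> \<le> \<eta> * x \<and> (\<forall>j\<in>{1..n} - {i}. X j \<omega> \<le> h)}"
  shows "c1 * (1 - W.prob {\<omega>\<in>space M. \<bar>\<Sum>j\<in>{1..n} - {i}. X j \<omega>\<bar> > \<eta> * x} - real n * prob {h<..}) \<le> W.prob E"
    "E \<in> sets M"
proof -
  define J where "J = {1..n} - {i}"
  define good where "good z \<longleftrightarrow> \<bar>\<Sum>j\<in>J. z j\<bar> \<le> \<eta> * x \<and> (\<forall>j\<in>J. z j \<le> h)" for z :: "nat \<Rightarrow> real"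
  \<comment> \<open>The default value x lies outside the range |v| \<le> \<eta> * x because \<eta> *
    x < x. So |V| \<le> \<eta> * x encodes the whole good event, and on it V is the sum.\<close>
  define \<Phi> where "\<Phi> z = (if good z then \<Sum>j\<in>J. z j else x)" for z
  define V where "V \<omega> = \<Phi> (restrict (\<lambda>j. X j \<omega>) J)" for \<omega>
  have fin: "finite J" by (simp add: J_def)
  have good_pred: "Measurable.pred (PiM J (\<lambda>_. borel)) good"
    unfolding good_def using fin by measurable
  have \<Phi>m: "\<Phi> \<in> borel_measurable (PiM J (\<lambda>_. borel))"
    unfolding \<Phi>_def using good_pred fin by (intro measurable_If) (auto intro!: borel_measurable_sum measurable_component_singleton)
  define B where "B = {(y, v). y + v \<in> shifted_Delta x T \<and> \<bar>v\<bar> \<le> \<eta> * x}"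
  have Bm: "B \<in> sets (borel \<Otimes>\<^sub>M borel)" unfolding B_def by (rule pair_set_measurable)
  have i1: "i \<ge> 1" using i by simp
  have ind: "W.indep_var borel (X i) borel V"
    unfolding V_def by (rule W.indep_var_function_of_others[OF i1 _ _ \<Phi>m]) (auto simp: J_def)
  have Vm: "V \<in> borel_measurable M" using ind by (rule W.indep_var_rv2)
  have good_eq: "good (restrict (\<lambda>j. X j \<omega>) J) \<longleftrightarrow> \<bar>\<Sum>j\<in>J. X j \<omega>\<bar> \<le> \<eta> * x \<and> (\<forall>j\<in>J. X j \<omega> \<le> h)" for \<omega>
    by (auto simp: good_def)
  have V_good: "\<bar>V \<omega>\<bar> \<le> \<eta> * x \<longleftrightarrow> \<bar>\<Sum>j\<in>J. X j \<omega>\<bar> \<le> \<eta> * x \<and> (\<forall>j\<in>J. X j \<omega> \<le> h)" for \<omega>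
    unfolding V_def \<Phi>_def using \<eta> good_eq[of \<omega>] by (auto simp: good_def)
  have V_val: "V \<omega> = (\<Sum>j\<in>J. X j \<omega>)" if "\<bar>V \<omega>\<bar> \<le> \<eta> * x" for \<omega>
    using that good_eq[of \<omega>] unfolding V_good by (simp add: V_def \<Phi>_def)
  have EB: "E = {\<omega>\<in>space M. (X i \<omega>, V \<omega>) \<in> B}"
  proof (intro set_eqI)
    fix \<omega>
    show "\<omega> \<in> E \<longleftrightarrow> \<omega> \<in> {\<omega>\<in>space M. (X i \<omega>, V \<omega>) \<in> B}"
    proof (cases "\<bar>V \<omega>\<bar> \<le> \<eta> * x")
      case True
      then show ?thesis using V_val[OF True] V_good[of \<omega>] sum_split_off[OF i, of \<omega>] by (auto simp: E_def B_def J_def)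
    next
      case False
      then show ?thesis using V_good[of \<omega>] by (auto simp: E_def B_def J_def)
    qed
  qed
  have pm: "(\<lambda>\<omega>. (X i \<omega>, V \<omega>)) \<in> measurable M (borel \<Otimes>\<^sub>M borel)"
    using W.rv_X[OF i1] Vm by measurable
  show "E \<in> sets M"
    unfolding EB using measurable_sets[OF pm Bm] by (simp add: vimage_def Int_def conj_commute)
  define A where "A = {\<omega>\<in>space M. \<bar>V \<omega>\<bar> \<le> \<eta> * x}"
  have As: "A \<in> sets M" unfolding A_def using Vm by measurable
  have "c1 * W.prob A = W.expectation (\<lambda>\<omega>. c1 * indicator A \<omega>)" using As by simp
  also have "\<dots> \<le> W.expectation (\<lambda>\<omega>. prob {y. (y, V \<omega>) \<in> B})"
  proof (rule integral_mono)
    show "integrable M (\<lambda>\<omega>. prob {y. (y, V \<omega>) \<in> B})"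
      by (rule W.integrable_const_bound[where B=1]) (use W.prob_indep_pair(2)[OF ind i1 Bm] in auto)
    show "integrable M (\<lambda>\<omega>. c1 * indicator A \<omega>)"
      using As by (intro integrable_mult_right integrable_real_indicator) (auto simp: less_top[symmetric])
    fix \<omega>
    show "c1 * indicator A \<omega> \<le> prob {y. (y, V \<omega>) \<in> B}"
    proof (cases "\<omega> \<in> A")
      case True
      then have "\<bar>V \<omega>\<bar> \<le> \<eta> * x" by (simp add: A_def)
      then have "prob {y. (y, V \<omega>) \<in> B} = f (x - V \<omega>)" by (simp add: B_def measure_shifted)
      then show ?thesis using near[of "V \<omega>"] True by (simp add: A_def)
    qed simp
  qed
  also have "\<dots> = W.prob E" unfolding EB by (rule W.prob_indep_pair(1)[OF ind i1 Bm, symmetric])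
  finally have 1: "c1 * W.prob A \<le> W.prob E" .
  have Us: "{\<omega>\<in>space M. \<bar>\<Sum>j\<in>J. X j \<omega>\<bar> > \<eta> * x} \<in> sets M"
  proof -
    have "(\<lambda>\<omega>. \<Sum>j\<in>J. X j \<omega>) \<in> borel_measurable M" by (rule W.sum_measurable) (auto simp: J_def)
    then show ?thesis by measurable
  qed
  have Xs: "{\<omega>\<in>space M. X j \<omega> \<in> {h<..}} \<in> sets M" if "j \<in> J" for j
  proof -
    have "X j \<in> borel_measurable M" using that by (intro W.rv_X) (simp add: J_def)
    then show ?thesis by measurable
  qed
  have "W.prob (space M - A) \<le> W.prob ({\<omega>\<in>space M. \<bar>\<Sum>j\<in>J. X j \<omega>\<bar> > \<eta> * x} \<union> (\<Union>j\<in>J. {\<omega>\<in>space M. X j \<omega> \<in> {h<..}}))"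
  proof (rule W.finite_measure_mono)
    show "space M - A \<subseteq> {\<omega>\<in>space M. \<bar>\<Sum>j\<in>J. X j \<omega>\<bar> > \<eta> * x} \<union> (\<Union>j\<in>J. {\<omega>\<in>space M. X j \<omega> \<in> {h<..}})"
      unfolding A_def V_good by (auto simp: not_le)
    show "{\<omega>\<in>space M. \<bar>\<Sum>j\<in>J. X j \<omega>\<bar> > \<eta> * x} \<union> (\<Union>j\<in>J. {\<omega>\<in>space M. X j \<omega> \<in> {h<..}}) \<in> sets M"
      by (intro sets.Un sets.finite_UN Us Xs fin)
  qed
  also have "\<dots> \<le> W.prob {\<omega>\<in>space M. \<bar>\<Sum>j\<in>J. X j \<omega>\<bar> > \<eta> * x} + W.prob (\<Union>j\<in>J. {\<omega>\<in>space M. X j \<omega> \<in> {h<..}})"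
    by (intro measure_subadditive Us sets.finite_UN Xs fin) auto
  also have "W.prob (\<Union>j\<in>J. {\<omega>\<in>space M. X j \<omega> \<in> {h<..}}) \<le> (\<Sum>j\<in>J. W.prob {\<omega>\<in>space M. X j \<omega> \<in> {h<..}})"
    using Xs fin by (intro W.finite_measure_subadditive_finite) auto
  also have "\<dots> = (\<Sum>j\<in>J. prob {h<..})"
    by (intro sum.cong refl W.prob_X) (auto simp: J_def)
  also have "\<dots> \<le> real n * prob {h<..}"
  proof -
    have "card J \<le> n" using card_mono[of "{1..n}" J] by (auto simp: J_def)
    then show ?thesis by (simp add: mult_right_mono)
  qed
  finally have 2: "W.prob (space M - A) \<le> W.prob {\<omega>\<in>space M. \<bar>\<Sum>j\<in>J. X j \<omega>\<bar> > \<eta> * x} + real n * prob {h<..}" by simp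
  have "W.prob (space M - A) = 1 - W.prob A" by (rule W.prob_compl[OF As])
  with 2 have "1 - W.prob {\<omega>\<in>space M. \<bar>\<Sum>j\<in>J. X j \<omega>\<bar> > \<eta> * x} - real n * prob {h<..} \<le> W.prob A" by linarith
  then have "c1 * (1 - W.prob {\<omega>\<in>space M. \<bar>\<Sum>j\<in>J. X j \<omega>\<bar> > \<eta> * x} - real n * prob {h<..}) \<le> c1 * W.prob A"
    using c by (intro mult_left_mono)
  with 1 show "c1 * (1 - W.prob {\<omega>\<in>space M. \<bar>\<Sum>j\<in>{1..n} - {i}. X j \<omega>\<bar> > \<eta> * x} - real n * prob {h<..}) \<le> W.prob E"
    by (simp add: J_def)
qed

lemma pS_event: "{\<omega>\<in>space M. (\<Sum>i=1..n. X i \<omega>) \<in> shifted_Delta x T} \<in> sets M"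
  using measurable_sets[OF W.sum_measurable[of "{1..n}"] shifted_Delta_borel[of x T]]
  by (simp add: vimage_def Int_def conj_commute)

lemma pS_upper:
  "pS n x \<le> small n h x + (\<Sum>i=1..n. W.prob {\<omega>\<in>space M. (\<Sum>j=1..n. X j \<omega>) \<in> shifted_Delta x T \<and> h < X i \<omega>})"
proof -
  let ?S = "{\<omega>\<in>space M. (\<Sum>i=1..n. X i \<omega>) \<in> shifted_Delta x T \<and> (\<forall>i\<in>{1..n}. X i \<omega> \<le> h)}"
  let ?E = "\<lambda>i. {\<omega>\<in>space M. (\<Sum>j=1..n. X j \<omega>) \<in> shifted_Delta x T \<and> h < X i \<omega>}"
  have S: "?S \<in> sets M" by (rule W.truncated_event_measurable) simp
  have E: "?E i \<in> sets M" if "i \<in> {1..n}" for i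
  proof -
    have "X i \<in> borel_measurable M" using that by (intro W.rv_X) simp
    then have "{\<omega>\<in>space M. h < X i \<omega>} \<in> sets M" by measurable
    with pS_event have "{\<omega>\<in>space M. (\<Sum>i=1..n. X i \<omega>) \<in> shifted_Delta x T} \<inter> {\<omega>\<in>space M. h < X i \<omega>} \<in> sets M"
      by (rule sets.Int)
    then show ?thesis by (rule back_subst[of "\<lambda>B. B \<in> sets M"]) blast
  qed
  have "pS n x \<le> W.prob (?S \<union> (\<Union>i\<in>{1..n}. ?E i))"
    unfolding pS_def
  proof (rule W.finite_measure_mono)
    show "{\<omega>\<in>space M. (\<Sum>i=1..n. X i \<omega>) \<in> shifted_Delta x T} \<subseteq> ?S \<union> (\<Union>i\<in>{1..n}. ?E i)"
      by (auto simp: not_le)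
    show "?S \<union> (\<Union>i\<in>{1..n}. ?E i) \<in> sets M" by (intro sets.Un sets.finite_UN S E) auto
  qed
  also have "\<dots> \<le> W.prob ?S + W.prob (\<Union>i\<in>{1..n}. ?E i)"
    by (intro measure_subadditive S sets.finite_UN E) auto
  also have "W.prob (\<Union>i\<in>{1..n}. ?E i) \<le> (\<Sum>i=1..n. W.prob (?E i))"
    using E by (intro W.finite_measure_subadditive_finite) auto
  finally show ?thesis by (simp add: small_def)
qed

text \<open>In the upper bound 3 * e collects the sums without a large summand, the shift of f by a
  small rest, and jumps paired with a large rest. In the lower bound the n one-jump events are
  disjoint, each of probability at least (1 - e)^2 * f x, and (1 - e)^2 \<ge> 1 - 3 * e.\<close>

lemma uniform_estimate:
  assumes e: "0 < e" "e < 1"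
  shows "\<forall>\<^sub>F n in sequentially. \<forall>x\<ge>thr t n. \<bar>pS n x / (real n * f x) - 1\<bar> \<le> 3 * e"
proof -
  obtain \<delta> where \<delta>: "\<delta> > 0" "\<delta> \<le> 1/2"
    and sm: "\<And>e. e > 0 \<Longrightarrow> \<forall>\<^sub>F n in sequentially. \<forall>x. thr t n \<le> x \<longrightarrow> small n (\<delta> * x) x \<le> e * (real n * f x)"
    using small_negligible by blast
  obtain \<eta> X1 where \<eta>: "\<eta> > 0" "\<eta> < 1/2" and X1: "X1 > 0"
    and cl: "\<And>x u. x \<ge> X1 \<Longrightarrow> \<bar>u\<bar> \<le> \<eta> * x \<Longrightarrow> (1 - e) * f x \<le> f (x - u) \<and> f (x - u) \<le> (1 + e) * f x"
    using f_shift_close[OF e(1)] by blast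
  obtain X2 C where X2: "X2 > 0" and C: "C > 0"
    and far: "\<And>x w. x \<ge> X2 \<Longrightarrow> w \<ge> \<delta> * x \<Longrightarrow> f w \<le> C * f x"
    using f_le_const[of \<delta>] \<delta> by auto
  obtain X3 where X3: "\<And>x. x \<ge> X3 \<Longrightarrow> 0 < f x" using f_pos by auto
  \<comment> \<open>At most e / C, so that jumps paired with a large rest cost at most e * f x; at
    most e / 2, because the lower bound loses e' twice.\<close>
  define e' where "e' = min (e / C) (e / 2)"
  have e': "e' > 0" "C * e' \<le> e" "e' \<le> e / 2" using e C by (auto simp: e'_def min_def field_simps)
  have t0: "0 < t" using t_gt_1 by simp
  have top: "\<forall>\<^sub>F n in sequentially. max X1 (max X2 X3) \<le> thr t n"
    using thr_at_top[OF t0] by (simp only: filterlim_at_top)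
  have oth: "\<forall>\<^sub>F n in sequentially. \<forall>x. thr t n \<le> x \<longrightarrow> (\<forall>J. J \<subseteq> {1..n} \<longrightarrow>
    W.prob {\<omega>\<in>space M. \<bar>\<Sum>i\<in>J. X i \<omega>\<bar> > \<eta> * x} \<le> e') \<and> real n * prob {\<delta> * x<..} \<le> e'"
    using \<eta> \<delta> e' by (intro others_small) auto
  show ?thesis
    using sm[OF e(1)] top oth eventually_gt_at_top[of 0]
  proof eventually_elim
    case (elim n)
    show ?case
    proof (intro allI impI)
      fix x assume x: "thr t n \<le> x"
      have xs: "X1 \<le> x" "X2 \<le> x" "X3 \<le> x" using elim x by auto
      have x0: "x > 0" using xs X1 by simp
      have fx: "f x > 0" using X3 xs by simp
      have n0: "real n > 0" using elim by simp
      have U: "W.prob {\<omega>\<in>space M. \<bar>\<Sum>j\<in>{1..n} - {i}. X j \<omega>\<bar> > \<eta> * x} \<le> e'" for i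
        using elim x Diff_subset[of "{1..n}" "{i}"] by blast
      have tl: "real n * prob {\<delta> * x<..} \<le> e'" using elim x by blast
      have s: "small n (\<delta> * x) x \<le> e * (real n * f x)" using elim x by blast
      have up: "pS n x \<le> (1 + 3 * e) * (real n * f x)"
      proof -
        have "W.prob {\<omega>\<in>space M. (\<Sum>j=1..n. X j \<omega>) \<in> shifted_Delta x T \<and> \<delta> * x < X i \<omega>} \<le> (1 + 2 * e) * f x"
          if "i \<in> {1..n}" for i
        proof -
          have "W.prob {\<omega>\<in>space M. (\<Sum>j=1..n. X j \<omega>) \<in> shifted_Delta x T \<and> \<delta> * x < X i \<omega>}
            \<le> (1 + e) * f x + C * f x * W.prob {\<omega>\<in>space M. \<bar>\<Sum>j\<in>{1..n} - {i}. X j \<omega>\<bar> > \<eta> * x}"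
            using e fx C cl[OF xs(1)] far[OF xs(2)] by (intro jump_upper that) auto
          also have "\<dots> \<le> (1 + e) * f x + C * f x * e'"
            using U[of i] C fx by (intro add_left_mono mult_left_mono) auto
          also have "C * f x * e' \<le> e * f x" using mult_right_mono[OF e'(2), of "f x"] fx by (simp add: mult_ac)
          finally show ?thesis by (simp add: algebra_simps)
        qed
        then have "(\<Sum>i=1..n. W.prob {\<omega>\<in>space M. (\<Sum>j=1..n. X j \<omega>) \<in> shifted_Delta x T \<and> \<delta> * x < X i \<omega>}) \<le> (\<Sum>i=1..n. (1 + 2 * e) * f x)"
          by (intro sum_mono) auto
        then show ?thesis using pS_upper[of n x "\<delta> * x"] s by (simp add: algebra_simps)
      qed
      have lo: "(1 - 3 * e) * (real n * f x) \<le> pS n x"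
      proof -
        let ?E = "\<lambda>i. {\<omega>\<in>space M. (\<Sum>j=1..n. X j \<omega>) \<in> shifted_Delta x T \<and> \<bar>\<Sum>j\<in>{1..n} - {i}. X j \<omega>\<bar> \<le> \<eta> * x \<and> (\<forall>j\<in>{1..n} - {i}. X j \<omega> \<le> \<delta> * x)}"
        have \<eta>x: "\<eta> * x < x / 2" using \<eta> x0 by simp
        have Ei: "?E i \<in> sets M" "(1 - e) * f x * (1 - e) \<le> W.prob (?E i)" if i: "i \<in> {1..n}" for i
        proof -
          have a: "0 \<le> (1 - e) * f x" using e fx by simp
          have b: "\<eta> * x < x" using \<eta>x x0 by linarith
          note J = jump_lower[OF i a b, of "\<delta> * x"]
          show "?E i \<in> sets M" using J(2) cl[OF xs(1)] by blast
          have "(1 - e) * f x * (1 - W.prob {\<omega>\<in>space M. \<bar>\<Sum>j\<in>{1..n} - {i}. X j \<omega>\<bar> > \<eta> * x} - real n * prob {\<delta> * x<..}) \<le> W.prob (?E i)"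
            using J(1) cl[OF xs(1)] by blast
          moreover have "(1 - e) * f x * (1 - e) \<le> (1 - e) * f x * (1 - W.prob {\<omega>\<in>space M. \<bar>\<Sum>j\<in>{1..n} - {i}. X j \<omega>\<bar> > \<eta> * x} - real n * prob {\<delta> * x<..})"
            using U[of i] tl e' a by (intro mult_left_mono) auto
          ultimately show "(1 - e) * f x * (1 - e) \<le> W.prob (?E i)" by linarith
        qed
        \<comment> \<open>On the intersection X i is at most \<delta> * x \<le> x / 2 by the event
          for j, and the other summands add less than x / 2 by the event for i, against a sum above
          x.\<close>
        have disj: "disjoint_family_on ?E {1..n}"
        proof (unfold disjoint_family_on_def, intro ballI impI)
          fix i j assume ij: "i \<in> {1..n}" "j \<in> {1..n}" "i \<noteq> j"
          show "?E i \<inter> ?E j = {}"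
          proof (intro equals0I)
            fix \<omega> assume w: "\<omega> \<in> ?E i \<inter> ?E j"
            then have "x < (\<Sum>k=1..n. X k \<omega>)" by (auto simp: mem_shifted_Delta)
            moreover have "\<bar>\<Sum>k\<in>{1..n} - {i}. X k \<omega>\<bar> \<le> \<eta> * x" using w by auto
            moreover have "X i \<omega> \<le> \<delta> * x" using w ij by auto
            moreover have "\<delta> * x \<le> x / 2" using \<delta> x0 by simp
            ultimately show False using sum_split_off[OF ij(1), of \<omega>] \<eta>x by linarith
          qed
        qed
        have "(\<Sum>i=1..n. (1 - e) * f x * (1 - e)) \<le> (\<Sum>i=1..n. W.prob (?E i))"
          using Ei by (intro sum_mono) auto
        also have "\<dots> = W.prob (\<Union>i\<in>{1..n}. ?E i)"
          using Ei disj by (intro W.finite_measure_finite_Union[symmetric]) auto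
        also have "\<dots> \<le> pS n x"
          unfolding pS_def by (intro W.finite_measure_mono pS_event) auto
        finally have "real n * ((1 - e) * f x * (1 - e)) \<le> pS n x" by simp
        moreover have "(1 - 3 * e) * (real n * f x) \<le> ((1 - e) * (1 - e)) * (real n * f x)"
          using e fx n0 by (intro mult_right_mono) (auto simp: algebra_simps add_nonneg_nonneg)
        ultimately show ?thesis by (simp add: mult_ac)
      qed
      have pos: "real n * f x > 0" using n0 fx by simp
      have "pS n x / (real n * f x) \<le> 1 + 3 * e" "1 - 3 * e \<le> pS n x / (real n * f x)"
        using up lo by (simp_all only: pos_divide_le_eq[OF pos] pos_le_divide_eq[OF pos])
      then show "\<bar>pS n x / (real n * f x) - 1\<bar> \<le> 3 * e" by linarith
    qed
  qed
qed

lemma uniform_equivalence: "uniformly_equiv_from pS (\<lambda>n x. real n * f x) (thr t)"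
  unfolding uniformly_equiv_from_def
proof (rule tendsto_sandwich[OF _ _ tendsto_const])
  let ?s = "\<lambda>n. SUP x\<in>{thr t n..}. ereal \<bar>pS n x / (real n * f x) - 1\<bar>"
  show "\<forall>\<^sub>F n in sequentially. 0 \<le> ?s n"
    by (intro always_eventually allI SUP_upper2[of "thr t _"]) auto
  show "\<forall>\<^sub>F n in sequentially. ?s n \<le> ?s n" by simp
  show "?s \<longlonglongrightarrow> 0"
  proof (rule order_tendstoI)
    fix a :: ereal assume "a < 0"
    then show "\<forall>\<^sub>F n in sequentially. a < ?s n"
      by (intro always_eventually allI order.strict_trans2[OF _ SUP_upper2[of "thr t _"]]) auto
  next
    fix a :: ereal assume "0 < a"
    then obtain r where r: "0 < ereal r" "ereal r < a" by (metis ereal_dense2)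
    define e where "e = min (r / 3) (1 / 2)"
    have e: "0 < e" "e < 1" "3 * e \<le> r" using r by (auto simp: e_def)
    show "\<forall>\<^sub>F n in sequentially. ?s n < a"
      using uniform_estimate[OF e(1,2)]
    proof eventually_elim
      case (elim n)
      have "?s n \<le> ereal r"
        using elim e by (intro SUP_least) (auto intro: order_trans)
      then show ?case using r by simp
    qed
  qed
qed

end

theorem theorem9p2:
  fixes M :: "'a measure" and X :: "nat \<Rightarrow> 'a \<Rightarrow> real" and D :: "real measure"
    and T :: ereal and \<alpha> \<beta> t :: real and b :: "nat \<Rightarrow> real"
  assumes "prob_space M"
    and "prob_space.indep_vars M (\<lambda>_. borel) X {1..}"
    and "\<And>i. i \<ge> 1 \<Longrightarrow> distr M borel (X i) = D"
    and "0 < T"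
    and "1 < \<alpha>" and "\<alpha> < 2" and "\<alpha> < \<beta>"
    and "regularly_varying (\<lambda>x. cdf D (- x)) (- \<alpha>)"
    and "regularly_varying (\<lambda>x. measure D {x<..}) (- \<beta>)"
    and "integrable D (\<lambda>y. y)" and "(LINT y|D. y) = 0"
    and "filterlim b at_top sequentially"
    and "\<forall>\<^sub>F n in sequentially.
           Gamma (3 - \<alpha>) * real n * truncated_second_moment D (b n) = (\<alpha> - 1) * (b n)\<^sup>2"
    and "limsup (\<lambda>n. ereal (cdf D (- (b n / ln (real n) powr (1 / \<alpha>)))
                             / (ln (real n) * cdf D (- b n)))) \<le> 1"
    and "T < \<infinity> \<Longrightarrow> \<exists>\<rho>. regularly_varying (\<lambda>x. measure D (shifted_Delta x T)) \<rho>"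
    and "1 < t"
  shows "uniformly_equiv_from
           (\<lambda>n x. \<P>(\<omega> in M. (\<Sum>i=1..n. X i \<omega>) \<in> shifted_Delta x T))
           (\<lambda>n x. real n * measure D (shifted_Delta x T))
           (\<lambda>n. t * ((\<beta> - \<alpha>) / (\<alpha> - 1) * ln (real n)) powr ((\<alpha> - 1) / \<alpha>) * b n)"
proof -
  interpret W: iid_walk M X D
    using assms(1-3) by (intro iid_walk.intro iid_walk_axioms.intro) auto
  have rd: "real_distribution D"
    using W.D_prob_space by (intro real_distribution.intro real_distribution_axioms.intro) auto
  \<comment> \<open>For infinite T the set is the half-line above x, so the assumption on the right
    tail supplies the index.\<close>
  have rv: "\<exists>\<rho>. regularly_varying (\<lambda>x. measure D (shifted_Delta x T)) \<rho>"
  proof (cases "T = \<infinity>")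
    case True
    then show ?thesis using assms(4,9) Delta_cases[of T] by auto
  qed (use assms(15) less_top in auto)
  interpret heavy_walk D \<alpha> \<beta> b T M X t
    by (intro heavy_walk.intro heavy_walk_axioms.intro heavy_left_tail_local.intro heavy_left_tail_local_axioms.intro
        heavy_left_tail_norming.intro heavy_left_tail_norming_axioms.intro heavy_left_tail.intro heavy_left_tail_axioms.intro
        rd rv assms W.iid_walk_axioms)
  show ?thesis
    using uniform_equivalence unfolding pS_def[abs_def] f_def[abs_def] thr_def[abs_def] c0_def .
qed

end
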